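(* Let $G$ be a non-complete stiff chordal graph and let $n\ge 0$ be an integer. Then the vertex connectivity satisfies $\kappa(G)=n+1$ if and only if $\mathrm{Conn}(\mathcal{N}(G))=n$.
   Context: Graphs are finite, undirected, without loops or multiple edges. A graph is chordal if it has no induced subgraph isomorphic to a cycle $C_k$ with $k\ge 4$. A graph $G$ is stiff if there are no two distinct vertices $u,v$ with $N_G(u)\subseteq N_G(v)$, where $N_G(\cdot)$ is the set of neighbours. A graph is $k$-connected if for any two distinct vertices $x,y$ there are at least $k$ internally disjoint $xy$-paths (pairwise sharing only $x,y$; a single edge $xy$ counts as one path); the vertex connectivity $\kappa(G)$ is the maximum $k$ for which $G$ is $k$-connected. The neighbourhood complex $\mathcal{N}(G)$ is the simplicial complex whose simplices are the subsets $\sigma\subseteq V(G)$ whose elements have a common neighbour in $G$. A nonempty topological space $X$ is $k$-connected if every map from $S^m$ to $X$ extends to a map from $D^{m+1}$ to $X$, for $m=0,1,\dots,k$; $\mathrm{Conn}(X)$ is the largest integer $k$ such that $X$ is $k$-connected. For a simplicial complex this refers to its geometric realization. *)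

theory Defs
  imports "HOL-Analysis.Analysis" "Graph_Theory.Graph_Theory"
begin

text \<open>
  A finite simple undirected graph is a \<^locale>\<open>pair_graph\<close>: a finite vertex set together with a
  symmetric irreflexive arc relation, an edge being represented by its two orientations.
\<close>

definition neighbours :: "'a pair_pre_digraph \<Rightarrow> 'a \<Rightarrow> 'a set" where
  "neighbours G v = {w. (v, w) \<in> parcs G}"

definition cycle_graph :: "nat \<Rightarrow> nat pair_pre_digraph" where
  "cycle_graph k = \<lparr> pverts = {..<k},
     parcs = {(i, j). i < k \<and> j < k \<and> (j = (i + 1) mod k \<or> i = (j + 1) mod k)} \<rparr>"

definition chordal :: "'a pair_pre_digraph \<Rightarrow> bool" where
  "chordal G \<longleftrightarrow>
     \<not> (\<exists>k\<ge>4. \<exists>H. induced_subgraph H (with_proj G) \<and> digraph_iso H (with_proj (cycle_graph k)))"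

definition stiff :: "'a pair_pre_digraph \<Rightarrow> bool" where
  "stiff G \<longleftrightarrow>
     \<not> (\<exists>u\<in>pverts G. \<exists>v\<in>pverts G. u \<noteq> v \<and> neighbours G u \<subseteq> neighbours G v)"

definition complete_graph :: "'a pair_pre_digraph \<Rightarrow> bool" where
  "complete_graph G \<longleftrightarrow> complete_digraph (card (pverts G)) (with_proj G)"

definition internally_disjoint_paths ::
    "'a pair_pre_digraph \<Rightarrow> 'a \<Rightarrow> 'a \<Rightarrow> 'a list set \<Rightarrow> bool" where
  "internally_disjoint_paths G x y P \<longleftrightarrow>
     (\<forall>p\<in>P. vpath p (with_proj G) \<and> hd p = x \<and> last p = y) \<and>
     (\<forall>p\<in>P. \<forall>q\<in>P. p \<noteq> q \<longrightarrow> set p \<inter> set q = {x, y})"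

definition graph_k_connected :: "nat \<Rightarrow> 'a pair_pre_digraph \<Rightarrow> bool" where
  "graph_k_connected k G \<longleftrightarrow>
     (\<forall>x\<in>pverts G. \<forall>y\<in>pverts G. x \<noteq> y \<longrightarrow>
        (\<exists>P. internally_disjoint_paths G x y P \<and> finite P \<and> k \<le> card P))"

text \<open>
  The maximum exists for every finite graph with at least two vertices, in particular for every
  non-complete finite graph.
\<close>
definition vertex_connectivity :: "'a pair_pre_digraph \<Rightarrow> nat" where
  "vertex_connectivity G = (GREATEST k. graph_k_connected k G)"

text \<open>A simplicial complex is given by the set of its simplices; the empty simplex may be included.\<close>

definition neighbourhood_complex :: "'a pair_pre_digraph \<Rightarrow> 'a set set" where
  "neighbourhood_complex G = {\<sigma>. \<sigma> \<subseteq> pverts G \<and> (\<exists>w\<in>pverts G. \<forall>v\<in>\<sigma>. w \<in> neighbours G v)}"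

text \<open>
  Points are given by barycentric coordinates. The product topology is the usual topology of the
  realization only for complexes with finitely many vertices. The condition on the sum
  excludes the empty support and, by the convention for infinite sums, infinite supports.
\<close>
definition geometric_realization :: "'a set set \<Rightarrow> ('a \<Rightarrow> real) topology" where
  "geometric_realization K = subtopology (powertop_real UNIV)
     {x. (\<forall>v. 0 \<le> x v) \<and> {v. x v \<noteq> 0} \<in> K \<and> (\<Sum>v | x v \<noteq> 0. x v) = 1}"

definition disc :: "nat \<Rightarrow> (nat \<Rightarrow> real) topology" where
  "disc n = subtopology (Euclidean_space n) {x. (\<Sum>i<n. x i ^ 2) \<le> 1}"

text \<open>For negative \<open>k\<close> the condition only requires the space to be nonempty.\<close>
definition space_k_connected :: "int \<Rightarrow> 'b topology \<Rightarrow> bool" where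
  "space_k_connected k X \<longleftrightarrow> topspace X \<noteq> {} \<and>
     (\<forall>m. int m \<le> k \<longrightarrow>
        (\<forall>f. continuous_map (nsphere m) X f \<longrightarrow>
           (\<exists>g. continuous_map (disc (m + 1)) X g \<and> (\<forall>x\<in>topspace (nsphere m). g x = f x))))"

text \<open>
  The largest \<open>k\<close> such that the space is \<open>k\<close>-connected. The supremum is taken in the extended
  reals, so that it is \<open>\<infinity>\<close> for a space that is \<open>k\<close>-connected for all \<open>k\<close>; if it is finite, it is an
  integer and is attained.
\<close>
definition Conn :: "'b topology \<Rightarrow> ereal" where
  "Conn X = (SUP k\<in>{k. space_k_connected k X}. ereal (real_of_int k))"

end

theory Submission
  imports Defs "HOL-Homology.Brouwer_Degree"
begin

text \<open>
  Let \<open>r\<close> be the smallest order of a vertex separation \<open>(A, S, B)\<close> of \<open>G\<close>. For a chordal graph \<open>S\<close> is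
  a clique if \<open>card S = r\<close>, and two arbitrary vertices are joined by \<open>r\<close> internally disjoint paths, as
  one sees by removing simplicial vertices one at a time; hence \<open>r\<close> is the vertex connectivity.

  The neighbourhood complex is \<open>(r - 1)\<close>-connected as soon as \<open>G\<close> contains a clique with \<open>r + 2\<close>
  vertices, which follows from stiffness. Indeed, start with such a clique, whose complex is the
  boundary of a simplex. Adding a simplicial vertex \<open>v\<close> with neighbourhood \<open>Q\<close> amounts to adding the
  simplex \<open>Q\<close> and then a cone over the union of the neighbourhoods of the vertices of \<open>Q\<close>. If \<open>Q\<close> has
  a common neighbour, then \<open>Q\<close> is already present and this union is a cone. Otherwise
  \<open>card Q \<ge> r + 1\<close>, and the union is as highly connected as the boundary of \<open>Q\<close>.

  It is not \<open>r\<close>-connected: choose \<open>a \<in> A\<close> and \<open>b \<in> B\<close> that are adjacent to all vertices of \<open>S\<close>. Collapsing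
  \<open>A\<close> to \<open>a\<close> and \<open>B\<close> to \<open>b\<close> maps the neighbourhood complex to the boundary of the simplex with vertex
  set \<open>S \<union> {a, b}\<close>, which is an \<open>r\<close>-sphere. A map in the opposite direction is given by the inclusion
  except on the faces \<open>S \<union> {a}\<close> and \<open>S \<union> {b}\<close>, where it exists because the neighbourhood complexes of the
  subgraphs induced by \<open>A \<union> S\<close> and \<open>B \<union> S\<close> are \<open>(r - 1)\<close>-connected. The composition preserves the
  faces, so it is homotopic to the identity of the sphere.
\<close>

section \<open>Separations of chordal graphs\<close>

text \<open>The induction over induced subgraphs dictates the hypotheses. Chordality and
  \<open>sep_order_ge r\<close> survive the deletion of a simplicial vertex, stiffness need not; so
  stiffness is used only to produce a clique with \<open>r + 2\<close> vertices, and this clique is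
  carried along. As long as the graph is not complete, Dirac's theorem supplies a simplicial vertex
  outside any given clique, so the clique is never destroyed. The link between combinatorics and
  topology is that a clique with at most \<open>r\<close> vertices that is not the whole graph has a
  common neighbour outside itself; hence the simplex \<open>Q\<close> is either redundant or large.
  On the topological side connectivity is treated as solvability of extension problems, never
  through homotopy groups. Two open sets are glued by a nullhomotopy built cube by cube, so neither
  van Kampen nor Hurewicz is involved; homology enters only through the noncontractibility of
  spheres. As the argument alternates between round balls, cubes and simplices, extension problems
  have to be moved between different unit balls.\<close>

locale sgraph =
  fixes E :: "'a \<Rightarrow> 'a \<Rightarrow> bool"
  assumes E_sym: "E x y \<Longrightarrow> E y x"
    and E_irrefl: "\<not> E x x"
begin

definition clique :: "'a set \<Rightarrow> bool" where
  "clique S \<longleftrightarrow> (\<forall>x\<in>S. \<forall>y\<in>S. x \<noteq> y \<longrightarrow> E x y)"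

definition nbh :: "'a set \<Rightarrow> 'a \<Rightarrow> 'a set" where
  "nbh W v = {w\<in>W. E v w}"

definition simplicial :: "'a set \<Rightarrow> 'a \<Rightarrow> bool" where
  "simplicial W v \<longleftrightarrow> v \<in> W \<and> clique (nbh W v)"

definition chordal_on :: "'a set \<Rightarrow> bool" where
  "chordal_on W \<longleftrightarrow> \<not> (\<exists>k\<ge>4. \<exists>c::nat \<Rightarrow> 'a. inj_on c {..<k} \<and> c ` {..<k} \<subseteq> W \<and>
     (\<forall>i<k. \<forall>j<k. E (c i) (c j) \<longleftrightarrow> j = (i + 1) mod k \<or> i = (j + 1) mod k))"

definition separation :: "'a set \<Rightarrow> 'a set \<Rightarrow> 'a set \<Rightarrow> 'a set \<Rightarrow> bool" where
  "separation W A S B \<longleftrightarrow> W = A \<union> S \<union> B \<and> A \<inter> S = {} \<and> A \<inter> B = {} \<and> S \<inter> B = {} \<and>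
     A \<noteq> {} \<and> B \<noteq> {} \<and> (\<forall>a\<in>A. \<forall>b\<in>B. \<not> E a b)"

text \<open>Vacuous for a clique, whatever \<open>r\<close> is. This keeps the property stable under
  deletion of simplicial vertices down to a clique; lower bounds on \<open>card W\<close> are
  therefore stated separately where they matter.\<close>

definition sep_order_ge :: "nat \<Rightarrow> 'a set \<Rightarrow> bool" where
  "sep_order_ge r W \<longleftrightarrow> (\<forall>A S B. separation W A S B \<longrightarrow> r \<le> card S)"

lemma chordal_on_subset: "chordal_on W \<Longrightarrow> W' \<subseteq> W \<Longrightarrow> chordal_on W'"
  unfolding chordal_on_def by (meson order_trans)

lemma clique_subset: "clique S \<Longrightarrow> T \<subseteq> S \<Longrightarrow> clique T"
  unfolding clique_def by blast

lemma clique_insert: "clique S \<Longrightarrow> S \<subseteq> nbh W v \<Longrightarrow> clique (insert v S)"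
  unfolding clique_def nbh_def using E_sym by blast

lemma separation_sym: "separation W A S B \<Longrightarrow> separation W B S A"
  unfolding separation_def using E_sym by blast

lemma nonclique_separation:
  assumes "x \<in> W" "y \<in> W" "x \<noteq> y" "\<not> E x y"
  shows "separation W {x} (W - {x, y}) {y}"
  using assms unfolding separation_def by auto

lemma clique_no_separation: "clique W \<Longrightarrow> \<not> separation W A S B"
  unfolding clique_def separation_def by (metis Un_iff disjoint_iff ex_in_conv)

lemma ex_minimum_separation:
  assumes "finite W" "\<not> clique W"
  obtains A S B where "separation W A S B" "sep_order_ge (card S) W"
proof -
  let ?P = "\<lambda>n. \<exists>A S B. separation W A S B \<and> card S = n"
  have "\<exists>n. ?P n"
    using assms(2) nonclique_separation unfolding clique_def by blast
  then have "?P (LEAST n. ?P n)" by (rule LeastI_ex)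
  moreover have "sep_order_ge (LEAST n. ?P n) W"
    unfolding sep_order_ge_def by (blast intro: Least_le)
  ultimately show thesis using that by metis
qed

section \<open>Shortest walks and induced cycles\<close>

definition walk_in :: "'a set \<Rightarrow> 'a \<Rightarrow> 'a \<Rightarrow> 'a list \<Rightarrow> bool" where
  "walk_in X s t p \<longleftrightarrow> p \<noteq> [] \<and> hd p = s \<and> last p = t \<and> set p \<subseteq> X \<and> successively E p"

lemma walk_in_shortcut:
  assumes p: "walk_in X s t p" and ij: "i < j" "j < length p" and E: "E (p ! i) (p ! j)"
  shows "walk_in X s t (take (Suc i) p @ drop j p)"
proof -
  have ne: "drop j p \<noteq> []" "take (Suc i) p \<noteq> []" using ij by auto
  have "last (take (Suc i) p) = p ! i" using ij by (simp add: take_Suc_conv_app_nth)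
  moreover have "hd (drop j p) = p ! j" using ij by (simp add: hd_drop_conv_nth)
  moreover have "successively E (take (Suc i) p)" "successively E (drop j p)"
    using p unfolding walk_in_def
    by (metis append_take_drop_id successively_append_iff)+
  ultimately have "successively E (take (Suc i) p @ drop j p)"
    using E ne by (simp add: successively_append_iff)
  moreover have "hd (take (Suc i) p @ drop j p) = s"
    using p ne unfolding walk_in_def by (simp add: hd_append)
  moreover have "last (take (Suc i) p @ drop j p) = t"
    using p ne unfolding walk_in_def by simp
  moreover have "set (take (Suc i) p @ drop j p) \<subseteq> X"
    using p unfolding walk_in_def by (auto dest: in_set_takeD in_set_dropD)
  ultimately show ?thesis using ne unfolding walk_in_def by simp
qed

lemma walk_in_cut_cycle:
  assumes p: "walk_in X s t p" and ij: "i < j" "j < length p" and eq: "p ! i = p ! j"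
  shows "walk_in X s t (take i p @ drop j p)"
proof (cases i)
  case 0
  have j: "j < length p" "p ! j = hd p" "p \<noteq> []"
    using assms 0 unfolding walk_in_def by (auto simp: hd_conv_nth)
  have "successively E (drop j p)"
    using p unfolding walk_in_def by (metis append_take_drop_id successively_append_iff)
  then show ?thesis using p j 0 set_drop_subset[of j p] unfolding walk_in_def
    by (auto simp: hd_drop_conv_nth)
next
  case (Suc i')
  \<comment> \<open>By \<open>p ! i = p ! j\<close> this edge also leads to \<open>p ! j\<close>, so
    removing the loop is a shortcut from \<open>i'\<close> to \<open>j\<close>.\<close>
  have "E (p ! i') (p ! i)"
    using p ij Suc unfolding walk_in_def by (metis Suc_lessD successively_nth order_less_trans)
  then show ?thesis using walk_in_shortcut[OF p, of i' j] ij eq Suc by simp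
qed

text \<open>A walk of least length works: a repeated vertex or a chord would give a shorter walk
  with the same ends in the same set.\<close>

lemma ex_induced_path:
  assumes "walk_in X s t p"
  obtains q where "walk_in X s t q"
    "\<And>i j. i < j \<Longrightarrow> j < length q \<Longrightarrow> q ! i \<noteq> q ! j \<and> (E (q ! i) (q ! j) \<longleftrightarrow> j = Suc i)"
proof -
  define q where "q = arg_min length (walk_in X s t)"
  have q: "walk_in X s t q" and q_min: "\<And>q'. walk_in X s t q' \<Longrightarrow> length q \<le> length q'"
    using arg_min_nat_lemma[of "walk_in X s t" p length] assms unfolding q_def by auto
  have "q ! i \<noteq> q ! j \<and> (E (q ! i) (q ! j) \<longleftrightarrow> j = Suc i)" if ij: "i < j" "j < length q" for i j
  proof (intro conjI notI iffI)
    assume "q ! i = q ! j"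
    from q_min[OF walk_in_cut_cycle[OF q ij this]] show False using ij by simp
  next
    assume "E (q ! i) (q ! j)"
    from q_min[OF walk_in_shortcut[OF q ij this]] show "j = Suc i" using ij by simp
  next
    assume "j = Suc i"
    then show "E (q ! i) (q ! j)" using q ij unfolding walk_in_def by (metis successively_nth)
  qed
  then show thesis using q that by blast
qed

text \<open>Induced paths from \<open>s\<close> to \<open>t\<close> through \<open>A\<close> and
  back through \<open>B\<close> close up to an induced cycle, as nothing joins \<open>A\<close> to
  \<open>B\<close>. Since \<open>s\<close> and \<open>t\<close> are not adjacent, each path has at
  least two edges, so the cycle has length at least 4.\<close>

lemma two_paths_not_chordal:
  assumes A: "walk_in (A \<union> {s, t}) s t p" and B: "walk_in (B \<union> {s, t}) t s q"
    and no: "\<And>a b. a \<in> A \<Longrightarrow> b \<in> B \<Longrightarrow> \<not> E a b" "A \<inter> B = {}"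
    and disj: "s \<notin> A" "s \<notin> B" "t \<notin> A" "t \<notin> B"
    and st: "s \<noteq> t" "\<not> E s t"
    and W: "A \<union> B \<union> {s, t} \<subseteq> W"
  shows "\<not> chordal_on W"
proof -
  obtain p where p: "walk_in (A \<union> {s, t}) s t p"
    and pi: "\<And>i j. i < j \<Longrightarrow> j < length p \<Longrightarrow> p ! i \<noteq> p ! j \<and> (E (p ! i) (p ! j) \<longleftrightarrow> j = Suc i)"
    using ex_induced_path[OF A] by blast
  obtain q where q: "walk_in (B \<union> {s, t}) t s q"
    and qi: "\<And>i j. i < j \<Longrightarrow> j < length q \<Longrightarrow> q ! i \<noteq> q ! j \<and> (E (q ! i) (q ! j) \<longleftrightarrow> j = Suc i)"
    using ex_induced_path[OF B] by blast
  define m where "m = length p - 1"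
  define n where "n = length q - 1"
  have p0: "p ! 0 = s" and pm: "p ! m = t" and lp: "length p = Suc m"
    using p unfolding walk_in_def m_def by (auto simp: hd_conv_nth last_conv_nth)
  have q0: "q ! 0 = t" and qn: "q ! n = s" and lq: "length q = Suc n"
    using q unfolding walk_in_def n_def by (auto simp: hd_conv_nth last_conv_nth)
  have m: "m \<ge> 2"
  proof -
    have "m \<noteq> 0" using p0 pm st(1) by metis
    moreover have "m \<noteq> 1" using p0 pm st pi[of 0 1] lp by auto
    ultimately show ?thesis by simp
  qed
  have n: "n \<ge> 2"
  proof -
    have "n \<noteq> 0" using q0 qn st(1) by metis
    moreover have "n \<noteq> 1" using q0 qn st E_sym qi[of 0 1] lq by auto
    ultimately show ?thesis by simp
  qed
  have pA: "p ! i \<in> A" if "0 < i" "i < m" for i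
  proof -
    have "p ! i \<in> A \<union> {s, t}" using p that lp unfolding walk_in_def by (metis less_SucI nth_mem subsetD)
    moreover have "p ! i \<noteq> s" using pi[of 0 i] that lp p0 by auto
    moreover have "p ! i \<noteq> t" using pi[of i m] that lp pm by auto
    ultimately show ?thesis by blast
  qed
  have qB: "q ! i \<in> B" if "0 < i" "i < n" for i
  proof -
    have "q ! i \<in> B \<union> {s, t}" using q that lq unfolding walk_in_def by (metis less_SucI nth_mem subsetD)
    moreover have "q ! i \<noteq> t" using qi[of 0 i] that lq q0 by auto
    moreover have "q ! i \<noteq> s" using qi[of i n] that lq qn by auto
    ultimately show ?thesis by blast
  qed
  \<comment> \<open>The cycle is \<open>p\<close> without its end \<open>t\<close>, followed by
    \<open>q\<close> without its end \<open>s\<close>; index \<open>m\<close> is \<open>t\<close>,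
    and index \<open>k\<close> would be \<open>s\<close> again.\<close>
  define k where "k = m + n"
  define c where "c i = (if i < m then p ! i else q ! (i - m))" for i
  have main: "c i \<noteq> c j \<and> (E (c i) (c j) \<longleftrightarrow> j = Suc i \<or> (i = 0 \<and> j = k - 1))" if ij: "i < j" "j < k" for i j
  proof -
    consider "j < m" | "m \<le> i" | "i < m" "j = m" | "i = 0" "j > m" | "0 < i" "i < m" "j > m"
      using ij by linarith
    then show ?thesis
    proof cases
      case 1
      then show ?thesis using pi[of i j] ij lp n by (auto simp: c_def k_def)
    next
      case 2
      then have "c i = q ! (i - m)" "c j = q ! (j - m)" using ij by (auto simp: c_def)
      moreover have "i - m < j - m" "j - m < length q" using 2 ij lq by (auto simp: k_def)
      ultimately show ?thesis using qi[of "i - m" "j - m"] 2 m by auto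
    next
      case 3
      then have "c i = p ! i" "c j = p ! m" using q0 pm by (auto simp: c_def)
      then show ?thesis using pi[of i m] 3 lp n by (auto simp: k_def)
    next
      case 4
      \<comment> \<open>Here \<open>c 0 = s\<close> is read as the end of \<open>q\<close>, so that
        both vertices lie on the induced path \<open>q\<close>; adjacency then occurs exactly for
        the closing edge.\<close>
      then have "c i = q ! n" "c j = q ! (j - m)" using m p0 qn by (auto simp: c_def)
      moreover have "j - m < n" using 4 ij by (auto simp: k_def)
      ultimately show ?thesis using qi[of "j - m" n] E_sym[of "c i" "c j"] E_sym[of "c j" "c i"] 4 lq m
        by (auto simp: k_def)
    next
      case 5
      have "c i \<in> A" using pA[of i] 5 by (auto simp: c_def)
      moreover have "c j \<in> B" using qB[of "j - m"] 5 ij by (auto simp: c_def k_def)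
      ultimately show ?thesis using no 5 by auto
    qed
  qed
  have k: "k \<ge> 4" using m n by (simp add: k_def)
  have inj: "inj_on c {..<k}"
    by (rule linorder_inj_onI') (use main in auto)
  have sub: "c ` {..<k} \<subseteq> W"
  proof -
    have "c i \<in> A \<union> B \<union> {s, t}" if "i < k" for i
    proof (cases "i < m")
      case True
      then show ?thesis using pA[of i] p0 by (cases "i = 0") (auto simp: c_def)
    next
      case False
      then show ?thesis using qB[of "i - m"] q0 that by (cases "i = m") (auto simp: c_def k_def)
    qed
    then show ?thesis using W by blast
  qed
  have md: "j = (i + 1) mod k \<or> i = (j + 1) mod k \<longleftrightarrow> j = Suc i \<or> (i = 0 \<and> j = k - 1)"
    if "i < j" "j < k" for i j
    using that by (cases "Suc j = k") auto
  have "E (c i) (c j) \<longleftrightarrow> j = (i + 1) mod k \<or> i = (j + 1) mod k" if "i < k" "j < k" for i j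
  proof (cases i j rule: linorder_cases)
    case less then show ?thesis using main md that by blast
  next
    case equal
    have "(i + 1) mod k \<noteq> i" using that k by (cases "Suc i = k") auto
    then show ?thesis using equal E_irrefl by metis
  next
    case greater
    then have "E (c j) (c i) \<longleftrightarrow> i = (j + 1) mod k \<or> j = (i + 1) mod k" using main md that by blast
    then show ?thesis using E_sym by blast
  qed
  then show ?thesis unfolding chordal_on_def using k inj sub by blast
qed

text \<open>Otherwise let \<open>R\<close> be the part of \<open>A\<close> reachable from
  \<open>s\<close> through \<open>A\<close>. If \<open>s\<close> had no neighbour in
  \<open>A\<close>, it could be moved to \<open>B\<close>; so \<open>R\<close> is nonempty, none of
  its vertices is adjacent to \<open>t\<close>, and \<open>S - {t}\<close> separates
  \<open>R\<close> from everything else. Either way a separator smaller than \<open>S\<close>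
  results.\<close>

lemma minimum_separation_walk:
  assumes sep: "separation W A S B" and min: "sep_order_ge (card S) W" and fin: "finite W"
    and s: "s \<in> S" and t: "t \<in> S"
  shows "\<exists>p. walk_in (A \<union> {s, t}) s t p"
proof (rule ccontr)
  assume no: "\<not> ?thesis"
  define R where "R = {x\<in>A. \<exists>p. walk_in (A \<union> {s}) s x p}"
  have finS: "finite S" using sep fin unfolding separation_def by auto
  have smaller: "\<not> separation W A' (S - {x}) B'" if "x \<in> S" for A' B' x
    using min that finS unfolding sep_order_ge_def
    by (metis card_Diff1_less linorder_not_le)
  have ws: "walk_in (A \<union> {s}) s s [s]" by (simp add: walk_in_def)
  have ext: "walk_in (A \<union> {s}) s y (p @ [y])" if "walk_in (A \<union> {s}) s x p" "E x y" "y \<in> A" for x y p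
    using that unfolding walk_in_def by (auto simp: successively_append_iff)
  have "\<exists>x\<in>A. E s x"
  proof (rule ccontr)
    assume "\<not> (\<exists>x\<in>A. E s x)"
    then have "separation W A (S - {s}) (insert s B)"
      using sep s E_sym unfolding separation_def by auto
    then show False using smaller s by blast
  qed
  then have R_ne: "R \<noteq> {}" using ext[OF ws] unfolding R_def by blast
  have Rt: "\<not> E x t" if "x \<in> R" for x
  proof
    assume Ext: "E x t"
    obtain p where "walk_in (A \<union> {s}) s x p" using \<open>x \<in> R\<close> unfolding R_def by blast
    then have "walk_in (A \<union> {s, t}) s t (p @ [t])"
      using Ext unfolding walk_in_def by (auto simp: successively_append_iff)
    then show False using no by blast
  qed
  have "separation W R (S - {t}) (W - R - (S - {t}))"
    unfolding separation_def
  proof (intro conjI ballI)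
    show "W = R \<union> (S - {t}) \<union> (W - R - (S - {t}))" using sep unfolding separation_def R_def by auto
    show "R \<inter> (S - {t}) = {}" using sep unfolding separation_def R_def by auto
    show "W - R - (S - {t}) \<noteq> {}" using sep unfolding separation_def R_def by auto
    fix a b assume a: "a \<in> R" and b: "b \<in> W - R - (S - {t})"
    show "\<not> E a b"
    proof
      assume E: "E a b"
      have "b \<noteq> t" using Rt a E by blast
      then have "b \<in> A \<or> b \<in> B" using b sep unfolding separation_def by blast
      moreover have "b \<notin> B" using sep a E unfolding separation_def R_def by blast
      moreover have "b \<notin> A" using a b E ext unfolding R_def by blast
      ultimately show False by blast
    qed
  qed (use R_ne in auto)
  then show False using smaller t by blast
qed

text \<open>Two non-adjacent vertices of \<open>S\<close> would be joined by walks through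
  \<open>A\<close> and through \<open>B\<close>, contradicting chordality.\<close>

lemma minimum_separation_clique:
  assumes ch: "chordal_on W" and sep: "separation W A S B" and min: "sep_order_ge (card S) W"
    and fin: "finite W"
  shows "clique S"
  unfolding clique_def
proof (intro ballI impI, rule ccontr)
  fix s t assume st: "s \<in> S" "t \<in> S" "s \<noteq> t" "\<not> E s t"
  obtain p where p: "walk_in (A \<union> {s, t}) s t p"
    using minimum_separation_walk[OF sep min fin] st by blast
  obtain q where q: "walk_in (B \<union> {s, t}) t s q"
    using minimum_separation_walk[OF separation_sym[OF sep] min fin, of t s] st
    by (auto simp: insert_commute)
  have "\<not> chordal_on W"
    using sep st by (intro two_paths_not_chordal[OF p q]) (auto simp: separation_def)
  then show False using ch by blast
qed

section \<open>Simplicial vertices\<close>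

lemma simplicial_extend:
  assumes "separation W A S B" "simplicial (A \<union> S) v" "v \<in> A"
  shows "simplicial W v"
proof -
  have "nbh W v = nbh (A \<union> S) v" using assms unfolding separation_def nbh_def by auto
  then show ?thesis using assms unfolding simplicial_def separation_def by auto
qed

text \<open>Dirac's theorem. Each side of a minimum separation contains a simplicial vertex, and
  vertices of different sides are not adjacent. The induction is applied to
  \<open>A \<union> S\<close>; the clique \<open>S\<close> cannot contain both of two non-adjacent
  simplicial vertices, and one lying in \<open>A\<close> stays simplicial in
  \<open>W\<close>.\<close>

lemma Dirac_two_simplicial:
  assumes "finite W" "chordal_on W" "\<not> clique W"
  shows "\<exists>u v. simplicial W u \<and> simplicial W v \<and> u \<noteq> v \<and> \<not> E u v"
  using assms
proof (induction "card W" arbitrary: W rule: less_induct)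
  case less
  obtain A S B where sep: "separation W A S B" and min: "sep_order_ge (card S) W"
    using ex_minimum_separation less.prems by blast
  have cl: "clique S" using minimum_separation_clique less.prems sep min by blast
  have *: "\<exists>v\<in>A. simplicial W v" if sep: "separation W A S B" for A B
  proof (cases "clique (A \<union> S)")
    case True
    obtain v where "v \<in> A" using sep unfolding separation_def by blast
    moreover have "simplicial (A \<union> S) v"
      using \<open>v \<in> A\<close> clique_subset[OF True, of "nbh (A \<union> S) v"] unfolding simplicial_def nbh_def by auto
    ultimately show ?thesis using simplicial_extend[OF sep] by blast
  next
    case False
    have "A \<union> S \<subset> W" using sep unfolding separation_def by blast
    then obtain u v where uv: "simplicial (A \<union> S) u" "simplicial (A \<union> S) v" "u \<noteq> v" "\<not> E u v"
      using less.hyps[OF psubset_card_mono[OF less.prems(1)], of "A \<union> S"] less.prems(1,2) False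
        chordal_on_subset[of W "A \<union> S"] finite_subset[of "A \<union> S" W] by blast
    then have "u \<in> A \<or> v \<in> A" using cl unfolding simplicial_def clique_def by blast
    then show ?thesis using uv simplicial_extend[OF sep] by blast
  qed
  obtain u where "u \<in> A" "simplicial W u" using *[OF sep] by blast
  moreover obtain v where "v \<in> B" "simplicial W v" using *[OF separation_sym[OF sep]] by blast
  ultimately show ?case using sep unfolding separation_def by blast
qed

text \<open>The form in which Dirac's theorem drives the later inductions on \<open>card W\<close>:
  the vertex to be deleted avoids the clique \<open>K\<close> that has to be kept.\<close>

lemma ex_simplicial_not_in_clique:
  assumes "finite W" "chordal_on W" "\<not> clique W" "clique K"
  obtains v where "simplicial W v" "v \<notin> K"
  using Dirac_two_simplicial[OF assms(1-3)] assms(4) unfolding clique_def by blast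

text \<open>The neighbours of \<open>v\<close> separate \<open>v\<close> from the other vertices, of
  which there are some: otherwise \<open>W\<close> would consist of \<open>v\<close> and a clique of
  neighbours, and be a clique itself.\<close>

lemma simplicial_degree:
  assumes "simplicial W v" "\<not> clique W" "sep_order_ge r W"
  shows "r \<le> card (nbh W v)" "nbh W v \<noteq> W - {v}"
proof -
  show *: "nbh W v \<noteq> W - {v}"
  proof
    assume "nbh W v = W - {v}"
    then have "clique (insert v (W - {v}))"
      using assms(1) clique_insert[of "W - {v}" W v] unfolding simplicial_def by simp
    then show False using assms unfolding simplicial_def by (simp add: insert_absorb)
  qed
  have "separation W {v} (nbh W v) (W - {v} - nbh W v)"
    using * assms(1) E_irrefl unfolding separation_def simplicial_def nbh_def by auto
  then show "r \<le> card (nbh W v)" using assms(3) unfolding sep_order_ge_def by blast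
qed

text \<open>The neighbours of \<open>v\<close> form a clique, hence do not meet both sides of a
  separation of \<open>W - {v}\<close>; so \<open>v\<close> can be added to one side without
  enlarging \<open>S\<close>.\<close>

lemma sep_order_ge_remove_simplicial:
  assumes v: "simplicial W v" and W: "sep_order_ge r W"
  shows "sep_order_ge r (W - {v})"
  unfolding sep_order_ge_def
proof (intro allI impI)
  fix A S B assume sep: "separation (W - {v}) A S B"
  have "separation W (insert v A) S B \<or> separation W A S (insert v B)"
  proof (cases "\<exists>a\<in>A. E v a")
    case True
    then obtain a where a: "a \<in> A" "E v a" by blast
    have "\<not> E v b" if "b \<in> B" for b
    proof
      assume "E v b"
      then have "a \<in> nbh W v" "b \<in> nbh W v" "a \<noteq> b"
        using a that sep unfolding separation_def nbh_def by auto
      then have "E a b" using v unfolding simplicial_def clique_def by blast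
      then show False using sep a that unfolding separation_def by blast
    qed
    then have "separation W (insert v A) S B"
      using sep v unfolding separation_def simplicial_def by auto
    then show ?thesis ..
  next
    case False
    then have "separation W A S (insert v B)"
      using sep v E_sym unfolding separation_def simplicial_def by auto
    then show ?thesis ..
  qed
  then show "r \<le> card S" using W unfolding sep_order_ge_def by blast
qed

text \<open>A separation of \<open>A \<union> S\<close> has a side that the clique \<open>S\<close>
  does not meet. That side has no neighbours in \<open>B\<close>, so \<open>B\<close> can be added
  to the other side, which gives a separation of \<open>W\<close> with the same separator.\<close>

lemma sep_order_ge_side:
  assumes sep: "separation W A S B" and cl: "clique S" and W: "sep_order_ge r W"
  shows "sep_order_ge r (A \<union> S)"
  unfolding sep_order_ge_def
proof (intro allI impI)
  fix A1 S1 B1 assume sep1: "separation (A \<union> S) A1 S1 B1"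
  have *: "r \<le> card S1" if sep1: "separation (A \<union> S) A1 S1 B1" and dj: "S \<inter> A1 = {}" for A1 B1
  proof -
    have "A1 \<subseteq> A" using sep1 dj unfolding separation_def by auto
    moreover from this have "\<not> E a b" if "a \<in> A1" "b \<in> B1 \<union> B" for a b
      using sep sep1 that unfolding separation_def by (metis UnE subsetD)
    moreover have "W = A1 \<union> S1 \<union> (B1 \<union> B)"
      using sep sep1 unfolding separation_def by (simp add: Un_assoc)
    moreover have "(A \<union> S) \<inter> B = {}" "B \<noteq> {}" using sep unfolding separation_def by auto
    moreover have "S1 \<subseteq> A \<union> S" "A1 \<inter> S1 = {}" "A1 \<inter> B1 = {}" "S1 \<inter> B1 = {}" "A1 \<noteq> {}"
      using sep1 unfolding separation_def by auto
    ultimately have "separation W A1 S1 (B1 \<union> B)"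
      unfolding separation_def by auto
    then show ?thesis using W unfolding sep_order_ge_def by blast
  qed
  have "S \<inter> A1 = {} \<or> S \<inter> B1 = {}"
  proof (rule ccontr)
    assume "\<not> ?thesis"
    then obtain x y where xy: "x \<in> S" "x \<in> A1" "y \<in> S" "y \<in> B1" by blast
    then have "x \<noteq> y" "\<not> E x y" using sep1 unfolding separation_def by auto
    then show False using cl xy unfolding clique_def by blast
  qed
  then show "r \<le> card S1"
    using *[OF sep1] *[OF separation_sym[OF sep1]] by blast
qed

text \<open>Simplicial vertices outside \<open>S\<close> are deleted until the rest is a clique or
  consists of \<open>S\<close> and one vertex \<open>v\<close>. In the latter case the degree of
  \<open>v\<close> is at least \<open>r \<ge> card S\<close>, which forces \<open>v\<close> to be
  adjacent to all of \<open>S\<close>.\<close>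

lemma small_clique_extends:
  assumes "finite W" "chordal_on W" "sep_order_ge r W" "clique S" "S \<subseteq> W" "S \<noteq> W" "card S \<le> r"
  shows "\<exists>w\<in>W - S. S \<subseteq> nbh W w"
  using assms
proof (induction "card W" arbitrary: W rule: less_induct)
  case less
  show ?case
  proof (cases "clique W")
    case True
    obtain w where w: "w \<in> W" "w \<notin> S" using less.prems(5,6) by blast
    have "x \<in> nbh W w" if "x \<in> S" for x
    proof -
      have "x \<in> W" "x \<noteq> w" using that w less.prems(5) by auto
      then show ?thesis using True w unfolding clique_def nbh_def by auto
    qed
    then have "S \<subseteq> nbh W w" by blast
    then show ?thesis using w by blast
  next
    case False
    obtain v where v: "simplicial W v" "v \<notin> S"
      using ex_simplicial_not_in_clique less.prems False by metis
    have vW: "v \<in> W" using v unfolding simplicial_def by blast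
    have deg: "r \<le> card (nbh W v)" using simplicial_degree v False less.prems by blast
    show ?thesis
    proof (cases "S = W - {v}")
      case True
      then have "nbh W v \<subseteq> S" using E_irrefl unfolding nbh_def by auto
      moreover have "finite S" using less.prems finite_subset by blast
      ultimately have "nbh W v = S" using deg less.prems(7) by (meson card_seteq le_trans)
      then show ?thesis using v vW by blast
    next
      case S: False
      have "card (W - {v}) < card W" using vW less.prems by (meson card_Diff1_less)
      moreover have "sep_order_ge r (W - {v})"
        using sep_order_ge_remove_simplicial v less.prems by blast
      moreover have "chordal_on (W - {v})" using chordal_on_subset less.prems by blast
      ultimately obtain w where "w \<in> W - {v} - S" "S \<subseteq> nbh (W - {v}) w"
        using less.hyps[of "W - {v}"] less.prems S v by blast
      then show ?thesis unfolding nbh_def by blast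
    qed
  qed
qed

text \<open>The clique grows from \<open>{y}\<close> by one common neighbour at a time. The last
  step starts from a clique with \<open>n \<le> r\<close> vertices, hence the bound
  \<open>r + 1\<close> on the size.\<close>

lemma ex_clique_of_size:
  assumes "finite W" "chordal_on W" "sep_order_ge r W" "y \<in> W" "Suc n \<le> card W" "n \<le> r"
  shows "\<exists>Y. clique Y \<and> Y \<subseteq> W \<and> y \<in> Y \<and> card Y = Suc n"
  using assms(5,6)
proof (induction n)
  case 0
  then show ?case using assms by (intro exI[of _ "{y}"]) (auto simp: clique_def)
next
  case (Suc n)
  then obtain Y where Y: "clique Y" "Y \<subseteq> W" "y \<in> Y" "card Y = Suc n" by auto
  then have "Y \<noteq> W" using Suc by auto
  then obtain w where "w \<in> W - Y" "Y \<subseteq> nbh W w"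
    using small_clique_extends[OF assms(1-3)] Y Suc by metis
  then show ?case using Y clique_insert finite_subset[OF Y(2) assms(1)]
    by (intro exI[of _ "insert w Y"]) auto
qed

section \<open>Internally disjoint paths\<close>

definition path_in :: "'a set \<Rightarrow> 'a \<Rightarrow> 'a \<Rightarrow> 'a list \<Rightarrow> bool" where
  "path_in W s t p \<longleftrightarrow> walk_in W s t p \<and> distinct p"

lemma path_in_mono: "path_in W' s t p \<Longrightarrow> W' \<subseteq> W \<Longrightarrow> path_in W s t p"
  unfolding path_in_def walk_in_def by blast

lemma path_in_Cons:
  "path_in W' w t p \<Longrightarrow> E v w \<Longrightarrow> v \<in> W \<Longrightarrow> v \<notin> W' \<Longrightarrow> W' \<subseteq> W \<Longrightarrow> path_in W v t (v # p)"
  unfolding path_in_def walk_in_def by (cases p) auto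

text \<open>Deleting a simplicial vertex \<open>v\<close> outside \<open>Q\<close> is harmless
  unless \<open>v \<in> P\<close>. In that case \<open>v\<close> has more neighbours than
  \<open>P - {v}\<close> has elements, so \<open>v\<close> is replaced by a new neighbour
  \<open>w\<close>. The new set is again a clique, being part of the neighbourhood of
  \<open>v\<close>, and the path from \<open>w\<close> is prolonged by \<open>v\<close>.\<close>

lemma clique_linkage:
  assumes "finite W" "chordal_on W" "sep_order_ge k W"
    and "clique P" "clique Q" "P \<subseteq> W" "Q \<subseteq> W" "card P \<le> card Q" "card P \<le> k"
  shows "\<exists>f. (\<forall>p\<in>P. \<exists>q\<in>Q. path_in W p q (f p)) \<and>
    (\<forall>p\<in>P. \<forall>p'\<in>P. p \<noteq> p' \<longrightarrow> set (f p) \<inter> set (f p') = {})"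
  using assms
proof (induction "card W" arbitrary: W P rule: less_induct)
  case less
  note fin = finite_subset[OF less.prems(6,1)] finite_subset[OF less.prems(7,1)]
  show ?case
  proof (cases "clique W")
    case True
    \<comment> \<open>In a clique, common vertices of \<open>P\<close> and \<open>Q\<close> stay
      put, and the remaining vertices of \<open>P\<close> are matched by single edges.\<close>
    have "card (P - Q) \<le> card (Q - P)"
      using fin less.prems(8) by (metis card_le_sym_Diff)
    then obtain g where g: "g ` (P - Q) \<subseteq> Q - P" "inj_on g (P - Q)"
      using fin card_le_inj[of "P - Q" "Q - P"] by auto
    define f where "f p = (if p \<in> Q then [p] else [p, g p])" for p
    have "\<exists>q\<in>Q. path_in W p q (f p)" if "p \<in> P" for p
    proof (cases "p \<in> Q")
      case True
      then show ?thesis using that less.prems(6)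
        by (intro bexI[of _ p]) (auto simp: f_def path_in_def walk_in_def)
    next
      case False
      then have gp: "g p \<in> Q" "p \<noteq> g p" using g that by auto
      then have "E p (g p)" using True less.prems(6,7) that unfolding clique_def by blast
      then show ?thesis using gp that less.prems(6,7) False
        by (intro bexI[of _ "g p"]) (auto simp: f_def path_in_def walk_in_def)
    qed
    moreover have "set (f p) \<inter> set (f p') = {}" if "p \<in> P" "p' \<in> P" "p \<noteq> p'" for p p'
      using that g unfolding f_def inj_on_def by auto
    ultimately show ?thesis by blast
  next
    case False
    obtain v where v: "simplicial W v" "v \<notin> Q"
      using ex_simplicial_not_in_clique less.prems False by metis
    have vW: "v \<in> W" using v unfolding simplicial_def by blast
    have IH: "\<exists>f. (\<forall>p\<in>P'. \<exists>q\<in>Q. path_in (W - {v}) p q (f p)) \<and>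
      (\<forall>p\<in>P'. \<forall>p'\<in>P'. p \<noteq> p' \<longrightarrow> set (f p) \<inter> set (f p') = {})"
      if "clique P'" "P' \<subseteq> W - {v}" "card P' = card P" for P'
    proof (rule less.hyps)
      show "card (W - {v}) < card W" using vW less.prems(1) by (meson card_Diff1_less)
      show "chordal_on (W - {v})" using chordal_on_subset less.prems by blast
      show "sep_order_ge k (W - {v})" using sep_order_ge_remove_simplicial v less.prems by blast
      show "Q \<subseteq> W - {v}" using v less.prems by blast
    qed (use that less.prems in auto)
    show ?thesis
    proof (cases "v \<in> P")
      case vP: False
      then have "P \<subseteq> W - {v}" using less.prems(6) by blast
      then obtain f where f: "\<forall>p\<in>P. \<exists>q\<in>Q. path_in (W - {v}) p q (f p)"
        "\<forall>p\<in>P. \<forall>p'\<in>P. p \<noteq> p' \<longrightarrow> set (f p) \<inter> set (f p') = {}"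
        using IH[OF less.prems(4) _ refl] by auto
      have "\<forall>p\<in>P. \<exists>q\<in>Q. path_in W p q (f p)" using f(1) path_in_mono by (meson Diff_subset)
      then show ?thesis using f(2) by blast
    next
      case True
      have "card (P - {v}) < card P" using True fin by (meson card_Diff1_less)
      also have "card P \<le> card (nbh W v)" using simplicial_degree(1)[OF v(1) False] less.prems by force
      finally have "\<not> nbh W v \<subseteq> P - {v}" using fin by (meson card_mono finite_Diff linorder_not_le)
      then obtain w where w: "w \<in> nbh W v" "w \<notin> P - {v}" by blast
      then have wv: "w \<noteq> v" "E v w" "w \<in> W" using E_irrefl unfolding nbh_def by auto
      define P' where "P' = insert w (P - {v})"
      have "P - {v} \<subseteq> nbh W v" using less.prems(4,6) True unfolding clique_def nbh_def by auto
      then have "P' \<subseteq> nbh W v" using w unfolding P'_def by blast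
      then have "clique P'" using v clique_subset unfolding simplicial_def by blast
      moreover have "P' \<subseteq> W - {v}" using wv less.prems unfolding P'_def by auto
      moreover have "card P' = card P" using w fin True unfolding P'_def
        by (metis card_Suc_Diff1 card_insert_disjoint finite_Diff)
      ultimately obtain f where f: "\<forall>p\<in>P'. \<exists>q\<in>Q. path_in (W - {v}) p q (f p)"
        "\<forall>p\<in>P'. \<forall>p'\<in>P'. p \<noteq> p' \<longrightarrow> set (f p) \<inter> set (f p') = {}"
        using IH by blast
      define f' where "f' = f(v := v # f w)"
      have "\<exists>q\<in>Q. path_in W p q (f' p)" if "p \<in> P" for p
      proof (cases "p = v")
        case True
        obtain q where "q \<in> Q" "path_in (W - {v}) w q (f w)" using f(1) unfolding P'_def by blast
        then show ?thesis using path_in_Cons[of "W - {v}" w q "f w" v W] wv vW True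
          unfolding f'_def by auto
      next
        case False
        then show ?thesis using f(1) that path_in_mono[of "W - {v}" _ _ _ W]
          unfolding f'_def P'_def by fastforce
      qed
      moreover have nv: "v \<notin> set (f p)" if "p \<in> P'" for p
        using f(1) that unfolding path_in_def walk_in_def by blast
      have vd: "set (f' v) \<inter> set (f' p) = {}" if "p \<in> P" "p \<noteq> v" for p
      proof -
        have "p \<in> P'" "w \<in> P'" "p \<noteq> w" using that w unfolding P'_def by auto
        then show ?thesis using f(2) nv[of p] that unfolding f'_def by auto
      qed
      have "set (f' p) \<inter> set (f' p') = {}" if "p \<in> P" "p' \<in> P" "p \<noteq> p'" for p p'
      proof -
        consider "p = v" | "p' = v" | "p \<noteq> v" "p' \<noteq> v" by blast
        then show ?thesis
        proof cases
          case 3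
          then show ?thesis using f(2) that unfolding f'_def P'_def by auto
        qed (use vd that in blast)+
      qed
      ultimately show ?thesis by blast
    qed
  qed
qed

definition disjoint_paths :: "'a set \<Rightarrow> 'a \<Rightarrow> 'a \<Rightarrow> 'a list set \<Rightarrow> bool" where
  "disjoint_paths W x y Ps \<longleftrightarrow> finite Ps \<and> (\<forall>p\<in>Ps. path_in W x y p) \<and>
     (\<forall>p\<in>Ps. \<forall>q\<in>Ps. p \<noteq> q \<longrightarrow> set p \<inter> set q = {x, y})"

lemma disjoint_paths_common_neighbours:
  assumes "finite C" "x \<in> W" "y \<in> W" "x \<noteq> y" "E x y"
    and C: "C \<subseteq> W - {x, y}" "\<And>z. z \<in> C \<Longrightarrow> E x z \<and> E z y"
  shows "\<exists>Ps. disjoint_paths W x y Ps \<and> card Ps = Suc (card C)"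
proof (intro exI conjI)
  let ?Ps = "insert [x, y] ((\<lambda>z. [x, z, y]) ` C)"
  have "card ((\<lambda>z. [x, z, y]) ` C) = card C" by (rule card_image) (simp add: inj_on_def)
  then show "card ?Ps = Suc (card C)" using assms(1) by (subst card_insert_disjoint) auto
  show "disjoint_paths W x y ?Ps"
    using assms unfolding disjoint_paths_def path_in_def walk_in_def by auto
qed

text \<open>A simplicial vertex \<open>v \<noteq> y\<close> is deleted; only \<open>x = v\<close>
  needs work. If \<open>y\<close> is a neighbour of \<open>v\<close>, the other neighbours of
  \<open>v\<close> are adjacent to both. Otherwise \<open>k\<close> neighbours of \<open>v\<close>
  are linked to \<open>k\<close> vertices of a clique through \<open>y\<close>, from which
  \<open>y\<close> is reached in one step.\<close>

theorem ex_disjoint_paths: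
  assumes "finite W" "chordal_on W" "sep_order_ge k W" "Suc k \<le> card W"
    and "x \<in> W" "y \<in> W" "x \<noteq> y"
  shows "\<exists>Ps. disjoint_paths W x y Ps \<and> k \<le> card Ps"
  using assms
proof (induction "card W" arbitrary: W rule: less_induct)
  case less
  show ?case
  proof (cases "clique W")
    case True
    have "card (W - {x, y}) = card W - 2" using less.prems by (simp add: card_Diff_subset)
    moreover have "\<exists>Ps. disjoint_paths W x y Ps \<and> card Ps = Suc (card (W - {x, y}))"
      using less.prems True unfolding clique_def by (intro disjoint_paths_common_neighbours) auto
    ultimately show ?thesis using less.prems(4) by fastforce
  next
    case False
    obtain v where v: "simplicial W v" "v \<notin> {y}"
      using ex_simplicial_not_in_clique[of W "{y}"] less.prems False unfolding clique_def by auto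
    have vW: "v \<in> W" using v unfolding simplicial_def by blast
    let ?N = "nbh W v"
    note N = simplicial_degree[OF v(1) False less.prems(3)]
    have N_sub: "?N \<subseteq> W - {v}" using E_irrefl unfolding nbh_def by auto
    have W': "card (W - {v}) < card W" "chordal_on (W - {v})" "sep_order_ge k (W - {v})" "finite (W - {v})"
      using vW less.prems chordal_on_subset sep_order_ge_remove_simplicial v
      by (auto intro: card_Diff1_less)
    \<comment> \<open>The neighbourhood is a proper subset of \<open>W - {v}\<close>, so at least
      \<open>k + 1\<close> vertices remain after the deletion.\<close>
    have "card ?N < card (W - {v})" using N_sub N(2) W'(4) by (meson psubsetI psubset_card_mono)
    then have card_W': "Suc k \<le> card (W - {v})" using N(1) by simp
    consider "x \<noteq> v" | "x = v" "y \<in> ?N" | "x = v" "y \<notin> ?N" by blast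
    then show ?thesis
    proof cases
      case 1
      then obtain Ps where Ps: "disjoint_paths (W - {v}) x y Ps" "k \<le> card Ps"
        using less.hyps[of "W - {v}"] W' card_W' less.prems v by auto
      then have "disjoint_paths W x y Ps" using path_in_mono[of "W - {v}" x y _ W]
        unfolding disjoint_paths_def by auto
      then show ?thesis using Ps by blast
    next
      case 2
      have "\<exists>Ps. disjoint_paths W x y Ps \<and> card Ps = Suc (card (?N - {y}))"
      proof (rule disjoint_paths_common_neighbours)
        show "finite (?N - {y})" using less.prems(1) unfolding nbh_def by auto
        show "E x y" using 2 unfolding nbh_def by auto
        show "?N - {y} \<subseteq> W - {x, y}" using N_sub 2 by auto
        show "E x z \<and> E z y" if "z \<in> ?N - {y}" for z
          using 2 that v unfolding simplicial_def clique_def nbh_def by blast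
      qed (use less.prems in auto)
      moreover have "finite ?N" using less.prems(1) unfolding nbh_def by auto
      ultimately show ?thesis using N(1) 2(2) by (metis card_Suc_Diff1)
    next
      case 3
      obtain P where P: "P \<subseteq> ?N" "card P = k" using N(1) obtain_subset_with_card_n by metis
      have "clique P" using P v clique_subset unfolding simplicial_def by blast
      \<comment> \<open>One vertex more than \<open>k\<close>, so that \<open>Y - {y}\<close> still
        has enough of them for \<open>clique_linkage\<close>.\<close>
      obtain Y where Y: "clique Y" "Y \<subseteq> W - {v}" "y \<in> Y" "card Y = Suc k"
        using ex_clique_of_size[of "W - {v}" k y k] W' card_W' v less.prems by auto
      have "card (Y - {y}) = k" using Y finite_subset[OF Y(2) W'(4)] by simp
      moreover have "P \<subseteq> W - {v}" "Y - {y} \<subseteq> W - {v}" using P N_sub Y by blast+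
      moreover have "clique (Y - {y})" using clique_subset[OF Y(1)] by blast
      ultimately obtain f where f: "\<forall>p\<in>P. \<exists>q\<in>Y - {y}. path_in (W - {v}) p q (f p)"
        "\<forall>p\<in>P. \<forall>p'\<in>P. p \<noteq> p' \<longrightarrow> set (f p) \<inter> set (f p') = {}"
        using clique_linkage[OF W'(4,2,3) \<open>clique P\<close>, of "Y - {y}"] P(2) by auto
      \<comment> \<open>A linked path may pass through \<open>y\<close> on its way; it is then cut
        just before \<open>y\<close>. Otherwise its end in \<open>Y - {y}\<close> is adjacent to
        \<open>y\<close>.\<close>
      define h where "h p = takeWhile (\<lambda>z. z \<noteq> y) (f p)" for p
      define g where "g p = v # h p @ [y]" for p
      have h: "h p \<noteq> [] \<and> hd (h p) = p \<and> successively E (h p @ [y]) \<and> distinct (h p) \<and>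
          y \<notin> set (h p) \<and> set (h p) \<subseteq> set (f p) \<and> set (f p) \<subseteq> W - {v}" if p: "p \<in> P" for p
      proof -
        obtain q where q: "q \<in> Y" "q \<noteq> y" "path_in (W - {v}) p q (f p)" using f p by blast
        have "p \<noteq> y" using p P 3 by blast
        have fp: "f p \<noteq> []" "hd (f p) = p" "last (f p) = q" "successively E (f p)" "distinct (f p)"
          "set (f p) \<subseteq> W - {v}"
          using q unfolding path_in_def walk_in_def by auto
        have ne: "h p \<noteq> []" "hd (h p) = p"
          using fp \<open>p \<noteq> y\<close> unfolding h_def by (cases "f p"; auto)+
        have "successively E (h p @ [y])"
        proof (cases "y \<in> set (f p)")
          case True
          define d where "d = dropWhile (\<lambda>z. z \<noteq> y) (f p)"
          have d: "f p = h p @ d" unfolding h_def d_def by simp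
          have "d \<noteq> []" using True unfolding d_def by (simp add: dropWhile_eq_Nil_conv)
          moreover from this have "hd d = y" unfolding d_def using hd_dropWhile[of "\<lambda>z. z \<noteq> y" "f p"] by blast
          ultimately show ?thesis using fp(4) ne unfolding d by (auto simp: successively_append_iff)
        next
          case False
          then have "h p = f p" unfolding h_def by (auto simp: takeWhile_eq_all_conv)
          moreover have "E q y" using Y q unfolding clique_def by blast
          ultimately show ?thesis using fp by (auto simp: successively_append_iff)
        qed
        moreover have "y \<notin> set (h p)" "set (h p) \<subseteq> set (f p)" unfolding h_def
          by (auto dest: set_takeWhileD)
        ultimately show ?thesis using ne fp unfolding h_def by (auto simp: distinct_takeWhile)
      qed
      have "path_in W v y (g p)" if p: "p \<in> P" for p
      proof -
        have "E v p" using p P unfolding nbh_def by blast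
        then have "successively E (g p)"
          using h[OF p] unfolding g_def by (cases "h p") auto
        then show ?thesis using h[OF p] v vW less.prems unfolding g_def path_in_def walk_in_def by auto
      qed
      moreover have "set (g p) \<inter> set (g p') = {v, y}" if "p \<in> P" "p' \<in> P" "p \<noteq> p'" for p p'
      proof -
        have "set (h p) \<inter> set (h p') = {}" using f(2) h[OF that(1)] h[OF that(2)] that by blast
        then show ?thesis using h[OF that(1)] h[OF that(2)] unfolding g_def by auto
      qed
      moreover have "finite P" using P(1) N_sub W'(4) by (meson finite_subset order_trans)
      ultimately have "disjoint_paths W v y (g ` P)"
        unfolding disjoint_paths_def by blast
      moreover have "inj_on g P"
      proof (rule inj_onI)
        fix p p' assume pp: "p \<in> P" "p' \<in> P" "g p = g p'"
        then have "h p = h p'" unfolding g_def by simp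
        then show "p = p'" using h[OF pp(1)] h[OF pp(2)] by metis
      qed
      then have "card (g ` P) = k" using P by (simp add: card_image)
      ultimately show ?thesis using 3 by blast
    qed
  qed
qed

lemma walk_meets_separator:
  assumes "separation W A S B"
  shows "x \<in> A \<Longrightarrow> walk_in W x y p \<Longrightarrow> y \<in> B \<Longrightarrow> set p \<inter> S \<noteq> {}"
proof (induction p arbitrary: x)
  case Nil
  then show ?case by (simp add: walk_in_def)
next
  case (Cons z p)
  then have z: "z = x" "p \<noteq> []" using assms unfolding walk_in_def separation_def by auto
  then have p: "walk_in W (hd p) y p" "E x (hd p)" "hd p \<in> W"
    using Cons.prems unfolding walk_in_def by (cases p; auto)+
  then have "hd p \<in> A \<or> hd p \<in> S"
    using assms Cons.prems(1) unfolding separation_def by blast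
  moreover have "hd p \<in> set p" using z by simp
  ultimately have "set p \<inter> S \<noteq> {}" using Cons.IH[of "hd p"] p Cons.prems by blast
  then show ?case by auto
qed

text \<open>The easy half of Menger's theorem: each path contains a vertex of \<open>S\<close>, and
  different paths share only \<open>x\<close> and \<open>y\<close>, which lie outside
  \<open>S\<close>.\<close>

lemma disjoint_paths_card_le:
  assumes sep: "separation W A S B" and "finite S" "x \<in> A" "y \<in> B" and Ps: "disjoint_paths W x y Ps"
  shows "card Ps \<le> card S"
proof -
  have "\<exists>s. s \<in> set p \<inter> S" if "p \<in> Ps" for p
  proof -
    have "walk_in W x y p" using Ps that unfolding disjoint_paths_def path_in_def by simp
    then show ?thesis using walk_meets_separator[OF sep assms(3) _ assms(4), of p] by auto
  qed
  then obtain s where s: "\<forall>p\<in>Ps. s p \<in> set p \<inter> S" by metis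
  have "x \<notin> S" "y \<notin> S" using sep assms(3,4) unfolding separation_def by auto
  have "inj_on s Ps"
  proof (rule inj_onI, rule ccontr)
    fix p q assume pq: "p \<in> Ps" "q \<in> Ps" "s p = s q" "p \<noteq> q"
    then have "set p \<inter> set q = {x, y}" using Ps unfolding disjoint_paths_def by blast
    moreover have "s p \<in> set p \<inter> set q" "s p \<in> S" using s pq by (metis IntI IntE)+
    ultimately show False using \<open>x \<notin> S\<close> \<open>y \<notin> S\<close> by auto
  qed
  then show ?thesis using s assms(2) by (auto intro: card_inj_on_le)
qed

section \<open>Consequences of stiffness\<close>

definition stiff_on :: "'a set \<Rightarrow> bool" where
  "stiff_on W \<longleftrightarrow> (\<forall>u\<in>W. \<forall>v\<in>W. u \<noteq> v \<longrightarrow> \<not> nbh W u \<subseteq> nbh W v)"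

text \<open>With at most \<open>r\<close> vertices, the clique of neighbours of \<open>v\<close>
  would be contained in the neighbourhood of a second vertex \<open>w\<close>, by
  \<open>small_clique_extends\<close> in \<open>W - {v}\<close>; this is what stiffness
  forbids.\<close>

lemma stiff_simplicial_degree:
  assumes "finite W" "chordal_on W" "sep_order_ge r W" "\<not> clique W" "stiff_on W"
    and v: "simplicial W v"
  shows "Suc r \<le> card (nbh W v)"
proof (rule ccontr)
  assume "\<not> ?thesis"
  then have "card (nbh W v) \<le> r" by simp
  moreover have "nbh W v \<subseteq> W - {v}" using E_irrefl unfolding nbh_def by auto
  moreover have "nbh W v \<noteq> W - {v}" "clique (nbh W v)"
    using simplicial_degree[OF v] assms unfolding simplicial_def by auto
  moreover have "chordal_on (W - {v})" "sep_order_ge r (W - {v})"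
    using assms chordal_on_subset sep_order_ge_remove_simplicial v by auto
  ultimately obtain w where w: "w \<in> W - {v} - nbh W v" "nbh W v \<subseteq> nbh (W - {v}) w"
    using small_clique_extends[of "W - {v}" r "nbh W v"] assms(1) by blast
  have "nbh W v \<subseteq> nbh W w" using w(2) unfolding nbh_def by auto
  moreover have "v \<in> W" "w \<in> W" "v \<noteq> w" using w(1) v unfolding simplicial_def by auto
  ultimately show False using assms(5) unfolding stiff_on_def by blast
qed

text \<open>The clique is found in the closed neighbourhood of a vertex \<open>v \<in> A\<close>
  that is simplicial in \<open>A \<union> S\<close>. Such a \<open>v\<close> is also simplicial in
  \<open>W\<close>, with the same neighbours, so that stiffness, which is known for \<open>W\<close>
  only, bounds its degree.\<close>

lemma separation_side:
  assumes "finite W" "chordal_on W" "sep_order_ge (card S) W" "stiff_on W"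
    and sep: "separation W A S B"
  shows "\<exists>a\<in>A. S \<subseteq> nbh W a" "\<exists>K\<subseteq>A \<union> S. clique K \<and> card K = card S + 2"
    "sep_order_ge (card S) (A \<union> S)"
proof -
  have AS: "A \<union> S \<subseteq> W" using sep unfolding separation_def by blast
  note fin = finite_subset[OF AS assms(1)]
  have S: "clique S" using minimum_separation_clique assms by blast
  show side: "sep_order_ge (card S) (A \<union> S)" using sep_order_ge_side[OF sep S] assms by blast
  have ch: "chordal_on (A \<union> S)" using chordal_on_subset[OF assms(2) AS] .
  have nS: "S \<noteq> A \<union> S" using sep unfolding separation_def by blast
  then obtain a where "a \<in> A \<union> S - S" "S \<subseteq> nbh (A \<union> S) a"
    using small_clique_extends[OF fin ch side S] by auto
  then show "\<exists>a\<in>A. S \<subseteq> nbh W a" using AS unfolding nbh_def by auto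
  have nW: "\<not> clique W" using clique_no_separation sep by blast
  have "\<exists>v\<in>A. simplicial (A \<union> S) v"
  proof (cases "clique (A \<union> S)")
    case True
    obtain v where "v \<in> A" using sep unfolding separation_def by blast
    then show ?thesis using clique_subset[OF True, of "nbh (A \<union> S) v"]
      unfolding simplicial_def nbh_def by auto
  next
    case False
    then obtain v where "simplicial (A \<union> S) v" "v \<notin> S"
      using ex_simplicial_not_in_clique[OF fin ch _ S] by blast
    then show ?thesis unfolding simplicial_def by blast
  qed
  then obtain v where v: "v \<in> A" "simplicial (A \<union> S) v" by blast
  have vW: "simplicial W v" using simplicial_extend[OF sep v(2,1)] .
  have "nbh W v \<subseteq> A \<union> S" using sep v unfolding separation_def nbh_def by blast
  moreover have "clique (insert v (nbh W v))"
    using vW clique_insert unfolding simplicial_def by blast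
  moreover have "v \<notin> nbh W v" "finite (nbh W v)" using E_irrefl assms(1) unfolding nbh_def by auto
  ultimately have "insert v (nbh W v) \<subseteq> A \<union> S" "clique (insert v (nbh W v))"
    "card S + 2 \<le> card (insert v (nbh W v))"
    using v stiff_simplicial_degree[OF assms(1,2,3) nW assms(4) vW] by auto
  moreover from this obtain K where "K \<subseteq> insert v (nbh W v)" "card K = card S + 2"
    using obtain_subset_with_card_n by metis
  ultimately show "\<exists>K\<subseteq>A \<union> S. clique K \<and> card K = card S + 2"
    using clique_subset[of "insert v (nbh W v)" K] by (metis order_trans)
qed

end

section \<open>Extension of maps from spheres\<close>

definition extendable ::
    "'p::topological_space set \<Rightarrow> 'p set \<Rightarrow> 'b::topological_space set \<Rightarrow> bool" where
  "extendable F C Y \<longleftrightarrow> (\<forall>f. continuous_on C f \<and> f ` C \<subseteq> Y \<longrightarrow>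
     (\<exists>g. continuous_on F g \<and> g ` F \<subseteq> Y \<and> (\<forall>x\<in>C. g x = f x)))"

text \<open>A map on \<open>C'\<close> is pulled back along \<open>q\<close>, extended over
  \<open>F\<close>, and composed with \<open>p\<close>. Only on the boundary is \<open>q\<close>
  inverse to \<open>p\<close>, so that \<open>p\<close> may be any convenient map of pairs instead
  of a homeomorphism.\<close>

lemma extendable_transfer:
  assumes ext: "extendable F C Y"
    and p: "continuous_on F' p" "p ` F' \<subseteq> F" "p ` C' \<subseteq> C"
    and q: "continuous_on C q" "q ` C \<subseteq> C'" "\<And>x. x \<in> C' \<Longrightarrow> q (p x) = x"
  shows "extendable F' C' Y"
  unfolding extendable_def
proof (intro allI impI, elim conjE)
  fix f assume f: "continuous_on C' f" "f ` C' \<subseteq> Y"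
  have "continuous_on C (\<lambda>x. f (q x))" "(\<lambda>x. f (q x)) ` C \<subseteq> Y"
    using continuous_on_compose2[OF f(1) q(1,2)] f(2) q(2) by auto
  then obtain g where g: "continuous_on F g" "g ` F \<subseteq> Y" "\<And>x. x \<in> C \<Longrightarrow> g x = f (q x)"
    using ext unfolding extendable_def by metis
  have "continuous_on F' (\<lambda>x. g (p x))" by (rule continuous_on_compose2[OF g(1) p(1,2)])
  moreover have "(\<lambda>x. g (p x)) ` F' \<subseteq> Y" using g(2) p(2) by blast
  moreover have "\<forall>x\<in>C'. g (p x) = f x" using g(3) p(3) q(3) by (metis image_subset_iff)
  ultimately show "\<exists>g. continuous_on F' g \<and> g ` F' \<subseteq> Y \<and> (\<forall>x\<in>C'. g x = f x)" by blast
qed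

lemma continuous_on_coordinate: "continuous_on A (\<lambda>x::'i \<Rightarrow> 'b::topological_space. x i)"
  by (rule continuous_on_subset[OF continuous_on_product_coordinates]) simp

lemma extendableE:
  assumes "extendable F C Y" "continuous_on C f" "f ` C \<subseteq> Y"
  obtains g where "continuous_on F g" "g ` F \<subseteq> Y" "\<And>x. x \<in> C \<Longrightarrow> g x = f x"
proof -
  have "\<exists>g. continuous_on F g \<and> g ` F \<subseteq> Y \<and> (\<forall>x\<in>C. g x = f x)"
    using assms(1)[unfolded extendable_def, rule_format, OF conjI, OF assms(2,3)] .
  then show thesis using that by auto
qed

section \<open>Balls of different norms\<close>

definition espace :: "nat \<Rightarrow> (nat \<Rightarrow> real) set" where
  "espace d = {x. \<forall>i\<ge>d. x i = 0}"

definition scl :: "real \<Rightarrow> ('i \<Rightarrow> real) \<Rightarrow> 'i \<Rightarrow> real" where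
  "scl c x = (\<lambda>i. c * x i)"

text \<open>A gauge in the sense of positive homogeneity and positivity; symmetry is left out
  because the gauge of a simplex about its barycentre lacks it.\<close>

definition gauge_norm :: "nat \<Rightarrow> ((nat \<Rightarrow> real) \<Rightarrow> real) \<Rightarrow> bool" where
  "gauge_norm d N \<longleftrightarrow> continuous_on UNIV N \<and>
     (\<forall>c\<ge>0. \<forall>x\<in>espace d. N (scl c x) = c * N x) \<and>
     (\<forall>x\<in>espace d. x \<noteq> (\<lambda>i. 0) \<longrightarrow> 0 < N x)"

definition gball :: "nat \<Rightarrow> ((nat \<Rightarrow> real) \<Rightarrow> real) \<Rightarrow> (nat \<Rightarrow> real) set" where
  "gball d N = {x\<in>espace d. N x \<le> 1}"

definition gsphere :: "nat \<Rightarrow> ((nat \<Rightarrow> real) \<Rightarrow> real) \<Rightarrow> (nat \<Rightarrow> real) set" where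
  "gsphere d N = {x\<in>espace d. N x = 1}"

lemma scl_espace: "x \<in> espace d \<Longrightarrow> scl c x \<in> espace d"
  by (simp add: espace_def scl_def)

lemma scl_scale: "scl a (scl b x) = scl (a * b) x"
  by (simp add: scl_def mult.assoc)

lemma scl_1: "scl 1 x = x"
  by (simp add: scl_def)

lemma continuous_on_scl [continuous_intros]:
  assumes "continuous_on A c" "continuous_on A f"
  shows "continuous_on A (\<lambda>x. scl (c x) (f x))"
  unfolding scl_def
  by (intro continuous_on_coordinatewise_then_product continuous_on_mult assms
      continuous_on_product_then_coordinatewise[OF assms(2)])

lemma gauge_norm_cont:
  assumes "gauge_norm d N" "continuous_on A f"
  shows "continuous_on A (\<lambda>x. N (f x))"
  using assms continuous_on_compose2[of UNIV N A f] unfolding gauge_norm_def by auto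

lemma gauge_norm_0: "gauge_norm d N \<Longrightarrow> N (\<lambda>i. 0) = 0"
proof -
  assume "gauge_norm d N"
  then have "N (scl 0 (\<lambda>i. 0)) = 0 * N (\<lambda>i. 0)"
    unfolding gauge_norm_def espace_def by (auto simp del: mult_zero_left)
  then show ?thesis by (simp add: scl_def)
qed

lemma gauge_norm_scl: "gauge_norm d N \<Longrightarrow> 0 \<le> c \<Longrightarrow> x \<in> espace d \<Longrightarrow> N (scl c x) = c * N x"
  unfolding gauge_norm_def by blast

lemma gauge_norm_pos: "gauge_norm d N \<Longrightarrow> x \<in> espace d \<Longrightarrow> x \<noteq> (\<lambda>i. 0) \<Longrightarrow> 0 < N x"
  unfolding gauge_norm_def by blast

lemma gauge_norm_neq_0: "gauge_norm d N \<Longrightarrow> N x = 1 \<Longrightarrow> x \<noteq> (\<lambda>i. 0)"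
  using gauge_norm_0 by force

text \<open>On the \<open>N'\<close>-sphere the denominator in \<open>p\<close> is
  \<open>N x\<close>, so \<open>p\<close> is the radial projection to the \<open>N\<close>-sphere.
  Inside, the summand \<open>1 - N' x\<close> keeps the denominator positive, also at the origin,
  and keeps \<open>N (p x)\<close> at most 1.\<close>

lemma gauge_transfer_maps:
  assumes N: "gauge_norm d N" and N': "gauge_norm d N'"
  defines "p \<equiv> \<lambda>x. scl (1 / (N x + 1 - N' x)) x"
    and "q \<equiv> \<lambda>x. scl (1 / N' x) x"
  shows "continuous_on (gball d N') p" "p ` gball d N' \<subseteq> gball d N"
    "p ` gsphere d N' \<subseteq> gsphere d N"
    "continuous_on (gsphere d N) q" "q ` gsphere d N \<subseteq> gsphere d N'"
    "\<And>x. x \<in> gsphere d N' \<Longrightarrow> q (p x) = x"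
proof -
  have pos: "0 < N x + 1 - N' x" if "x \<in> gball d N'" for x
  proof (cases "x = (\<lambda>i. 0)")
    case True
    then show ?thesis using gauge_norm_0[OF N] gauge_norm_0[OF N'] by simp
  next
    case False
    then show ?thesis using that gauge_norm_pos[OF N] unfolding gball_def by force
  qed
  have pos': "0 < N' x" if "x \<in> gsphere d N" for x
    using that gauge_norm_neq_0[OF N] gauge_norm_pos[OF N'] unfolding gsphere_def by blast
  have S_B: "x \<in> gball d N'" if "x \<in> gsphere d N'" for x
    using that unfolding gsphere_def gball_def by auto
  show "continuous_on (gball d N') p"
    unfolding p_def using pos
    by (intro continuous_intros gauge_norm_cont[OF N] gauge_norm_cont[OF N']) force
  show "continuous_on (gsphere d N) q"
    unfolding q_def using pos'
    by (intro continuous_intros gauge_norm_cont[OF N']) force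
  show "p ` gball d N' \<subseteq> gball d N"
  proof safe
    fix x assume x: "x \<in> gball d N'"
    then have "N (p x) = N x / (N x + 1 - N' x)"
      unfolding p_def using gauge_norm_scl[OF N, of "1 / (N x + 1 - N' x)" x] pos[OF x]
      by (simp add: gball_def)
    also have "\<dots> \<le> 1" using x pos[OF x] by (simp add: gball_def)
    finally show "p x \<in> gball d N" using x scl_espace unfolding gball_def p_def by auto
  qed
  have pS: "p x = scl (1 / N x) x \<and> 0 < N x" if "x \<in> gsphere d N'" for x
    using that gauge_norm_neq_0[OF N'] gauge_norm_pos[OF N] unfolding gsphere_def p_def by auto
  show "p ` gsphere d N' \<subseteq> gsphere d N"
    using pS gauge_norm_scl[OF N] scl_espace unfolding gsphere_def by fastforce
  show "q ` gsphere d N \<subseteq> gsphere d N'"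
    using pos' gauge_norm_scl[OF N'] scl_espace unfolding gsphere_def q_def by fastforce
  show "q (p x) = x" if x: "x \<in> gsphere d N'" for x
  proof -
    have "N' (p x) = 1 / N x"
      using pS[OF x] gauge_norm_scl[OF N', of "1 / N x" x] x unfolding gsphere_def by auto
    then show ?thesis using pS[OF x] unfolding q_def by (simp add: scl_scale scl_1)
  qed
qed

lemma gauge_transfer:
  assumes "gauge_norm d N" "gauge_norm d N'" "extendable (gball d N) (gsphere d N) Y"
  shows "extendable (gball d N') (gsphere d N') Y"
  by (rule extendable_transfer[OF assms(3)]) (rule gauge_transfer_maps[OF assms(1,2)]; assumption?)+

definition enorm :: "nat \<Rightarrow> (nat \<Rightarrow> real) \<Rightarrow> real" where
  "enorm d x = sqrt (\<Sum>i<d. (x i)\<^sup>2)"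

lemma gauge_norm_enorm: "gauge_norm d (enorm d)"
  unfolding gauge_norm_def
proof (intro conjI ballI allI impI)
  show "continuous_on UNIV (enorm d)"
    unfolding enorm_def by (intro continuous_intros continuous_on_product_coordinates)
  show "enorm d (scl c x) = c * enorm d x" if "0 \<le> c" for c x
    using that unfolding enorm_def scl_def
    by (simp add: power_mult_distrib real_sqrt_mult flip: sum_distrib_left)
  show "0 < enorm d x" if x: "x \<in> espace d" "x \<noteq> (\<lambda>i. 0)" for x
  proof -
    obtain i where i: "x i \<noteq> 0" using x by auto
    then have "i < d" using x(1) unfolding espace_def by (auto simp flip: linorder_not_le)
    then have "0 < (\<Sum>i<d. (x i)\<^sup>2)" using i by (intro sum_pos2[of _ i]) auto
    then show ?thesis unfolding enorm_def by simp
  qed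
qed

definition supnorm :: "nat \<Rightarrow> (nat \<Rightarrow> real) \<Rightarrow> real" where
  "supnorm d x = Max (insert 0 ((\<lambda>i. \<bar>x i\<bar>) ` {..<d}))"

lemma continuous_on_Max_image:
  fixes f :: "'i \<Rightarrow> 'p::topological_space \<Rightarrow> real"
  assumes "finite I" "I \<noteq> {}" "\<And>i. i \<in> I \<Longrightarrow> continuous_on A (f i)"
  shows "continuous_on A (\<lambda>x. Max ((\<lambda>i. f i x) ` I))"
  using assms
proof (induction I rule: finite_ne_induct)
  case (insert i I)
  then have "continuous_on A (\<lambda>x. max (f i x) (Max ((\<lambda>i. f i x) ` I)))"
    by (intro continuous_intros) auto
  then show ?case using insert by simp
qed simp

lemma continuous_on_Min_image:
  fixes f :: "'i \<Rightarrow> 'p::topological_space \<Rightarrow> real"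
  assumes "finite I" "I \<noteq> {}" "\<And>i. i \<in> I \<Longrightarrow> continuous_on A (f i)"
  shows "continuous_on A (\<lambda>x. Min ((\<lambda>i. f i x) ` I))"
  using assms
proof (induction I rule: finite_ne_induct)
  case (insert i I)
  then have "continuous_on A (\<lambda>x. min (f i x) (Min ((\<lambda>i. f i x) ` I)))"
    by (intro continuous_intros) auto
  then show ?case using insert by simp
qed simp

lemma supnorm_le_iff: "0 \<le> c \<Longrightarrow> supnorm d x \<le> c \<longleftrightarrow> (\<forall>i<d. \<bar>x i\<bar> \<le> c)"
  unfolding supnorm_def by (subst Max_le_iff) auto

lemma supnorm_eq_iff: "0 < c \<Longrightarrow> supnorm d x = c \<longleftrightarrow> (\<forall>i<d. \<bar>x i\<bar> \<le> c) \<and> (\<exists>i<d. \<bar>x i\<bar> = c)"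
  unfolding supnorm_def by (subst Max_eq_iff) auto

lemma gauge_norm_supnorm: "gauge_norm d (supnorm d)"
  unfolding gauge_norm_def
proof (intro conjI ballI allI impI)
  have "supnorm d = (\<lambda>x. max 0 (Max ((\<lambda>i. \<bar>x i\<bar>) ` {..<d})))" if "d \<noteq> 0"
    unfolding supnorm_def using that by (intro ext Max_insert) auto
  moreover have "continuous_on UNIV (\<lambda>x::nat\<Rightarrow>real. Max ((\<lambda>i. \<bar>x i\<bar>) ` {..<d}))" if "d \<noteq> 0"
    using that by (intro continuous_on_Max_image continuous_intros continuous_on_product_coordinates) auto
  moreover have "supnorm d = (\<lambda>x. 0)" if "d = 0" unfolding supnorm_def using that by simp
  ultimately show "continuous_on UNIV (supnorm d)"
    by (cases "d = 0") (auto intro!: continuous_intros)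
  show "supnorm d (scl c x) = c * supnorm d x" if "0 \<le> c" for c x
  proof -
    have "mono (\<lambda>y. c * y)" using that by (simp add: mono_def mult_left_mono)
    then have "c * supnorm d x = Max ((\<lambda>y. c * y) ` insert 0 ((\<lambda>i. \<bar>x i\<bar>) ` {..<d}))"
      unfolding supnorm_def by (intro mono_Max_commute) auto
    also have "(\<lambda>y. c * y) ` insert 0 ((\<lambda>i. \<bar>x i\<bar>) ` {..<d}) = insert 0 ((\<lambda>i. \<bar>scl c x i\<bar>) ` {..<d})"
      using that by (auto simp: scl_def abs_mult image_image)
    finally show ?thesis unfolding supnorm_def by simp
  qed
  show "0 < supnorm d x" if x: "x \<in> espace d" "x \<noteq> (\<lambda>i. 0)" for x
  proof (rule ccontr)
    assume "\<not> ?thesis"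
    then have "\<forall>i<d. \<bar>x i\<bar> \<le> 0" using supnorm_le_iff[of 0 d x] by simp
    then show False using x unfolding espace_def by (metis (mono_tags, lifting) abs_le_zero_iff ext linorder_not_le mem_Collect_eq)
  qed
qed

text \<open>
  A space \<open>Y\<close> is \<open>k\<close>-connected iff \<open>fills d Y\<close> for all \<open>d \<le> k + 1\<close>: here \<open>d\<close> is the dimension of
  the ball, and \<open>fills 0 Y\<close> means that \<open>Y\<close> is nonempty.
\<close>

definition fills :: "nat \<Rightarrow> 'b::topological_space set \<Rightarrow> bool" where
  "fills d Y \<longleftrightarrow> extendable (gball d (enorm d)) (gsphere d (enorm d)) Y"

lemma fills_iff_gauge:
  "gauge_norm d N \<Longrightarrow> fills d Y \<longleftrightarrow> extendable (gball d N) (gsphere d N) Y"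
  unfolding fills_def using gauge_transfer gauge_norm_enorm by blast

lemma fills_0: "fills 0 Y \<longleftrightarrow> Y \<noteq> {}"
proof -
  have "gsphere 0 (enorm 0) = {}" by (auto simp: gsphere_def enorm_def)
  moreover have "gball 0 (enorm 0) = {\<lambda>i. 0}" by (auto simp: gball_def enorm_def espace_def)
  ultimately show ?thesis unfolding fills_def extendable_def by auto
qed

text \<open>The ball of radius 1/2 carries the rescaled \<open>g\<close>, and the shell around it
  runs through the homotopy: the time \<open>2 - 2 * N x\<close> is 1 on the inner sphere, where
  \<open>g\<close> takes over, and 0 on the outer one.\<close>

lemma homotopy_extends:
  assumes N: "gauge_norm d N"
    and H: "continuous_on (gsphere d N \<times> {0..1::real}) H" "H ` (gsphere d N \<times> {0..1}) \<subseteq> Y"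
    and g: "continuous_on (gball d N) g" "g ` gball d N \<subseteq> Y"
    and eq: "\<And>x. x \<in> gsphere d N \<Longrightarrow> g x = H (x, 1)"
  shows "\<exists>G. continuous_on (gball d N) G \<and> G ` gball d N \<subseteq> Y \<and> (\<forall>x\<in>gsphere d N. G x = H (x, 0))"
proof -
  define in_part where "in_part x = g (scl 2 x)" for x
  define out_part where "out_part x = H (scl (1 / N x) x, 2 - 2 * N x)" for x
  define G where "G x = (if N x \<le> 1/2 then in_part x else out_part x)" for x
  have in_ball: "scl 2 x \<in> gball d N" if "x \<in> gball d N" "N x \<le> 1/2" for x
    using that gauge_norm_scl[OF N, of 2 x] scl_espace unfolding gball_def by auto
  have out_sphere: "(scl (1 / N x) x, 2 - 2 * N x) \<in> gsphere d N \<times> {0..1}"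
    if "x \<in> gball d N" "1/2 \<le> N x" for x
    using that gauge_norm_scl[OF N, of "1 / N x" x] scl_espace
    unfolding gball_def gsphere_def by auto
  have "continuous_on (gball d N) G"
    unfolding G_def
  proof (rule continuous_on_cases_le)
    show "continuous_on {x \<in> gball d N. N x \<le> 1/2} in_part"
      unfolding in_part_def
      by (rule continuous_on_compose2[OF g(1)]) (use in_ball in \<open>auto intro: continuous_on_scl\<close>)
    have "continuous_on {x \<in> gball d N. 1/2 \<le> N x} (\<lambda>x. (scl (1 / N x) x, 2 - 2 * N x))"
      by (intro continuous_intros gauge_norm_cont[OF N]) auto
    then show "continuous_on {x \<in> gball d N. 1/2 \<le> N x} out_part"
      unfolding out_part_def by (rule continuous_on_compose2[OF H(1)]) (use out_sphere in auto)
    show "continuous_on (gball d N) N" by (intro gauge_norm_cont[OF N] continuous_intros)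
    show "in_part x = out_part x" if "x \<in> gball d N" "N x = 1/2" for x
    proof -
      have "scl 2 x \<in> gsphere d N"
        using that gauge_norm_scl[OF N, of 2 x] scl_espace[of x d 2]
        unfolding gball_def gsphere_def by simp
      moreover have "1 / N x = 2" "2 - 2 * N x = 1" unfolding that(2) by simp_all
      ultimately show ?thesis using eq unfolding in_part_def out_part_def by simp
    qed
  qed
  moreover have "G ` gball d N \<subseteq> Y"
  proof safe
    fix x assume "x \<in> gball d N"
    then show "G x \<in> Y" using in_ball[of x] out_sphere[of x] g(2) H(2)
      unfolding G_def in_part_def out_part_def by (cases "N x \<le> 1/2") auto
  qed
  moreover have "\<forall>x\<in>gsphere d N. G x = H (x, 0)"
    unfolding G_def out_part_def gsphere_def by (auto simp: scl_1)
  ultimately show ?thesis by blast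
qed

text \<open>The identity of \<open>U\<close> is homotopic to a map through \<open>A\<close>. So a
  map \<open>f\<close> from a sphere into \<open>U\<close> is homotopic to
  \<open>i \<circ> r \<circ> f\<close>, which extends because \<open>r \<circ> f\<close>
  does.\<close>

lemma fills_dominated:
  assumes r: "continuous_on U r" "r ` U \<subseteq> A" and i: "continuous_on A i" "i ` A \<subseteq> U"
    and h: "continuous_on (U \<times> {0..1::real}) h" "h ` (U \<times> {0..1}) \<subseteq> U"
      "\<And>x. x \<in> U \<Longrightarrow> h (x, 0) = x" "\<And>x. x \<in> U \<Longrightarrow> h (x, 1) = i (r x)"
    and A: "fills d A"
  shows "fills d U"
  unfolding fills_def extendable_def
proof (intro allI impI, elim conjE)
  let ?S = "gsphere d (enorm d)" and ?B = "gball d (enorm d)"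
  fix f assume f: "continuous_on ?S f" "f ` ?S \<subseteq> U"
  have "continuous_on ?S (\<lambda>x. r (f x))" "(\<lambda>x. r (f x)) ` ?S \<subseteq> A"
    using continuous_on_compose2[OF r(1) f] r(2) f(2) by auto
  then obtain g where g: "continuous_on ?B g" "g ` ?B \<subseteq> A" "\<And>x. x \<in> ?S \<Longrightarrow> g x = r (f x)"
    using A unfolding fills_def extendable_def by metis
  have "continuous_on (?S \<times> {0..1::real}) (\<lambda>z. f (fst z))"
    by (rule continuous_on_compose2[OF f(1) continuous_on_fst[OF continuous_on_id]]) auto
  then have c: "continuous_on (?S \<times> {0..1}) (\<lambda>z. h (f (fst z), snd z))"
    by (intro continuous_on_compose2[OF h(1)] continuous_on_Pair continuous_on_snd[OF continuous_on_id])
      (use f(2) in auto)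
  have "\<exists>G. continuous_on ?B G \<and> G ` ?B \<subseteq> U \<and> (\<forall>x\<in>?S. G x = (\<lambda>z. h (f (fst z), snd z)) (x, 0))"
  proof (rule homotopy_extends[OF gauge_norm_enorm c])
    show "continuous_on ?B (\<lambda>x. i (g x))" by (rule continuous_on_compose2[OF i(1) g(1,2)])
    show "(\<lambda>x. i (g x)) ` ?B \<subseteq> U" using g(2) i(2) by blast
    show "(\<lambda>z. h (f (fst z), snd z)) ` (?S \<times> {0..1}) \<subseteq> U"
      using f(2) h(2) by (auto simp: image_subset_iff)
    show "i (g x) = h (f (fst (x, 1::real)), snd (x, 1::real))" if "x \<in> ?S" for x
      using that g f h(4) by auto
  qed
  then show "\<exists>g. continuous_on ?B g \<and> g ` ?B \<subseteq> U \<and> (\<forall>x\<in>?S. g x = f x)"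
    using f(2) h(3) by (auto simp: image_subset_iff)
qed

lemma fills_singleton: "fills d {b}"
  unfolding fills_def extendable_def
proof (intro allI impI)
  fix f :: "(nat \<Rightarrow> real) \<Rightarrow> 'a"
  assume "continuous_on (gsphere d (enorm d)) f \<and> f ` gsphere d (enorm d) \<subseteq> {b}"
  then show "\<exists>g. continuous_on (gball d (enorm d)) g \<and> g ` gball d (enorm d) \<subseteq> {b} \<and>
      (\<forall>x\<in>gsphere d (enorm d). g x = f x)"
    by (intro exI[of _ "\<lambda>x. b"]) auto
qed

lemma fills_contracts:
  assumes "b \<in> U" and h: "continuous_on (U \<times> {0..1::real}) h" "h ` (U \<times> {0..1}) \<subseteq> U"
      "\<And>x. x \<in> U \<Longrightarrow> h (x, 0) = x" "\<And>x. x \<in> U \<Longrightarrow> h (x, 1) = b"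
  shows "fills d U"
  by (rule fills_dominated[of U "\<lambda>x. b" "{b}" "\<lambda>x. b" h]) (use assms fills_singleton in auto)

section \<open>Boxes and homotopies built cell by cell\<close>

definition cbx :: "('i \<Rightarrow> real) \<Rightarrow> ('i \<Rightarrow> real) \<Rightarrow> ('i \<Rightarrow> real) set" where
  "cbx a b = {x. \<forall>i. a i \<le> x i \<and> x i \<le> b i}"

text \<open>The boundary relative to the affine hull: coordinates with \<open>a i = b i\<close> do
  not count, so that lower-dimensional faces are boxes as well.\<close>

definition bd_cbx :: "('i \<Rightarrow> real) \<Rightarrow> ('i \<Rightarrow> real) \<Rightarrow> ('i \<Rightarrow> real) set" where
  "bd_cbx a b = {x\<in>cbx a b. \<exists>i. a i < b i \<and> (x i = a i \<or> x i = b i)}"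

text \<open>The nondegenerate coordinates, rescaled to \<open>[-1, 1]\<close>, map the box to the
  unit ball of \<open>supnorm d\<close>.\<close>

lemma fills_cbx:
  assumes le: "\<And>i. a i \<le> b i" and fin: "finite {i. a i < b i}" and card: "card {i. a i < b i} = d"
    and Y: "fills d Y"
  shows "extendable (cbx a b) (bd_cbx a b) Y"
proof -
  define J where "J = {i. a i < b i}"
  obtain e where e: "bij_betw e {..<d} J"
    using ex_bij_betw_nat_finite[of J] fin card unfolding J_def atLeast0LessThan by auto
  define p where "p x k = (if k < d then (2 * x (e k) - a (e k) - b (e k)) / (b (e k) - a (e k)) else 0)" for x k
  define q where "q y i = (if i \<in> J then (a i + b i + (b i - a i) * y (the_inv_into {..<d} e i)) / 2 else a i)" for y :: "nat \<Rightarrow> real" and i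
  have eJ: "e k \<in> J" if "k < d" for k using e that by (auto simp: bij_betw_def)
  have eK: "the_inv_into {..<d} e i < d" "e (the_inv_into {..<d} e i) = i" if "i \<in> J" for i
    using e that f_the_inv_into_f_bij_betw[OF e] the_inv_into_into[of e "{..<d}" i "{..<d}"]
    by (auto simp: bij_betw_def)
  have p_espace: "p x \<in> espace d" for x by (simp add: espace_def p_def)
  have pos: "b (e k) - a (e k) > 0" if "k < d" for k using eJ[OF that] unfolding J_def by simp
  have p_abs: "\<bar>p x k\<bar> \<le> 1" if "x \<in> cbx a b" "k < d" for x k
  proof -
    have "a (e k) \<le> x (e k)" "x (e k) \<le> b (e k)" using that unfolding cbx_def by auto
    then show ?thesis using pos[OF that(2)] that(2) unfolding p_def
      by (simp add: abs_le_iff field_simps)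
  qed
  show ?thesis
  proof (rule extendable_transfer)
    show "extendable (gball d (supnorm d)) (gsphere d (supnorm d)) Y"
      using Y fills_iff_gauge gauge_norm_supnorm by blast
    show "continuous_on (cbx a b) p"
    proof (rule continuous_on_coordinatewise_then_product)
      fix k
      show "continuous_on (cbx a b) (\<lambda>x. p x k)"
      proof (cases "k < d")
        case True
        then show ?thesis unfolding p_def using pos[OF True]
          by (auto intro!: continuous_intros continuous_on_coordinate)
      qed (simp add: p_def)
    qed
    show "p ` cbx a b \<subseteq> gball d (supnorm d)"
      using p_abs by (auto simp: gball_def espace_def p_def supnorm_le_iff)
    show "p ` bd_cbx a b \<subseteq> gsphere d (supnorm d)"
    proof safe
      fix x assume x: "x \<in> bd_cbx a b"
      then obtain i where i: "i \<in> J" "x i = a i \<or> x i = b i" unfolding bd_cbx_def J_def by auto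
      let ?k = "the_inv_into {..<d} e i"
      have "\<bar>p x ?k\<bar> = 1" using eK[OF i(1)] i pos[of ?k] unfolding p_def by (auto simp: field_simps)
      then show "p x \<in> gsphere d (supnorm d)"
        using x p_abs[of x] eK(1)[OF i(1)] p_espace unfolding gsphere_def bd_cbx_def
        by (auto simp: supnorm_eq_iff)
    qed
    show "continuous_on (gsphere d (supnorm d)) q"
    proof (rule continuous_on_coordinatewise_then_product)
      fix i
      show "continuous_on (gsphere d (supnorm d)) (\<lambda>x. q x i)"
        unfolding q_def by (cases "i \<in> J")
          (auto intro!: continuous_intros continuous_on_coordinate)
    qed
    show "q ` gsphere d (supnorm d) \<subseteq> bd_cbx a b"
    proof safe
      fix y assume y: "y \<in> gsphere d (supnorm d)"
      then have y1: "\<And>k. k < d \<Longrightarrow> \<bar>y k\<bar> \<le> 1" and "\<exists>k<d. \<bar>y k\<bar> = 1"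
        unfolding gsphere_def by (auto simp: supnorm_eq_iff)
      then obtain k where k: "k < d" "\<bar>y k\<bar> = 1" by blast
      have "a i \<le> q y i \<and> q y i \<le> b i" for i
      proof (cases "i \<in> J")
        case True
        let ?y = "y (the_inv_into {..<d} e i)"
        have "\<bar>?y\<bar> \<le> 1" using y1 eK[OF True] by blast
        moreover have "b i - a i > 0" using True unfolding J_def by simp
        ultimately have "\<bar>(b i - a i) * ?y\<bar> \<le> b i - a i"
          by (simp add: abs_mult mult_left_le)
        then show ?thesis using True unfolding q_def by (simp add: abs_le_iff)
      qed (use le in \<open>simp add: q_def\<close>)
      moreover have "e k \<in> J" "the_inv_into {..<d} e (e k) = k"
        using e k eJ by (auto simp: bij_betw_def the_inv_into_f_f)
      then have "q y (e k) = a (e k) \<or> q y (e k) = b (e k)"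
        using k unfolding q_def by (auto simp: abs_if field_simps split: if_splits)
      ultimately show "q y \<in> bd_cbx a b"
        using \<open>e k \<in> J\<close> unfolding bd_cbx_def cbx_def J_def by auto
    qed
    show "q (p x) = x" if "x \<in> bd_cbx a b" for x
    proof
      fix i
      show "q (p x) i = x i"
      proof (cases "i \<in> J")
        case True
        then have "b i - a i > 0" unfolding J_def by simp
        then show ?thesis using eK[OF True] True unfolding q_def p_def by (simp add: field_simps)
      next
        case False
        then have "a i = b i" using le[of i] unfolding J_def by simp
        moreover have "a i \<le> x i" "x i \<le> b i" using that unfolding bd_cbx_def cbx_def by auto
        ultimately show ?thesis using False unfolding q_def by simp
      qed
    qed
  qed
qed

text \<open>
  A cell complex is described by the cells together with the function that assigns to a point the
  unique cell containing it in its relative interior.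
\<close>

lemma skeletal_homotopy:
  fixes cell :: "'c \<Rightarrow> 'p::t2_space set" and dm :: "'c \<Rightarrow> nat" and X :: "'b::topological_space set"
  assumes fin: "finite \<C>" and closed: "\<And>c. c \<in> \<C> \<Longrightarrow> closed (cell c)"
    and idx: "\<And>c x. c \<in> \<C> \<Longrightarrow> x \<in> cell c \<Longrightarrow> idx x \<in> \<C> \<and> x \<in> cell (idx x) \<and>
      cell (idx x) \<subseteq> cell c \<and> (idx x = c \<or> dm (idx x) < dm c)"
    and car: "\<And>c c'. c \<in> \<C> \<Longrightarrow> c' \<in> \<C> \<Longrightarrow> cell c' \<subseteq> cell c \<Longrightarrow> dm c' < dm c \<Longrightarrow> car c' \<subseteq> car c"
    and ext: "\<And>c. c \<in> \<C> \<Longrightarrow> extendable (cell c \<times> {0..1::real})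
      ({x\<in>cell c. idx x \<noteq> c} \<times> {0..1} \<union> cell c \<times> {0, 1}) (car c)"
    and f: "\<And>c. c \<in> \<C> \<Longrightarrow> continuous_on (cell c) f" "\<And>c. c \<in> \<C> \<Longrightarrow> f ` cell c \<subseteq> car c"
    and c0: "\<And>c. c \<in> \<C> \<Longrightarrow> c0 \<in> car c" and X: "\<And>c. c \<in> \<C> \<Longrightarrow> car c \<subseteq> X"
  shows "\<exists>h. continuous_on ((\<Union>c\<in>\<C>. cell c) \<times> {0..1::real}) h \<and> h ` ((\<Union>c\<in>\<C>. cell c) \<times> {0..1}) \<subseteq> X \<and>
    (\<forall>x\<in>\<Union>c\<in>\<C>. cell c. h (x, 0) = f x \<and> h (x, 1) = c0)"
proof -
  define good where "good h c \<longleftrightarrow> continuous_on (cell c \<times> {0..1}) h \<and> h ` (cell c \<times> {0..1}) \<subseteq> car c \<and>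
    (\<forall>x\<in>cell c. h (x, 0) = f x \<and> h (x, 1) = c0)" for h :: "'p \<times> real \<Rightarrow> 'b" and c
  have "\<exists>h. \<forall>c\<in>\<C>. dm c < j \<longrightarrow> good h c" for j :: nat
  proof (induction j)
    case (Suc j)
    then obtain h where h: "\<And>c. c \<in> \<C> \<Longrightarrow> dm c < j \<Longrightarrow> good h c" by blast
    \<comment> \<open>The data prescribed on the prism over a new cell: \<open>f\<close> at the
      bottom, \<open>c0\<close> at the top, and on the sides the homotopy already built over lower
      cells.\<close>
    define h0 where "h0 z = (if snd z = 0 then f (fst z) else if snd z = 1 then c0 else h z)" for z
    let ?bd = "\<lambda>c. {x\<in>cell c. idx x \<noteq> c}"
    have ex: "\<exists>g. good g c \<and> (\<forall>z\<in>?bd c \<times> {0..1::real}. g z = h z)" if c: "c \<in> \<C>" "dm c = j" for c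
    proof -
      let ?F = "{c'\<in>\<C>. cell c' \<subseteq> cell c \<and> dm c' < j}"
      \<comment> \<open>The boundary is a finite union of closed lower cells, which gives continuity
        on the sides by pasting.\<close>
      have bd: "?bd c = (\<Union>c'\<in>?F. cell c')"
      proof (intro Set.set_eqI iffI)
        fix x assume "x \<in> ?bd c"
        then show "x \<in> (\<Union>c'\<in>?F. cell c')" using idx[OF c(1), of x] c by blast
      next
        fix x assume "x \<in> (\<Union>c'\<in>?F. cell c')"
        then obtain c' where c': "c' \<in> \<C>" "cell c' \<subseteq> cell c" "dm c' < j" "x \<in> cell c'" by blast
        then have "dm (idx x) < j" using idx[of c' x] by auto
        then show "x \<in> ?bd c" using c' c by auto
      qed
      have h0_h: "h0 z = h z" if "z \<in> cell c' \<times> {0..1}" "c' \<in> ?F" for z c'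
        using h[of c'] that unfolding good_def h0_def by auto
      have cont1: "continuous_on (?bd c \<times> {0..1}) h0"
      proof -
        have "continuous_on (cell c' \<times> {0..1}) h0" if "c' \<in> ?F" for c'
        proof -
          have "continuous_on (cell c' \<times> {0..1}) h" using h that unfolding good_def by blast
          then show ?thesis using h0_h that by (subst continuous_on_cong[OF refl, of _ h0 h]) auto
        qed
        then have "continuous_on (\<Union>c'\<in>?F. cell c' \<times> {0..1}) h0"
          using fin closed by (intro continuous_on_closed_Union) (auto intro: closed_Times)
        moreover have "?bd c \<times> {0..1} = (\<Union>c'\<in>?F. cell c' \<times> {0..1::real})" unfolding bd by blast
        ultimately show ?thesis by simp
      qed
      have cont2: "continuous_on (cell c \<times> {0}) h0"
        by (rule continuous_on_eq[of _ "\<lambda>z. f (fst z)"])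
          (auto simp: h0_def intro!: continuous_on_compose2[OF f(1)[OF c(1)]] continuous_intros)
      have cont3: "continuous_on (cell c \<times> {1}) h0"
        by (rule continuous_on_eq[of _ "\<lambda>z. c0"]) (auto simp: h0_def)
      have "closed (?bd c)" unfolding bd using fin closed by (intro closed_UN) auto
      then have contD: "continuous_on (?bd c \<times> {0..1} \<union> (cell c \<times> {0} \<union> cell c \<times> {1})) h0"
        (is "continuous_on ?D _")
        using closed[OF c(1)] cont1 cont2 cont3
        by (intro continuous_on_closed_Un closed_Un) (auto intro: closed_Times)
      have D: "?D = ?bd c \<times> {0..1} \<union> cell c \<times> {0, 1}" by blast
      have imD: "h0 ` (?bd c \<times> {0..1} \<union> cell c \<times> {0, 1}) \<subseteq> car c"
      proof (intro image_subsetI, elim UnE)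
        fix z assume z: "z \<in> ?bd c \<times> {0..1::real}"
        then obtain c' where c': "c' \<in> ?F" "z \<in> cell c' \<times> {0..1}" unfolding bd by auto
        then have "h z \<in> car c'" using h[of c'] unfolding good_def by blast
        moreover have "car c' \<subseteq> car c" using c' c by (intro car) auto
        ultimately show "h0 z \<in> car c" using h0_h c' by auto
      next
        fix z assume "z \<in> cell c \<times> {0, 1::real}"
        then show "h0 z \<in> car c" using f(2)[OF c(1)] c0[OF c(1)] unfolding h0_def by auto
      qed
      obtain g where g: "continuous_on (cell c \<times> {0..1}) g" "g ` (cell c \<times> {0..1}) \<subseteq> car c"
        "\<And>z. z \<in> ?bd c \<times> {0..1} \<union> cell c \<times> {0, 1} \<Longrightarrow> g z = h0 z"
        by (rule extendableE[OF ext[OF c(1)] contD[unfolded D] imD]) (rule that)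
      have "g z = h z" if z: "z \<in> ?bd c \<times> {0..1::real}" for z
      proof -
        obtain c' where "c' \<in> ?F" "z \<in> cell c' \<times> {0..1}" using z unfolding bd by auto
        then show ?thesis using g(3) h0_h z by auto
      qed
      moreover have "good g c" using g unfolding good_def h0_def by auto
      ultimately show ?thesis by blast
    qed
    define g where "g c = (SOME g. good g c \<and> (\<forall>z\<in>?bd c \<times> {0..1::real}. g z = h z))" for c
    have g: "good (g c) c \<and> (\<forall>z\<in>?bd c \<times> {0..1::real}. g c z = h z)" if "c \<in> \<C>" "dm c = j" for c
      unfolding g_def using ex[OF that] by (rule someI_ex)
    \<comment> \<open>Each point uses the map chosen for the cell that has it in its relative
      interior. On a whole closed cell \<open>c\<close> of dimension \<open>j\<close> this is
      \<open>g c\<close>, since \<open>g c\<close> agrees with \<open>h\<close> on the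
      boundary.\<close>
    define h' where "h' z = (if dm (idx (fst z)) = j then g (idx (fst z)) z else h z)" for z
    have "good h' c" if c: "c \<in> \<C>" "dm c < Suc j" for c
    proof (cases "dm c = j")
      case True
      have "h' z = g c z" if "z \<in> cell c \<times> {0..1}" for z
      proof (cases "idx (fst z) = c")
        case False
        then have "dm (idx (fst z)) < j" using idx[OF c(1), of "fst z"] that True by auto
        then show ?thesis using g[OF c(1) True] that False unfolding h'_def by auto
      qed (simp add: h'_def True)
      moreover have "good (g c) c" using g[OF c(1) True] by blast
      ultimately show ?thesis unfolding good_def
        by (auto simp: image_subset_iff intro: continuous_on_eq)
    next
      case False
      then have "dm c < j" using c by simp
      moreover have "h' z = h z" if "z \<in> cell c \<times> {0..1}" for z
        using idx[OF c(1), of "fst z"] that \<open>dm c < j\<close> unfolding h'_def by auto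
      moreover have "good h c" using h c \<open>dm c < j\<close> by blast
      ultimately show ?thesis unfolding good_def
        by (auto simp: image_subset_iff intro: continuous_on_eq)
    qed
    then show ?case by blast
  qed simp
  then obtain h where h: "\<forall>c\<in>\<C>. dm c < Suc (Max (dm ` \<C>)) \<longrightarrow> good h c" by blast
  then have h: "good h c" if "c \<in> \<C>" for c using that fin by (simp add: le_imp_less_Suc)
  have U: "(\<Union>c\<in>\<C>. cell c) \<times> {0..1::real} = (\<Union>c\<in>\<C>. cell c \<times> {0..1})" by blast
  have "continuous_on ((\<Union>c\<in>\<C>. cell c) \<times> {0..1}) h"
    unfolding U using fin closed h by (intro continuous_on_closed_Union) (auto simp: good_def intro: closed_Times)
  moreover have "h ` ((\<Union>c\<in>\<C>. cell c) \<times> {0..1}) \<subseteq> X"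
    using h X unfolding good_def by blast
  ultimately show ?thesis using h unfolding good_def by blast
qed

text \<open>The coordinate \<open>k\<close>, constantly 0 on the box, is used as time; the prism
  over the box thus becomes a box of one dimension more, whose boundary consists of the sides, the
  bottom and the top.\<close>

lemma extendable_cbx_times_interval:
  fixes a b :: "nat \<Rightarrow> real"
  assumes le: "\<And>i. a i \<le> b i" and fin: "finite {i. a i < b i}" and k: "a k = 0" "b k = 0"
    and Y: "fills (Suc (card {i. a i < b i})) Y"
  shows "extendable (cbx a b \<times> {0..1::real}) (bd_cbx a b \<times> {0..1} \<union> cbx a b \<times> {0, 1}) Y"
proof -
  let ?b = "b(k := 1)"
  define p where "p z = (fst z)(k := snd z)" for z :: "(nat \<Rightarrow> real) \<times> real"
  define q where "q z = (z(k := 0), z k)" for z :: "nat \<Rightarrow> real"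
  have J: "{i. a i < ?b i} = insert k {i. a i < b i}" using k by auto
  have "extendable (cbx a ?b) (bd_cbx a ?b) Y"
  proof (rule fills_cbx)
    show "a i \<le> ?b i" for i using le k by simp
    show "finite {i. a i < ?b i}" unfolding J using fin by simp
    show "card {i. a i < ?b i} = Suc (card {i. a i < b i})" unfolding J using fin k by simp
  qed (rule Y)
  then show ?thesis
  proof (rule extendable_transfer)
    show "continuous_on (cbx a b \<times> {0..1}) p"
    proof (rule continuous_on_coordinatewise_then_product)
      fix i
      have "continuous_on (cbx a b \<times> {0..1::real}) (\<lambda>z. fst z i)"
        by (rule continuous_on_compose2[OF continuous_on_coordinate[of UNIV i] continuous_on_fst[OF continuous_on_id]]) simp
      then show "continuous_on (cbx a b \<times> {0..1}) (\<lambda>z. p z i)"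
        unfolding p_def by (cases "i = k") (auto intro: continuous_on_snd)
    qed
    show "p ` (cbx a b \<times> {0..1}) \<subseteq> cbx a ?b"
      using k unfolding p_def cbx_def by auto
    show "p ` (bd_cbx a b \<times> {0..1} \<union> cbx a b \<times> {0, 1}) \<subseteq> bd_cbx a ?b"
    proof (intro image_subsetI, elim UnE)
      fix z assume "z \<in> bd_cbx a b \<times> {0..1::real}"
      then obtain x t i where z: "z = (x, t)" "x \<in> cbx a b" "0 \<le> t" "t \<le> 1"
        "a i < b i" "x i = a i \<or> x i = b i"
        unfolding bd_cbx_def by auto
      moreover have "i \<noteq> k" using z(5) k by auto
      ultimately show "p z \<in> bd_cbx a ?b" using k unfolding p_def cbx_def bd_cbx_def
        by (auto intro!: exI[of _ i])
    next
      fix z assume "z \<in> cbx a b \<times> {0, 1::real}"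
      then show "p z \<in> bd_cbx a ?b" using k unfolding p_def cbx_def bd_cbx_def
        by (auto intro!: exI[of _ k])
    qed
    have "continuous_on (bd_cbx a ?b) (\<lambda>z. (z(k := 0)))"
    proof (rule continuous_on_coordinatewise_then_product)
      fix i
      show "continuous_on (bd_cbx a ?b) (\<lambda>z. (z(k := 0)) i)"
        by (cases "i = k") (auto intro: continuous_on_coordinate)
    qed
    then show "continuous_on (bd_cbx a ?b) q"
      unfolding q_def by (intro continuous_on_Pair continuous_on_coordinate)
    show "q ` bd_cbx a ?b \<subseteq> bd_cbx a b \<times> {0..1} \<union> cbx a b \<times> {0, 1}"
    proof (intro image_subsetI)
      fix z assume "z \<in> bd_cbx a ?b"
      then obtain i where z: "z \<in> cbx a ?b" "a i < ?b i" "z i = a i \<or> z i = ?b i"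
        unfolding bd_cbx_def by auto
      then have c: "z(k := 0) \<in> cbx a b" "z k \<in> {0..1}" using k unfolding cbx_def
        by (auto simp: fun_upd_def split: if_splits)
      show "q z \<in> bd_cbx a b \<times> {0..1} \<union> cbx a b \<times> {0, 1}"
      proof (cases "i = k")
        case True
        then show ?thesis using z c k unfolding q_def by auto
      next
        case False
        then have "z(k := 0) \<in> bd_cbx a b" using z c unfolding bd_cbx_def by auto
        then show ?thesis using c unfolding q_def by auto
      qed
    qed
    show "q (p z) = z" if "z \<in> bd_cbx a b \<times> {0..1} \<union> cbx a b \<times> {0, 1}" for z
    proof -
      have "fst z \<in> cbx a b" using that unfolding bd_cbx_def by auto
      then have "fst z k = 0" using k unfolding cbx_def by (metis (mono_tags, lifting) mem_Collect_eq order_antisym)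
      then show ?thesis unfolding q_def p_def by (auto simp: fun_upd_idem prod_eq_iff)
    qed
  qed
qed

text \<open>The factor 2 is the sum of the weights \<open>(1/2)^n\<close> in the metric on
  functions.\<close>

lemma dist_fun_le:
  fixes x y :: "nat \<Rightarrow> real"
  assumes "\<And>i. \<bar>x i - y i\<bar> \<le> e"
  shows "dist x y \<le> 2 * e"
proof -
  have e: "0 \<le> e" using assms[of 0] by linarith
  have s: "summable (\<lambda>n. (1/2::real)^n * e)" by (intro summable_mult2 summable_geometric) simp
  have le: "(1/2)^n * min (dist (x (from_nat n)) (y (from_nat n))) 1 \<le> (1/2::real)^n * e" for n
    using assms by (intro mult_left_mono) (auto simp: dist_real_def intro: min.coboundedI1)
  have "dist x y \<le> suminf (\<lambda>n. (1/2::real)^n * e)"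
    unfolding dist_fun_def
    by (intro suminf_le le s summable_comparison_test'[OF s]) (use le e in \<open>auto simp: abs_mult\<close>)
  also have "\<dots> = 2 * e" by (simp add: suminf_mult2[symmetric] suminf_geometric summable_geometric)
  finally show ?thesis .
qed

lemma compact_cbx: "compact (cbx a b)"
proof -
  have "compactin (product_topology (\<lambda>i. euclidean) UNIV) (PiE UNIV (\<lambda>i. {a i..b i}))"
    unfolding compactin_PiE by simp
  moreover have "PiE UNIV (\<lambda>i. {a i..b i}) = cbx a b" by (auto simp: cbx_def PiE_def)
  ultimately show ?thesis by (simp add: euclidean_product_topology)
qed

lemma closed_cbx: "closed (cbx a b :: (nat \<Rightarrow> real) set)"
  using compact_cbx compact_imp_closed by blast

lemma gsphere_supnorm_cbx:
  "gball d (supnorm d) = cbx (\<lambda>i. if i < d then -1 else 0) (\<lambda>i. if i < d then 1 else 0)"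
proof (intro Set.set_eqI iffI)
  fix x assume "x \<in> gball d (supnorm d)"
  then show "x \<in> cbx (\<lambda>i. if i < d then -1 else 0) (\<lambda>i. if i < d then 1 else 0)"
    unfolding gball_def cbx_def espace_def by (auto simp: supnorm_le_iff abs_le_iff)
next
  fix x assume "x \<in> cbx (\<lambda>i. if i < d then -1 else 0) (\<lambda>i. if i < d then 1 else (0::real))"
  then have x: "(if i < d then -1 else 0) \<le> x i" "x i \<le> (if i < d then 1 else 0)" for i
    unfolding cbx_def by auto
  have "x i = 0" if "i \<ge> d" for i using x[of i] that by simp
  moreover have "\<bar>x i\<bar> \<le> 1" if "i < d" for i using x[of i] that by simp
  ultimately show "x \<in> gball d (supnorm d)"
    unfolding gball_def espace_def by (simp add: supnorm_le_iff)
qed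

lemma compact_gsphere_supnorm: "compact (gsphere d (supnorm d))"
proof -
  have "closed {x. supnorm d x = 1}"
    by (intro closed_Collect_eq gauge_norm_cont[OF gauge_norm_supnorm] continuous_intros)
  moreover have "gsphere d (supnorm d) = gball d (supnorm d) \<inter> {x. supnorm d x = 1}"
    by (auto simp: gsphere_def gball_def)
  ultimately show ?thesis using compact_cbx gsphere_supnorm_cbx by (metis compact_Int_closed)
qed

text \<open>A \<open>(d - 1)\<close>-sphere is subdivided into cells of dimension at most
  \<open>d - 1\<close>, and its nullhomotopy is built over prisms of dimension at most
  \<open>d\<close>. Only the prisms over top cells have dimension \<open>d\<close>, and these may
  use all of \<open>U\<close> or all of \<open>V\<close>; hence \<open>U \<inter> V\<close> has to
  fill one dimension less.\<close>

lemma fills_Un: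
  assumes X: "X = U \<union> V" and op: "openin (top_of_set X) U" "openin (top_of_set X) V"
    and fills: "\<And>d. d \<le> D \<Longrightarrow> fills d U" "\<And>d. d \<le> D \<Longrightarrow> fills d V" "\<And>d. d < D \<Longrightarrow> fills d (U \<inter> V)"
    and d: "d \<le> D"
  shows "fills d X"
proof (cases "d = 0")
  case True
  then show ?thesis using fills(1)[of 0] X by (auto simp: fills_0)
next
  case d0: False
  let ?S = "gsphere d (supnorm d)"
  show ?thesis
    unfolding fills_iff_gauge[OF gauge_norm_supnorm] extendable_def
  proof (intro allI impI, elim conjE)
    fix f assume f: "continuous_on ?S f" "f ` ?S \<subseteq> X"
    \<comment> \<open>As \<open>0 < d\<close>, the intersection fills dimension 0, that is, it is
      nonempty. Its point \<open>c0\<close> lies in every carrier and serves as the end of the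
      homotopy.\<close>
    obtain c0 where c0: "c0 \<in> U" "c0 \<in> V" using fills(3)[of 0] d d0 by (auto simp: fills_0)
    have "openin (top_of_set ?S) (?S \<inter> f -` U)" "openin (top_of_set ?S) (?S \<inter> f -` V)"
      using continuous_openin_preimage[OF f(1)] f(2) op by (auto simp: Pi_iff image_subset_iff)
    then obtain U1 V1 where UV: "open U1" "?S \<inter> f -` U = ?S \<inter> U1" "open V1" "?S \<inter> f -` V = ?S \<inter> V1"
      unfolding openin_open by blast
    have cover: "?S \<subseteq> \<Union>{U1, V1}"
    proof
      fix x assume x: "x \<in> ?S"
      then have "f x \<in> U \<or> f x \<in> V" using f(2) X by auto
      then have "x \<in> ?S \<inter> U1 \<or> x \<in> ?S \<inter> V1" unfolding UV(2,4)[symmetric] using x by auto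
      then show "x \<in> \<Union>{U1, V1}" by auto
    qed
    obtain \<delta> where \<delta>: "0 < \<delta>" "\<And>T. T \<subseteq> ?S \<Longrightarrow> diameter T < \<delta> \<Longrightarrow> \<exists>B\<in>{U1, V1}. T \<subseteq> B"
      using Lebesgue_number_lemma[OF compact_gsphere_supnorm _ cover] UV by (metis empty_iff insert_iff)
    \<comment> \<open>Cells with edges of length \<open>1 / N\<close> have diameter at most
      \<open>2 / N\<close> in the metric on functions; below the Lebesgue number each cell is mapped
      into \<open>U\<close> or into \<open>V\<close>.\<close>
    obtain N :: nat where N: "2 / \<delta> < N" using reals_Archimedean2 by blast
    then have "0 < real N" using \<delta>(1) by (metis divide_pos_pos order_less_trans zero_less_numeral)
    then have N0: "0 < N" "2 / N < \<delta>" using \<delta>(1) N by (auto simp: field_simps)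
    define cell where "cell c = cbx (\<lambda>i. of_int (fst c i) / N) (\<lambda>i. of_int (snd c i) / N)"
      for c :: "(nat \<Rightarrow> int) \<times> (nat \<Rightarrow> int)"
    have cell_iff: "x \<in> cell c \<longleftrightarrow> (\<forall>i. of_int (fst c i) \<le> N * x i \<and> N * x i \<le> of_int (snd c i))" for x :: "nat \<Rightarrow> real" and c
      using N0 unfolding cell_def cbx_def by (auto simp: field_simps)
    \<comment> \<open>A cell is coded by its lower and upper corner, scaled by \<open>N\<close>;
      \<open>l i = u i\<close> marks a degenerate coordinate. The last condition, a coordinate
      frozen at \<open>N\<close> or \<open>- N\<close>, puts the cell on the surface of the
      cube.\<close>
    define \<C> where "\<C> = {(l, u). (\<forall>i. l i \<le> u i \<and> u i \<le> l i + 1 \<and> - int N \<le> l i \<and> u i \<le> int N) \<and>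
      (\<forall>i\<ge>d. l i = 0 \<and> u i = 0) \<and> (\<exists>i<d. l i = u i \<and> \<bar>l i\<bar> = int N)}"
    have \<C>_iff: "c \<in> \<C> \<longleftrightarrow> (\<forall>i. fst c i \<le> snd c i \<and> snd c i \<le> fst c i + 1 \<and> - int N \<le> fst c i \<and> snd c i \<le> int N) \<and>
      (\<forall>i\<ge>d. fst c i = 0 \<and> snd c i = 0) \<and> (\<exists>i<d. fst c i = snd c i \<and> \<bar>fst c i\<bar> = int N)" for c
      unfolding \<C>_def by (cases c) simp
    have support: "{i. fst c i < snd c i} \<subseteq> {..<d}" if "c \<in> \<C>" for c
    proof
      fix i assume "i \<in> {i. fst c i < snd c i}"
      then have "\<not> (fst c i = 0 \<and> snd c i = 0)" by auto
      then have "\<not> d \<le> i" using that unfolding \<C>_iff by blast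
      then show "i \<in> {..<d}" by simp
    qed
    \<comment> \<open>Rounding down and up gives the smallest cell containing \<open>x\<close>, the
      one with \<open>x\<close> in its relative interior.\<close>
    define idx where "idx x = (\<lambda>i. \<lfloor>N * x i\<rfloor>, \<lambda>i. \<lceil>N * x i\<rceil>)" for x :: "nat \<Rightarrow> real"
    define dm where "dm c = card {i. fst c i < snd c i}" for c :: "(nat \<Rightarrow> int) \<times> (nat \<Rightarrow> int)"
    have fin_support: "finite {i. fst c i < snd c i}" if "c \<in> \<C>" for c
      using support[OF that] finite_subset by blast
    have idx: "idx x \<in> \<C> \<and> x \<in> cell (idx x) \<and> cell (idx x) \<subseteq> cell c \<and> (idx x = c \<or> dm (idx x) < dm c)"
      if c: "c \<in> \<C>" and x: "x \<in> cell c" for c x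
    proof -
      obtain l u where lu: "c = (l, u)" by fastforce
      have b: "of_int (l i) \<le> N * x i" "N * x i \<le> of_int (u i)" for i using x lu cell_iff by auto
      have b': "l i \<le> \<lfloor>N * x i\<rfloor>" "\<lceil>N * x i\<rceil> \<le> u i" for i
        using b[of i] by (simp_all add: le_floor_iff ceiling_le_iff)
      have fc: "\<lfloor>N * x i\<rfloor> \<le> \<lceil>N * x i\<rceil>" "\<lceil>N * x i\<rceil> \<le> \<lfloor>N * x i\<rfloor> + 1" for i
        using ceiling_diff_floor_le_1[of "N * x i"] floor_le_ceiling[of "N * x i"] by auto
      have lu_props: "l i \<le> u i" "u i \<le> l i + 1" "- int N \<le> l i" "u i \<le> int N" for i
        using c lu unfolding \<C>_def by auto
      have eq: "\<lfloor>N * x i\<rfloor> = l i \<and> \<lceil>N * x i\<rceil> = u i" if "l i = u i" for i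
        using b'[of i] fc(1)[of i] that by linarith
      obtain i0 where i0: "i0 < d" "l i0 = u i0" "\<bar>l i0\<bar> = int N" using c lu unfolding \<C>_def by auto
      have "idx x \<in> \<C>"
        unfolding \<C>_iff idx_def fst_conv snd_conv
      proof (intro conjI allI impI)
        fix i
        show "\<lfloor>N * x i\<rfloor> \<le> \<lceil>N * x i\<rceil>" "\<lceil>N * x i\<rceil> \<le> \<lfloor>N * x i\<rfloor> + 1" using fc by auto
        show "- int N \<le> \<lfloor>N * x i\<rfloor>" "\<lceil>N * x i\<rceil> \<le> int N" using b'[of i] lu_props[of i] by auto
        show "\<lfloor>N * x i\<rfloor> = 0" "\<lceil>N * x i\<rceil> = 0" if "d \<le> i"
          using eq[of i] that c lu unfolding \<C>_def by auto
        show "\<exists>i<d. \<lfloor>N * x i\<rfloor> = \<lceil>N * x i\<rceil> \<and> \<bar>\<lfloor>N * x i\<rfloor>\<bar> = int N"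
          using eq[OF i0(2)] i0 by auto
      qed
      moreover have "x \<in> cell (idx x)" unfolding cell_iff idx_def by simp
      moreover have "cell (idx x) \<subseteq> cell c"
      proof
        fix y assume y: "y \<in> cell (idx x)"
        have "of_int (l i) \<le> N * y i \<and> N * y i \<le> of_int (u i)" for i
        proof -
          have "of_int \<lfloor>N * x i\<rfloor> \<le> N * y i" "N * y i \<le> of_int \<lceil>N * x i\<rceil>"
            using y unfolding cell_iff idx_def by auto
          moreover have "real_of_int (l i) \<le> of_int \<lfloor>N * x i\<rfloor>" "real_of_int \<lceil>N * x i\<rceil> \<le> of_int (u i)"
            using b'[of i] by (simp_all only: of_int_le_iff)
          ultimately show ?thesis by linarith
        qed
        then show "y \<in> cell c" unfolding cell_iff lu by simp
      qed
      moreover have "dm (idx x) < dm c" if "idx x \<noteq> c"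
        unfolding dm_def
      proof (rule psubset_card_mono[OF fin_support[OF c]])
        have sub: "l i < u i \<and> \<lfloor>N * x i\<rfloor> = l i \<and> \<lceil>N * x i\<rceil> = u i" if "\<lfloor>N * x i\<rfloor> < \<lceil>N * x i\<rceil>" for i
          using that b'[of i] lu_props[of i] by linarith
        moreover have "\<exists>i. l i < u i \<and> \<not> \<lfloor>N * x i\<rfloor> < \<lceil>N * x i\<rceil>"
        proof (rule ccontr)
          assume "\<not> ?thesis"
          then have "\<lfloor>N * x i\<rfloor> = l i \<and> \<lceil>N * x i\<rceil> = u i" for i
            using sub[of i] eq[of i] lu_props(1)[of i] by (metis order_le_less)
          then show False using \<open>idx x \<noteq> c\<close> lu unfolding idx_def by auto
        qed
        ultimately show "{i. fst (idx x) i < snd (idx x) i} \<subset> {i. fst c i < snd c i}"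
          unfolding idx_def lu by auto
      qed
      ultimately show ?thesis by blast
    qed
    have bd: "{x\<in>cell c. idx x \<noteq> c} = bd_cbx (\<lambda>i. of_int (fst c i) / N) (\<lambda>i. of_int (snd c i) / N)"
      if c: "c \<in> \<C>" for c
    proof -
      obtain l u where lu: "c = (l, u)" by fastforce
      have lu_props: "l i \<le> u i" "u i \<le> l i + 1" for i using c lu unfolding \<C>_def by auto
      have "idx x \<noteq> c \<longleftrightarrow> (\<exists>i. l i < u i \<and> (real N * x i = of_int (l i) \<or> real N * x i = of_int (u i)))" if x: "x \<in> cell c" for x :: "nat \<Rightarrow> real"
      proof
        assume "\<exists>i. l i < u i \<and> (real N * x i = of_int (l i) \<or> real N * x i = of_int (u i))"
        then show "idx x \<noteq> c"
        proof (elim exE conjE)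
          fix i assume i: "l i < u i" "real N * x i = of_int (l i) \<or> real N * x i = of_int (u i)"
          then have "\<lfloor>real N * x i\<rfloor> = \<lceil>real N * x i\<rceil>" by auto
          then have "fst (idx x) i = snd (idx x) i" by (simp add: idx_def)
          then show ?thesis using i(1) lu by auto
        qed
      next
        assume ne: "idx x \<noteq> c"
        show "\<exists>i. l i < u i \<and> (real N * x i = of_int (l i) \<or> real N * x i = of_int (u i))"
        proof (rule ccontr)
          assume no: "\<not> ?thesis"
          have "\<lfloor>N * x i\<rfloor> = l i \<and> \<lceil>N * x i\<rceil> = u i" for i
          proof (cases "l i = u i")
            case True
            moreover have "of_int (l i) \<le> N * x i" "N * x i \<le> of_int (u i)" using x lu cell_iff by auto
            ultimately have "N * x i = of_int (l i)" by simp
            then show ?thesis using True by simp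
          next
            case False
            then have u: "u i = l i + 1" using lu_props[of i] by linarith
            moreover have "of_int (l i) \<le> N * x i" "N * x i \<le> of_int (u i)" using x lu cell_iff by auto
            moreover have "real N * x i \<noteq> of_int (l i)" "real N * x i \<noteq> of_int (u i)" using no u by (metis less_add_one)+
            ultimately have "of_int (l i) < N * x i" "N * x i < of_int (l i) + 1" by auto
            then show ?thesis unfolding u by (simp add: floor_eq_iff ceiling_eq_iff)
          qed
          then show False using ne unfolding idx_def lu by auto
        qed
      qed
      then have "{x\<in>cell c. idx x \<noteq> c} = {x\<in>cell c. \<exists>i. l i < u i \<and> (real N * x i = of_int (l i) \<or> real N * x i = of_int (u i))}" by blast
      also have "\<dots> = bd_cbx (\<lambda>i. of_int (fst c i) / N) (\<lambda>i. of_int (snd c i) / N)"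
        using N0 unfolding bd_cbx_def cell_def lu by (auto simp: field_simps)
      finally show ?thesis .
    qed
    have fin\<C>: "finite \<C>"
    proof -
      let ?F = "{l. \<forall>i. (i \<in> {..<d} \<longrightarrow> l i \<in> {- int N..int N}) \<and> (i \<notin> {..<d} \<longrightarrow> l i = 0)}"
      have "finite ?F" by (rule finite_set_of_finite_funs) auto
      moreover have "\<C> \<subseteq> ?F \<times> ?F"
        unfolding \<C>_def by (auto intro: order_trans)
      ultimately show ?thesis by (meson finite_SigmaI finite_subset)
    qed
    have union: "(\<Union>c\<in>\<C>. cell c) = ?S"
    proof (intro Set.set_eqI iffI)
      fix x assume "x \<in> (\<Union>c\<in>\<C>. cell c)"
      then obtain c where c: "c \<in> \<C>" "x \<in> cell c" by blast
      obtain l u where lu: "c = (l, u)" by fastforce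
      have b: "of_int (l i) \<le> N * x i" "N * x i \<le> of_int (u i)" for i using c lu cell_iff by auto
      have "x i = 0" if "i \<ge> d" for i
        using b[of i] c lu that N0 unfolding \<C>_def by auto
      moreover have "\<bar>x i\<bar> \<le> 1" for i
      proof -
        have "- int N \<le> l i" "u i \<le> int N" using c lu unfolding \<C>_def by auto
        then have "- real N \<le> of_int (l i)" "of_int (u i) \<le> real N" by linarith+
        then have "\<bar>N * x i\<bar> \<le> real N" using b[of i] by (simp add: abs_le_iff)
        then show ?thesis using N0 by (simp add: abs_mult)
      qed
      moreover obtain i0 where i0: "i0 < d" "l i0 = u i0" "\<bar>l i0\<bar> = int N"
        using c lu unfolding \<C>_def by auto
      then have "N * x i0 = of_int (l i0)" using b[of i0] by simp
      then have "\<bar>real N * x i0\<bar> = of_int \<bar>l i0\<bar>" by simp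
      then have "real N * \<bar>x i0\<bar> = real N" unfolding i0(3) by (simp add: abs_mult)
      then have "\<bar>x i0\<bar> = 1" using N0 by simp
      ultimately show "x \<in> ?S" using i0 unfolding gsphere_def espace_def by (auto simp: supnorm_eq_iff)
    next
      fix x assume "x \<in> ?S"
      then have x: "\<And>i. i \<ge> d \<Longrightarrow> x i = 0" "\<And>i. i < d \<Longrightarrow> \<bar>x i\<bar> \<le> 1" "\<exists>i<d. \<bar>x i\<bar> = 1"
        unfolding gsphere_def espace_def by (auto simp: supnorm_eq_iff)
      obtain i0 where i0: "i0 < d" "\<bar>x i0\<bar> = 1" using x by blast
      have bnd: "- real N \<le> N * x i" "N * x i \<le> real N" for i
      proof -
        have "\<bar>x i\<bar> \<le> 1" using x by (cases "i < d") auto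
        then have "\<bar>N * x i\<bar> \<le> real N" using N0 by (simp add: abs_mult)
        then show "- real N \<le> N * x i" "N * x i \<le> real N" by auto
      qed
      have "idx x \<in> \<C>"
        unfolding \<C>_iff idx_def fst_conv snd_conv
      proof (intro conjI allI impI)
        fix i
        show "\<lfloor>N * x i\<rfloor> \<le> \<lceil>N * x i\<rceil>" "\<lceil>N * x i\<rceil> \<le> \<lfloor>N * x i\<rfloor> + 1"
          using ceiling_diff_floor_le_1[of "N * x i"] floor_le_ceiling[of "N * x i"] by auto
        show "- int N \<le> \<lfloor>N * x i\<rfloor>" using bnd(1)[of i] by (simp add: le_floor_iff)
        show "\<lceil>N * x i\<rceil> \<le> int N" using bnd(2)[of i] by (simp add: ceiling_le_iff)
        show "\<lfloor>N * x i\<rfloor> = 0" "\<lceil>N * x i\<rceil> = 0" if "d \<le> i" using x(1) that by auto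
        have "real N * x i0 = of_int (int N) \<or> real N * x i0 = of_int (- int N)"
          using i0(2) by (auto simp: abs_if split: if_splits)
        then have "\<lfloor>real N * x i0\<rfloor> = \<lceil>real N * x i0\<rceil> \<and> \<bar>\<lfloor>real N * x i0\<rfloor>\<bar> = int N"
          by (metis abs_minus_cancel abs_of_nat ceiling_of_int floor_of_int)
        then show "\<exists>i<d. \<lfloor>N * x i\<rfloor> = \<lceil>N * x i\<rceil> \<and> \<bar>\<lfloor>N * x i\<rfloor>\<bar> = int N"
          using i0(1) by blast
      qed
      moreover have "x \<in> cell (idx x)" unfolding cell_iff idx_def by simp
      ultimately show "x \<in> (\<Union>c\<in>\<C>. cell c)" by blast
    qed
    have small: "f ` cell c \<subseteq> U \<or> f ` cell c \<subseteq> V" if c: "c \<in> \<C>" for c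
    proof -
      have sub: "cell c \<subseteq> ?S" using union c by blast
      have "dist x y \<le> 2 * (1 / N)" if "x \<in> cell c" "y \<in> cell c" for x y
      proof (rule dist_fun_le)
        fix i
        have "snd c i \<le> fst c i + 1" using c unfolding \<C>_def by auto
        then have "real_of_int (snd c i) \<le> of_int (fst c i) + 1" by linarith
        moreover have "of_int (fst c i) \<le> N * x i" "N * x i \<le> of_int (snd c i)"
          "of_int (fst c i) \<le> N * y i" "N * y i \<le> of_int (snd c i)"
          using that unfolding cell_iff by auto
        ultimately have "\<bar>N * x i - N * y i\<bar> \<le> 1" by linarith
        then have "real N * \<bar>x i - y i\<bar> \<le> 1" by (simp add: abs_mult flip: right_diff_distrib)
        then show "\<bar>x i - y i\<bar> \<le> 1 / N" using N0 by (simp add: field_simps)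
      qed
      then have "diameter (cell c) \<le> 2 / N"
        unfolding diameter_def by (auto intro!: cSUP_least)
      then obtain B where "B \<in> {U1, V1}" "cell c \<subseteq> B" using \<delta>(2)[OF sub] N0 by force
      then show ?thesis using UV sub by blast
    qed
    have dm_less: "dm c < d" if c: "c \<in> \<C>" for c
    proof -
      obtain i0 where i0: "i0 < d" "fst c i0 = snd c i0" using c unfolding \<C>_def by auto
      have "{i. fst c i < snd c i} \<subseteq> {..<d} - {i0}" using support[OF c] i0 by auto
      then have "dm c \<le> card ({..<d} - {i0})" unfolding dm_def by (intro card_mono) auto
      then show ?thesis using i0(1) by simp
    qed
    \<comment> \<open>Cells mapped into both sets get the carrier \<open>U \<inter> V\<close>,
      except in the top dimension, where the intersection need not fill the prism. A proper face is
      never a top cell, which makes carriers monotone: the face is carried by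
      \<open>U \<inter> V\<close>, or by the one set that its image, and so that of every larger
      cell, forces.\<close>
    define car where "car c = (if Suc (dm c) = d then if f ` cell c \<subseteq> U then U else V
      else if f ` cell c \<subseteq> U \<inter> V then U \<inter> V else if f ` cell c \<subseteq> U then U else V)" for c
    have car_cases: "car c = U \<or> car c = V \<or> car c = U \<inter> V \<and> Suc (dm c) \<noteq> d" for c
      unfolding car_def by auto
    have "\<exists>h. continuous_on ((\<Union>c\<in>\<C>. cell c) \<times> {0..1::real}) h \<and> h ` ((\<Union>c\<in>\<C>. cell c) \<times> {0..1}) \<subseteq> X \<and>
      (\<forall>x\<in>\<Union>c\<in>\<C>. cell c. h (x, 0) = f x \<and> h (x, 1) = c0)"
    proof (rule skeletal_homotopy[where idx = idx and dm = dm and car = car])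
      show "closed (cell c)" for c unfolding cell_def by (rule closed_cbx)
      show "car c' \<subseteq> car c" if "c \<in> \<C>" "c' \<in> \<C>" "cell c' \<subseteq> cell c" "dm c' < dm c" for c c'
      proof -
        have "Suc (dm c') \<noteq> d" using that dm_less[of c] by linarith
        have sub: "f ` cell c' \<subseteq> f ` cell c" using that(3) by (rule image_mono)
        have small': "f ` cell c' \<subseteq> U \<or> f ` cell c' \<subseteq> V" by (rule small[OF that(2)])
        consider "f ` cell c' \<subseteq> U \<inter> V" | "f ` cell c' \<subseteq> U" "\<not> f ` cell c' \<subseteq> V"
          | "f ` cell c' \<subseteq> V" "\<not> f ` cell c' \<subseteq> U"
          using small' by (metis Int_subset_iff)
        then show ?thesis
        proof cases
          case 1
          then show ?thesis using \<open>Suc (dm c') \<noteq> d\<close> car_cases[of c] unfolding car_def[of c'] by auto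
        next
          case 2
          then have "\<not> f ` cell c \<subseteq> V" using sub by (metis order_trans)
          then have "car c = U" using small[OF that(1)] unfolding car_def by auto
          moreover have "car c' = U" using 2 unfolding car_def by auto
          ultimately show ?thesis by simp
        next
          case 3
          then have "\<not> f ` cell c \<subseteq> U" using sub by (metis order_trans)
          then have "car c = V" using small[OF that(1)] unfolding car_def by auto
          moreover have "car c' = V" using 3 unfolding car_def by auto
          ultimately show ?thesis by simp
        qed
      qed
      \<comment> \<open>Coordinate \<open>d\<close> vanishes on all cells and is free to serve as
        time.\<close>
      show "extendable (cell c \<times> {0..1::real}) ({x\<in>cell c. idx x \<noteq> c} \<times> {0..1} \<union> cell c \<times> {0, 1}) (car c)"
        if c: "c \<in> \<C>" for c
        unfolding bd[OF c] unfolding cell_def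
      proof (rule extendable_cbx_times_interval[where k = d])
        have J: "{i. of_int (fst c i) / real N < of_int (snd c i) / real N} = {i. fst c i < snd c i}"
          using N0 by (simp add: divide_less_cancel)
        show "of_int (fst c i) / real N \<le> of_int (snd c i) / real N" for i
          using c N0 unfolding \<C>_def by (auto intro!: divide_right_mono)
        show "finite {i. of_int (fst c i) / real N < of_int (snd c i) / real N}"
          unfolding J by (rule fin_support[OF c])
        show "of_int (fst c d) / real N = 0" "of_int (snd c d) / real N = 0"
          using c unfolding \<C>_def by auto
        have "fills (Suc (dm c)) (car c)"
          using car_cases[of c] fills dm_less[OF c] d by auto
        then show "fills (Suc (card {i. of_int (fst c i) / real N < of_int (snd c i) / real N})) (car c)"
          unfolding J dm_def .
      qed
      show "continuous_on (cell c) f" if "c \<in> \<C>" for c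
        by (rule continuous_on_subset[OF f(1)]) (use union that in auto)
      show "f ` cell c \<subseteq> car c" if "c \<in> \<C>" for c using small[OF that] unfolding car_def by auto
      show "c0 \<in> car c" for c using car_cases[of c] c0 by blast
      show "car c \<subseteq> X" for c using car_cases[of c] X by blast
    qed (use fin\<C> idx in auto)
    then obtain h where h: "continuous_on (?S \<times> {0..1::real}) h" "h ` (?S \<times> {0..1}) \<subseteq> X"
      "\<forall>x\<in>?S. h (x, 0) = f x \<and> h (x, 1) = c0"
      unfolding union by blast
    \<comment> \<open>The homotopy ends in the constant \<open>c0\<close>, which extends to the
      ball.\<close>
    have "\<exists>G. continuous_on (gball d (supnorm d)) G \<and> G ` gball d (supnorm d) \<subseteq> X \<and> (\<forall>x\<in>?S. G x = h (x, 0))"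
      by (rule homotopy_extends[OF gauge_norm_supnorm h(1,2), of "\<lambda>x. c0"]) (use h(3) c0 X in auto)
    then show "\<exists>g. continuous_on (gball d (supnorm d)) g \<and> g ` gball d (supnorm d) \<subseteq> X \<and> (\<forall>x\<in>?S. g x = f x)"
      using h(3) by metis
  qed
qed

section \<open>Simplicial complexes and neighbourhood complexes\<close>

definition realization :: "'a set set \<Rightarrow> ('a \<Rightarrow> real) set" where
  "realization K = {x. (\<forall>v. 0 \<le> x v) \<and> {v. x v \<noteq> 0} \<in> K \<and> (\<Sum>v | x v \<noteq> 0. x v) = 1}"

definition abstract_complex :: "'a set \<Rightarrow> 'a set set \<Rightarrow> bool" where
  "abstract_complex W K \<longleftrightarrow> finite W \<and> K \<subseteq> Pow W \<and> (\<forall>\<sigma>\<in>K. \<forall>\<tau>\<subseteq>\<sigma>. \<tau> \<in> K)"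

lemma abstract_complexD:
  assumes "abstract_complex W K"
  shows "finite W" "\<sigma> \<in> K \<Longrightarrow> \<sigma> \<subseteq> W" "\<sigma> \<in> K \<Longrightarrow> \<tau> \<subseteq> \<sigma> \<Longrightarrow> \<tau> \<in> K"
  using assms unfolding abstract_complex_def by auto

lemma in_realization_iff:
  assumes "abstract_complex W K"
  shows "x \<in> realization K \<longleftrightarrow> (\<forall>v. 0 \<le> x v) \<and> {v. x v \<noteq> 0} \<in> K \<and> (\<Sum>v\<in>W. x v) = 1"
proof -
  have "(\<Sum>v | x v \<noteq> 0. x v) = (\<Sum>v\<in>W. x v)" if "{v. x v \<noteq> 0} \<in> K"
    by (rule sum.mono_neutral_left) (use abstract_complexD[OF assms] that in auto)
  then show ?thesis unfolding realization_def by auto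
qed

lemma realizationI:
  assumes K: "abstract_complex W K" and "\<And>v. 0 \<le> x v" "(\<Sum>v\<in>W. x v) = 1"
    and "{v. x v \<noteq> 0} \<subseteq> \<sigma>" "\<sigma> \<in> K"
  shows "x \<in> realization K"
  unfolding in_realization_iff[OF K] using assms abstract_complexD(3)[OF K] by blast

lemma continuous_on_coord_fst: "continuous_on (A \<times> B) (\<lambda>z. (fst z :: 'i \<Rightarrow> real) v)"
  by (rule continuous_on_compose2[OF continuous_on_coordinate[of UNIV v] continuous_on_fst[OF continuous_on_id]]) simp

text \<open>Straight-line contraction to the vertex \<open>p\<close>: the supports along the way lie
  in \<open>insert p \<sigma>\<close>.\<close>

lemma fills_cone:
  assumes K: "abstract_complex W K" "K \<noteq> {}" and p: "\<And>\<sigma>. \<sigma> \<in> K \<Longrightarrow> insert p \<sigma> \<in> K"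
  shows "fills d (realization K)"
proof -
  let ?e = "\<lambda>v. if v = p then 1 else (0::real)"
  define h where "h z = (\<lambda>v. (1 - snd z) * fst z v + snd z * ?e v)" for z :: "('a \<Rightarrow> real) \<times> real"
  obtain \<sigma> where "\<sigma> \<in> K" using K by blast
  then have pK: "insert p \<sigma> \<in> K" using p by blast
  then have pW: "p \<in> W" using abstract_complexD(2)[OF K(1)] by blast
  have e_sum: "(\<Sum>v\<in>W. ?e v) = 1" using pW abstract_complexD(1)[OF K(1)] by simp
  show ?thesis
  proof (rule fills_contracts)
    show "?e \<in> realization K"
      by (rule realizationI[OF K(1) _ e_sum _ pK]) auto
    have "continuous_on (realization K \<times> {0..1}) (\<lambda>z. h z v)" for v
      unfolding h_def by (intro continuous_intros continuous_on_coord_fst)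
    then show "continuous_on (realization K \<times> {0..1}) h" by (rule continuous_on_coordinatewise_then_product)
    show "h ` (realization K \<times> {0..1}) \<subseteq> realization K"
    proof safe
      fix x t assume x: "x \<in> realization K" and t: "t \<in> {0..1::real}"
      then have x': "\<And>v. 0 \<le> x v" "{v. x v \<noteq> 0} \<in> K" "(\<Sum>v\<in>W. x v) = 1"
        using in_realization_iff[OF K(1)] by auto
      show "h (x, t) \<in> realization K"
      proof (rule realizationI[OF K(1) _ _ _ p[OF x'(2)]])
        show "0 \<le> h (x, t) v" for v using x'(1) t unfolding h_def by auto
        show "(\<Sum>v\<in>W. h (x, t) v) = 1"
          unfolding h_def fst_conv snd_conv
          by (simp only: sum.distrib sum_distrib_left[symmetric] x'(3) e_sum) simp
        show "{v. h (x, t) v \<noteq> 0} \<subseteq> insert p {v. x v \<noteq> 0}" unfolding h_def by auto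
      qed
    qed
  qed (auto simp: h_def)
qed

text \<open>
  The realization is covered by the complement of the barycentre of \<open>Q\<close>, which retracts to the
  deletion of \<open>Q\<close>, and the open star of \<open>Q\<close>, which is contractible; the intersection of the
  two retracts to the join of the boundary of \<open>Q\<close> with the link of \<open>Q\<close>. All these
  deformations are expressed by means of the smallest coordinate at a vertex of \<open>Q\<close>.
\<close>

lemma fills_star_deletion:
  assumes K: "abstract_complex W K" and Q: "Q \<in> K" "Q \<noteq> {}"
    and del: "\<And>d. d \<le> D \<Longrightarrow> fills d (realization {\<sigma>\<in>K. \<not> Q \<subseteq> \<sigma>})"
    and link: "\<And>d. d < D \<Longrightarrow> fills d (realization {\<sigma>\<in>K. \<not> Q \<subseteq> \<sigma> \<and> \<sigma> \<union> Q \<in> K})"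
    and d: "d \<le> D"
  shows "fills d (realization K)"
proof -
  let ?del = "{\<sigma>\<in>K. \<not> Q \<subseteq> \<sigma>}" and ?link = "{\<sigma>\<in>K. \<not> Q \<subseteq> \<sigma> \<and> \<sigma> \<union> Q \<in> K}"
  note KD = abstract_complexD[OF K]
  have QW: "Q \<subseteq> W" and finQ: "finite Q" using KD(1,2) Q finite_subset by blast+
  have del_cplx: "abstract_complex W ?del"
    using K unfolding abstract_complex_def by auto
  have link_cplx: "abstract_complex W ?link"
    unfolding abstract_complex_def
  proof (intro conjI ballI allI impI KD(1))
    show "?link \<subseteq> Pow W" using KD(2) by auto
    fix \<sigma> \<tau> assume \<sigma>: "\<sigma> \<in> ?link" "\<tau> \<subseteq> \<sigma>"
    then have "\<tau> \<in> K" "\<tau> \<union> Q \<in> K"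
      using KD(3)[of \<sigma> \<tau>] KD(3)[of "\<sigma> \<union> Q" "\<tau> \<union> Q"] by auto
    then show "\<tau> \<in> ?link" using \<sigma> by auto
  qed
  define q where "q = real (card Q)"
  have q: "0 < q" using finQ Q unfolding q_def by (simp add: card_gt_0_iff)
  \<comment> \<open>\<open>q * \<mu> x\<close> is the largest weight with which the barycentre
    \<open>b\<close> of \<open>Q\<close> can be split off from \<open>x\<close>; it is zero iff the
    support of \<open>x\<close> omits a vertex of \<open>Q\<close>.\<close>
  define \<mu> where "\<mu> x = Min ((\<lambda>v. x v) ` Q)" for x :: "'a \<Rightarrow> real"
  have \<mu>_le: "\<mu> x \<le> x v" if "v \<in> Q" for x v using that finQ unfolding \<mu>_def by simp
  have \<mu>_ex: "\<exists>v\<in>Q. x v = \<mu> x" for x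
  proof -
    have "\<mu> x \<in> (\<lambda>v. x v) ` Q" unfolding \<mu>_def using finQ Q by (intro Min_in) auto
    then show ?thesis by auto
  qed
  have \<mu>_cont: "continuous_on UNIV \<mu>"
    unfolding \<mu>_def using finQ Q by (intro continuous_on_Min_image continuous_on_coordinate)
  have \<mu>_cont_fst: "continuous_on (A \<times> B) (\<lambda>z. \<mu> (fst z))" for A and B :: "real set"
    by (rule continuous_on_compose2[OF \<mu>_cont continuous_on_fst[OF continuous_on_id]]) simp
  have \<mu>_nonneg: "0 \<le> \<mu> x" if "x \<in> realization K" for x
    using \<mu>_ex[of x] that in_realization_iff[OF K] by metis
  have \<mu>_pos_iff: "0 < \<mu> x \<longleftrightarrow> Q \<subseteq> {v. x v \<noteq> 0}" if "x \<in> realization K" for x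
  proof -
    have "x v \<noteq> 0 \<longleftrightarrow> 0 < x v" for v using that in_realization_iff[OF K] by (auto simp: less_le)
    moreover obtain v where "v \<in> Q" "x v = \<mu> x" using \<mu>_ex by blast
    ultimately show ?thesis using \<mu>_le[of _ x] by (auto intro: less_le_trans)
  qed
  \<comment> \<open>Among points of the realization \<open>q * \<mu> x = 1\<close> holds for the
    barycentre of \<open>Q\<close> alone, so \<open>U\<close> is the complement of that point, and
    \<open>V\<close> is the open star.\<close>
  define U where "U = {x\<in>realization K. q * \<mu> x < 1}"
  define V where "V = {x\<in>realization K. 0 < \<mu> x}"
  define b where "b v = (if v \<in> Q then 1 / q else 0)" for v
  \<comment> \<open>The part \<open>t\<close> of the maximal multiple of the barycentre is
    subtracted and the rest renormalized: \<open>nz 0\<close> is the identity, and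
    \<open>nz 1\<close> makes a coordinate of \<open>Q\<close> vanish.\<close>
  define nz where "nz t x = (\<lambda>v. (x v - (if v \<in> Q then t * \<mu> x else 0)) / (1 - t * (q * \<mu> x)))"
    for t :: real and x :: "'a \<Rightarrow> real"
  have sum_if: "(\<Sum>v\<in>W. if v \<in> Q then c else 0) = q * c" for c :: real
    using QW KD(1) by (simp add: sum.If_cases Int_absorb1 q_def)
  have b_sum: "(\<Sum>v\<in>W. b v) = 1" unfolding b_def using sum_if[of "1 / q"] q by simp
  have tq: "t * (q * \<mu> x) < 1" if "x \<in> U" "0 \<le> t" "t \<le> 1" for t x
  proof -
    have "0 \<le> q * \<mu> x" using \<mu>_nonneg that(1) q unfolding U_def by auto
    then have "t * (q * \<mu> x) \<le> q * \<mu> x" using that by (simp add: mult_left_le_one_le)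
    then show ?thesis using that(1) unfolding U_def by auto
  qed
  have nz: "nz t x \<in> U" "{v. nz t x v \<noteq> 0} \<subseteq> {v. x v \<noteq> 0}" if x: "x \<in> U" and t: "0 \<le> t" "t \<le> 1" for t x
  proof -
    have xK: "x \<in> realization K" using x unfolding U_def by simp
    then have x': "\<And>v. 0 \<le> x v" "{v. x v \<noteq> 0} \<in> K" "(\<Sum>v\<in>W. x v) = 1"
      using in_realization_iff[OF K] by auto
    note tq = tq[OF x t]
    have le: "t * \<mu> x \<le> x v" if "v \<in> Q" for v
      using \<mu>_le[OF that, of x] \<mu>_nonneg[OF xK] t by (meson mult_left_le_one_le order_trans)
    show sub: "{v. nz t x v \<noteq> 0} \<subseteq> {v. x v \<noteq> 0}"
    proof
      fix v assume "v \<in> {v. nz t x v \<noteq> 0}"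
      then have *: "x v - (if v \<in> Q then t * \<mu> x else 0) \<noteq> 0" unfolding nz_def by auto
      have "x v \<noteq> 0"
      proof
        assume "x v = 0"
        then have "t * \<mu> x = 0" if "v \<in> Q" using le[OF that] \<mu>_nonneg[OF xK] t
          by (metis mult_nonneg_nonneg order_antisym)
        then show False using * \<open>x v = 0\<close> by (cases "v \<in> Q") auto
      qed
      then show "v \<in> {v. x v \<noteq> 0}" by simp
    qed
    have "nz t x \<in> realization K"
    proof (rule realizationI[OF K _ _ sub x'(2)])
      show "0 \<le> nz t x v" for v unfolding nz_def using tq x'(1) le by (auto intro: divide_nonneg_pos)
      have "(\<Sum>v\<in>W. nz t x v) = (\<Sum>v\<in>W. x v - (if v \<in> Q then t * \<mu> x else 0)) / (1 - t * (q * \<mu> x))"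
        unfolding nz_def by (simp add: sum_divide_distrib)
      also have "\<dots> = (1 - q * (t * \<mu> x)) / (1 - t * (q * \<mu> x))" by (simp add: sum_subtractf x'(3) sum_if)
      also have "\<dots> = 1" using tq by (simp add: mult.left_commute)
      finally show "(\<Sum>v\<in>W. nz t x v) = 1" .
    qed
    moreover have "q * \<mu> (nz t x) < 1"
    proof -
      obtain v where v: "v \<in> Q" "x v = \<mu> x" using \<mu>_ex by blast
      have "q * \<mu> (nz t x) \<le> q * nz t x v" using \<mu>_le[OF v(1)] q by simp
      also have "\<dots> = (q * \<mu> x - t * (q * \<mu> x)) / (1 - t * (q * \<mu> x))"
        unfolding nz_def using v by (simp add: right_diff_distrib mult.left_commute)
      also have "\<dots> < 1" using tq x unfolding U_def by simp
      finally show ?thesis .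
    qed
    ultimately show "nz t x \<in> U" unfolding U_def by simp
  qed
  have nz1: "\<not> Q \<subseteq> {v. nz 1 x v \<noteq> 0}" for x
  proof -
    obtain v where "v \<in> Q" "x v = \<mu> x" using \<mu>_ex by blast
    then have "nz 1 x v = 0" unfolding nz_def by simp
    then show ?thesis using \<open>v \<in> Q\<close> by blast
  qed
  have nz_cont: "continuous_on (A \<times> {0..1}) (\<lambda>z. nz (snd z) (fst z))" if "A \<subseteq> U" for A
  proof (rule continuous_on_coordinatewise_then_product)
    fix v
    have "1 - snd z * (q * \<mu> (fst z)) \<noteq> 0" if "z \<in> A \<times> {0..1}" for z
      using tq[of "fst z" "snd z"] that \<open>A \<subseteq> U\<close> by auto
    then show "continuous_on (A \<times> {0..1}) (\<lambda>z. nz (snd z) (fst z) v)"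
      unfolding nz_def by (cases "v \<in> Q") (auto intro!: continuous_intros continuous_on_coord_fst \<mu>_cont_fst)
  qed
  have nz1_cont: "continuous_on A (nz 1)" if "A \<subseteq> U" for A
  proof -
    have "continuous_on A (\<lambda>x. (x, 1::real))" "(\<lambda>x. (x, 1::real)) ` A \<subseteq> A \<times> {0..1}"
      by (auto intro: continuous_on_Pair)
    from continuous_on_compose2[OF nz_cont[OF that] this]
    show ?thesis by simp
  qed
  have realization_subset: "realization ?del \<subseteq> U"
  proof
    fix x assume "x \<in> realization ?del"
    then have "x \<in> realization K" "\<not> Q \<subseteq> {v. x v \<noteq> 0}"
      using in_realization_iff[OF del_cplx] in_realization_iff[OF K] by auto
    moreover from this have "\<mu> x = 0" using \<mu>_pos_iff[of x] \<mu>_nonneg[of x] by simp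
    ultimately show "x \<in> U" unfolding U_def by simp
  qed
  have fills_U: "fills d U" if "d \<le> D" for d
  proof (rule fills_dominated[where r = "nz 1" and i = "\<lambda>x. x" and h = "\<lambda>z. nz (snd z) (fst z)"])
    show "nz 1 ` U \<subseteq> realization ?del"
    proof safe
      fix x assume x: "x \<in> U"
      then have "nz 1 x \<in> realization K" using nz(1)[of x 1] unfolding U_def by auto
      then show "nz 1 x \<in> realization ?del" using nz1[of x]
        unfolding in_realization_iff[OF del_cplx] in_realization_iff[OF K] by simp
    qed
    show "(\<lambda>z. nz (snd z) (fst z)) ` (U \<times> {0..1}) \<subseteq> U" using nz(1) by auto
    show "nz (snd (x, 0)) (fst (x, 0::real)) = x" for x unfolding nz_def by (simp add: fun_eq_iff)
  qed (use nz1_cont nz_cont realization_subset del that in auto)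
  have comb: "(\<lambda>v. (1 - s) * y v + s * b v) \<in> realization K" if y: "y \<in> realization K"
    and yQ: "{v. y v \<noteq> 0} \<union> Q \<in> K" and s: "0 \<le> s" "s \<le> 1" for s y
  proof (rule realizationI[OF K _ _ _ yQ])
    have y': "\<And>v. 0 \<le> y v" "(\<Sum>v\<in>W. y v) = 1" using y in_realization_iff[OF K] by auto
    show "0 \<le> (1 - s) * y v + s * b v" for v using y'(1) s q unfolding b_def by auto
    show "(\<Sum>v\<in>W. (1 - s) * y v + s * b v) = 1"
      by (simp only: sum.distrib sum_distrib_left[symmetric] y'(2) b_sum) simp
  qed (auto simp: b_def)
  have V_supp: "Q \<subseteq> {v. x v \<noteq> 0}" "{v. x v \<noteq> 0} \<union> Q \<in> K" if "x \<in> V" for x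
  proof -
    show "Q \<subseteq> {v. x v \<noteq> 0}" using \<mu>_pos_iff that unfolding V_def by blast
    then show "{v. x v \<noteq> 0} \<union> Q \<in> K" using that in_realization_iff[OF K] unfolding V_def
      by (simp add: Un_absorb2)
  qed
  have fills_V: "fills d V" for d
  proof (rule fills_contracts[where b = b and h = "\<lambda>z v. (1 - snd z) * fst z v + snd z * b v"])
    have bK: "b \<in> realization K"
      by (rule realizationI[OF K _ b_sum _ Q(1)]) (use q in \<open>auto simp: b_def\<close>)
    then show "b \<in> V" using \<mu>_pos_iff[OF bK] q unfolding V_def b_def by auto
    have "continuous_on (V \<times> {0..1}) (\<lambda>z. (1 - snd z) * fst z v + snd z * b v)" for v
      by (intro continuous_intros continuous_on_coord_fst)
    then show "continuous_on (V \<times> {0..1}) (\<lambda>z v. (1 - snd z) * fst z v + snd z * b v)"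
      by (rule continuous_on_coordinatewise_then_product)
    show "(\<lambda>z v. (1 - snd z) * fst z v + snd z * b v) ` (V \<times> {0..1}) \<subseteq> V"
    proof safe
      fix x t assume x: "x \<in> V" and t: "t \<in> {0..1::real}"
      let ?y = "\<lambda>v. (1 - t) * x v + t * b v"
      have y: "?y \<in> realization K" using comb[of x t] V_supp[OF x] x t unfolding V_def by auto
      have "?y v \<noteq> 0" if "v \<in> Q" for v
      proof -
        have "0 < x v" using \<mu>_le[OF that, of x] x unfolding V_def by auto
        moreover have "0 < b v" using that q unfolding b_def by simp
        ultimately have "0 < ?y v" using t by (cases "t = 0") (auto intro: add_nonneg_pos)
        then show ?thesis by simp
      qed
      then have "0 < \<mu> ?y" using \<mu>_pos_iff[OF y] by blast
      then show "(\<lambda>v. (1 - snd (x, t)) * fst (x, t) v + snd (x, t) * b v) \<in> V"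
        using y unfolding V_def by simp
    qed
  qed auto
  \<comment> \<open>A point of \<open>?link\<close> has a vanishing coordinate on \<open>Q\<close>,
    where the mixture takes the value \<open>s / q\<close>; hence the minimum of the mixture over
    \<open>Q\<close> is positive and below \<open>1 / q\<close>.\<close>
  have comb_UV: "(\<lambda>v. (1 - s) * y v + s * b v) \<in> U \<inter> V" if y: "y \<in> realization ?link" and s: "0 < s" "s < 1" for s y
  proof -
    let ?z = "\<lambda>v. (1 - s) * y v + s * b v"
    have y': "\<And>v. 0 \<le> y v" "\<not> Q \<subseteq> {v. y v \<noteq> 0}" "{v. y v \<noteq> 0} \<union> Q \<in> K" "y \<in> realization K"
      using y unfolding in_realization_iff[OF link_cplx] in_realization_iff[OF K] by auto
    have z: "?z \<in> realization K" using comb[OF y'(4,3)] s by auto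
    have "?z v \<noteq> 0" if "v \<in> Q" for v
    proof -
      have "0 < s * b v" using that q s unfolding b_def by simp
      moreover have "0 \<le> (1 - s) * y v" using y' s by simp
      ultimately show ?thesis by linarith
    qed
    then have "0 < \<mu> ?z" using \<mu>_pos_iff[OF z] by blast
    moreover obtain v0 where v0: "v0 \<in> Q" "y v0 = 0" using y'(2) by blast
    then have "q * \<mu> ?z \<le> q * ?z v0" using \<mu>_le[OF v0(1), of ?z] q by simp
    then have "q * \<mu> ?z < 1" using v0 q s unfolding b_def by simp
    ultimately show ?thesis using z unfolding U_def V_def by auto
  qed
  have nz_link: "nz 1 x \<in> realization ?link" if "x \<in> U \<inter> V" for x
  proof -
    have "nz 1 x \<in> realization K" "{v. nz 1 x v \<noteq> 0} \<subseteq> {v. x v \<noteq> 0}"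
      using nz[of x 1] that unfolding U_def by auto
    moreover from this have "{v. nz 1 x v \<noteq> 0} \<union> Q \<in> K" using V_supp[of x] that KD(3) by blast
    ultimately show ?thesis using nz1[of x] unfolding in_realization_iff[OF link_cplx] in_realization_iff[OF K] by simp
  qed
  \<comment> \<open>With weight \<open>q * \<mu> x\<close> the mixture of \<open>nz 1 x\<close> and
    \<open>b\<close> gives back \<open>x\<close>. Moving the weight linearly to 1/2 deforms
    \<open>U \<inter> V\<close> onto a copy of the join in the middle.\<close>
  define s where "s z = (1 - snd z) * (q * \<mu> (fst z)) + snd z / 2" for z :: "('a \<Rightarrow> real) \<times> real"
  define h where "h z = (\<lambda>v. (1 - s z) * nz 1 (fst z) v + s z * b v)" for z
  have s01: "0 < s (x, t) \<and> s (x, t) < 1" if x: "x \<in> U \<inter> V" and t: "t \<in> {0..1}" for x t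
  proof -
    have m: "0 < q * \<mu> x" "q * \<mu> x < 1" using x q unfolding U_def V_def by auto
    have t': "0 \<le> t" "t \<le> 1" using t by auto
    have "(1 - t) * (q * \<mu> x) + t * (1 / 2) < 1"
      by (rule convex_bound_lt) (use m t' in auto)
    moreover have "(1 - t) * (- (q * \<mu> x)) + t * (- (1 / 2)) < 0"
      by (rule convex_bound_lt) (use m t' in auto)
    ultimately show ?thesis unfolding s_def by simp
  qed
  have fills_UV: "fills d (U \<inter> V)" if "d < D" for d
  proof (rule fills_dominated[where r = "nz 1" and i = "\<lambda>y v. (1 - 1/2) * y v + 1/2 * b v" and h = h])
    show "continuous_on (U \<inter> V) (nz 1)" by (rule nz1_cont) simp
    show "nz 1 ` (U \<inter> V) \<subseteq> realization ?link" using nz_link by blast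
    have "continuous_on (realization ?link) (\<lambda>y. (1 - 1/2) * y v + 1/2 * b v)" for v
      by (intro continuous_intros continuous_on_coordinate)
    then show "continuous_on (realization ?link) (\<lambda>y v. (1 - 1/2) * y v + 1/2 * b v)"
      by (rule continuous_on_coordinatewise_then_product)
    show "(\<lambda>y v. (1 - 1/2) * y v + 1/2 * b v) ` realization ?link \<subseteq> U \<inter> V"
      using comb_UV[of _ "1/2"] by auto
    have c1: "continuous_on ((U \<inter> V) \<times> {0..1::real}) (\<lambda>z. nz 1 (fst z))"
      by (rule continuous_on_compose2[OF nz1_cont[of "U \<inter> V"] continuous_on_fst[OF continuous_on_id]]) auto
    have c2: "continuous_on ((U \<inter> V) \<times> {0..1::real}) s"
      unfolding s_def by (intro continuous_intros \<mu>_cont_fst) simp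
    have "continuous_on ((U \<inter> V) \<times> {0..1}) (\<lambda>z. h z v)" for v
      unfolding h_def by (intro continuous_intros c2 continuous_on_product_then_coordinatewise[OF c1])
    then show "continuous_on ((U \<inter> V) \<times> {0..1}) h" by (rule continuous_on_coordinatewise_then_product)
    show "h ` ((U \<inter> V) \<times> {0..1}) \<subseteq> U \<inter> V"
      using comb_UV nz_link s01 unfolding h_def by auto
    show "h (x, 0) = x" if "x \<in> U \<inter> V" for x
    proof
      fix v
      have m: "q * \<mu> x < 1" using that unfolding U_def by auto
      show "h (x, 0) v = x v" using m q unfolding h_def s_def nz_def b_def by auto
    qed
    show "h (x, 1) = (\<lambda>v. (1 - 1/2) * nz 1 x v + 1/2 * b v)" for x unfolding h_def s_def by simp
  qed (use link that in auto)
  have "realization K = U \<union> V" using \<mu>_nonneg unfolding U_def V_def by (auto simp: less_le)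
  moreover have "openin (top_of_set (realization K)) U"
  proof -
    have "open {x. q * \<mu> x < 1}" using \<mu>_cont by (intro open_Collect_less continuous_intros)
    moreover have "U = realization K \<inter> {x. q * \<mu> x < 1}" unfolding U_def by blast
    ultimately show ?thesis by (simp add: openin_open_Int)
  qed
  moreover have "openin (top_of_set (realization K)) V"
  proof -
    have "open {x. 0 < \<mu> x}" using \<mu>_cont by (intro open_Collect_less continuous_intros)
    moreover have "V = realization K \<inter> {x. 0 < \<mu> x}" unfolding V_def by blast
    ultimately show ?thesis by (simp add: openin_open_Int)
  qed
  ultimately show ?thesis by (rule fills_Un) (use fills_U fills_V fills_UV d in auto)
qed

text \<open>The boundary of a simplex with \<open>m\<close> vertices is an
  \<open>(m - 2)\<close>-sphere. With one vertex removed, the deletion is the full simplex on the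
  others, a cone, and the link is the boundary of that simplex, of one dimension less.\<close>

lemma fills_simplex_boundary:
  assumes "finite Q" "d + 2 \<le> card Q"
  shows "fills d (realization {\<sigma>. \<sigma> \<subset> Q})"
  using assms
proof (induction Q arbitrary: d rule: finite_induct)
  case (insert v Q)
  let ?K = "{\<sigma>. \<sigma> \<subset> insert v Q}"
  have K: "abstract_complex (insert v Q) ?K"
    using insert.hyps unfolding abstract_complex_def by auto
  obtain p where p: "p \<in> Q" using insert by fastforce
  have Kd: "{\<sigma>\<in>?K. \<not> {v} \<subseteq> \<sigma>} = Pow Q" using insert.hyps by auto
  have Kl: "{\<sigma>\<in>?K. \<not> {v} \<subseteq> \<sigma> \<and> \<sigma> \<union> {v} \<in> ?K} = {\<sigma>. \<sigma> \<subset> Q}" using insert.hyps by auto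
  show ?case
  proof (rule fills_star_deletion[OF K, of "{v}" d])
    show "{v} \<in> ?K" using p insert.hyps by auto
    show "fills d' (realization {\<sigma>\<in>?K. \<not> {v} \<subseteq> \<sigma>})" for d'
      unfolding Kd by (rule fills_cone[of Q _ p]) (use p insert.hyps in \<open>auto simp: abstract_complex_def\<close>)
    show "fills d' (realization {\<sigma>\<in>?K. \<not> {v} \<subseteq> \<sigma> \<and> \<sigma> \<union> {v} \<in> ?K})" if "d' < d" for d'
      unfolding Kl using insert that by auto
  qed auto
qed simp

section \<open>Lower bound for the connectivity of neighbourhood complexes\<close>

context sgraph
begin

definition ncx :: "'a set \<Rightarrow> 'a set set" where
  "ncx W = {\<sigma>. \<sigma> \<subseteq> W \<and> (\<exists>w\<in>W. \<forall>v\<in>\<sigma>. E v w)}"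

text \<open>With \<open>Q\<close> the neighbourhood of \<open>v\<close> and \<open>X\<close> the
  other vertices this is the link of \<open>v\<close> in the neighbourhood complex:
  \<open>\<sigma> \<union> {v}\<close> has a common neighbour iff \<open>\<sigma>\<close> has one in
  \<open>Q\<close>.\<close>

definition link_complex :: "'a set \<Rightarrow> 'a set \<Rightarrow> 'a set set" where
  "link_complex Q X = {\<sigma>. \<sigma> \<subseteq> X \<and> (\<exists>q\<in>Q. \<forall>x\<in>\<sigma>. E x q)}"

lemma ncx_complex: "finite W \<Longrightarrow> abstract_complex W (ncx W)"
  unfolding abstract_complex_def ncx_def by blast

lemma link_complex_complex: "finite X \<Longrightarrow> abstract_complex X (link_complex Q X)"
  unfolding abstract_complex_def link_complex_def by blast

lemma ncx_clique:
  assumes "clique Q"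
  shows "ncx Q = {\<sigma>. \<sigma> \<subset> Q}"
proof (intro Set.set_eqI iffI)
  fix \<sigma> assume "\<sigma> \<in> ncx Q"
  then show "\<sigma> \<in> {\<sigma>. \<sigma> \<subset> Q}" using E_irrefl unfolding ncx_def by auto
next
  fix \<sigma> assume "\<sigma> \<in> {\<sigma>. \<sigma> \<subset> Q}"
  then obtain q where q: "\<sigma> \<subseteq> Q" "q \<in> Q" "q \<notin> \<sigma>" by blast
  have "E x q" if "x \<in> \<sigma>" for x
  proof -
    have "x \<in> Q" "x \<noteq> q" using that q by auto
    then show ?thesis using q(2) assms unfolding clique_def by auto
  qed
  then show "\<sigma> \<in> ncx Q" using q unfolding ncx_def by auto
qed

text \<open>Without \<open>U\<close> this is the boundary of the simplex \<open>Q\<close>. The link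
  of an added vertex \<open>u\<close> is a cone whose apex is any \<open>p \<in> Q\<close> not
  adjacent to \<open>u\<close>: a common neighbour \<open>q \<in> Q\<close> of \<open>u\<close> and
  \<open>\<sigma>\<close> differs from \<open>p\<close>, so it is adjacent to \<open>p\<close> as
  well.\<close>

lemma fills_link_complex:
  assumes "finite U" "finite Q" "clique Q" "U \<inter> Q = {}" "d + 2 \<le> card Q"
    and "\<And>u. u \<in> U \<Longrightarrow> \<exists>p\<in>Q. \<not> E p u"
  shows "fills d (realization (link_complex Q (Q \<union> U)))"
  using assms(1,4,5,6)
proof (induction U arbitrary: d rule: finite_induct)
  case empty
  have "link_complex Q Q = {\<sigma>. \<sigma> \<subset> Q}"
    using ncx_clique[OF assms(3)] unfolding link_complex_def ncx_def by simp
  then show ?case using fills_simplex_boundary assms(2) empty by simp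
next
  case (insert u U)
  let ?K = "link_complex Q (Q \<union> insert u U)"
  have K: "abstract_complex (Q \<union> insert u U) ?K"
    using insert.hyps assms(2) by (intro link_complex_complex) auto
  have IH: "fills d' (realization (link_complex Q (Q \<union> U)))" if "d' \<le> d" for d'
    using insert.IH[of d'] insert.prems that by auto
  have Kd: "{\<sigma>\<in>?K. \<not> {u} \<subseteq> \<sigma>} = link_complex Q (Q \<union> U)"
    using insert.hyps insert.prems(1) unfolding link_complex_def by auto
  show ?case
  proof (cases "{u} \<in> ?K")
    case False
    then have "{\<sigma>\<in>?K. \<not> {u} \<subseteq> \<sigma>} = ?K"
      using abstract_complexD(3)[OF K, of _ "{u}"] by auto
    then have "?K = link_complex Q (Q \<union> U)" using Kd by simp
    then show ?thesis using IH by simp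
  next
    case True
    obtain p where p: "p \<in> Q" "\<not> E p u" using insert.prems by blast
    let ?L = "{\<sigma>\<in>?K. \<not> {u} \<subseteq> \<sigma> \<and> \<sigma> \<union> {u} \<in> ?K}"
    show ?thesis
    proof (rule fills_star_deletion[OF K True, of d])
      show "fills d' (realization ?L)" for d'
      proof (rule fills_cone[where p = p])
        show "abstract_complex (Q \<union> insert u U) ?L"

          unfolding abstract_complex_def
        proof (intro conjI ballI allI impI abstract_complexD(1)[OF K])
          show "?L \<subseteq> Pow (Q \<union> insert u U)" using abstract_complexD(2)[OF K] by blast
          fix \<sigma> \<tau> assume \<sigma>: "\<sigma> \<in> ?L" "\<tau> \<subseteq> \<sigma>"
          then have "\<tau> \<in> ?K" "\<tau> \<union> {u} \<in> ?K"
            using abstract_complexD(3)[OF K, of \<sigma> \<tau>]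
              abstract_complexD(3)[OF K, of "\<sigma> \<union> {u}" "\<tau> \<union> {u}"] by auto
          then show "\<tau> \<in> ?L" using \<sigma> by auto
        qed
        have "{} \<in> ?L" using True unfolding link_complex_def by auto
        then show "?L \<noteq> {}" by blast
        fix \<sigma> assume \<sigma>: "\<sigma> \<in> ?L"
        then obtain q where q: "q \<in> Q" "E u q" "\<forall>x\<in>\<sigma>. E x q" unfolding link_complex_def by auto
        have "q \<noteq> p" using q p E_sym by blast
        then have "E p q" using p(1) q(1) assms(3) unfolding clique_def by metis
        moreover have "p \<noteq> u" using p insert.prems by blast
        ultimately show "insert p \<sigma> \<in> ?L" using \<sigma> q p unfolding link_complex_def by auto
      qed
    qed (use Kd IH in auto)
  qed
qed

text \<open>The clique \<open>C\<close> replaces stiffness, which need not pass to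
  \<open>W - {v}\<close>. The deleted vertex \<open>v\<close> is chosen outside \<open>C\<close>, so
  the hypotheses persist until \<open>W\<close> is a clique with at least \<open>r + 2\<close>
  vertices.\<close>

theorem fills_ncx:
  assumes "finite W" "chordal_on W" "sep_order_ge r W" "clique C" "C \<subseteq> W" "card C = r + 2" "d \<le> r"
  shows "fills d (realization (ncx W))"
  using assms(1-3,5,7)
proof (induction "card W" arbitrary: W d rule: less_induct)
  case less
  note fin = less.prems(1)
  show ?case
  proof (cases "clique W")
    case True
    have "r + 2 \<le> card W" using card_mono[OF fin less.prems(4)] assms(6) by simp
    then show ?thesis unfolding ncx_clique[OF True] using fin less.prems by (intro fills_simplex_boundary) auto
  next
    case False
    obtain v where v: "simplicial W v" "v \<notin> C"
      using ex_simplicial_not_in_clique[OF fin less.prems(2) False assms(4)] by blast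
    have vW: "v \<in> W" using v unfolding simplicial_def by blast
    define Q where "Q = nbh W v"
    define W' where "W' = W - {v}"
    have W': "finite W'" "chordal_on W'" "sep_order_ge r W'"
      using fin chordal_on_subset[OF less.prems(2)] sep_order_ge_remove_simplicial[OF v(1) less.prems(3)]
      unfolding W'_def by auto
    have IH: "fills d (realization (ncx W'))" if "d \<le> r" for d
    proof (rule less.hyps[OF _ W'])
      show "card W' < card W" unfolding W'_def using fin vW by (meson card_Diff1_less)
      show "C \<subseteq> W'" using v less.prems(4) unfolding W'_def by blast
    qed (rule that)
    have Q: "clique Q" "Q \<subseteq> W'" "finite Q"
      using v E_irrefl fin unfolding Q_def W'_def simplicial_def nbh_def by auto
    have degQ: "r \<le> card Q" "Q \<noteq> W'"
      using simplicial_degree[OF v(1) False less.prems(3)] unfolding Q_def W'_def by auto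
    let ?common = "\<exists>w\<in>W'. \<forall>q\<in>Q. E q w"
    \<comment> \<open>If \<open>Q\<close> had at most \<open>r\<close> vertices, it would have a
      common neighbour in \<open>W'\<close> by \<open>small_clique_extends\<close>.\<close>
    have big: "r + 1 \<le> card Q" if "\<not> ?common"
    proof (rule ccontr)
      assume "\<not> ?thesis"
      then have "card Q \<le> r" by simp
      then obtain w where "w \<in> W' - Q" "Q \<subseteq> nbh W' w"
        using small_clique_extends[OF W' Q(1,2) degQ(2)] by blast
      then have "w \<in> W'" "\<forall>q\<in>Q. E q w" using E_sym unfolding nbh_def by auto
      then show False using that by blast
    qed
    have Q_proper: "\<sigma> \<in> ncx W'" if \<sigma>: "\<sigma> \<subset> Q" for \<sigma>
    proof -
      have "\<sigma> \<in> ncx Q" using \<sigma> ncx_clique[OF Q(1)] by simp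
      then show ?thesis using Q(2) unfolding ncx_def by blast
    qed
    let ?K = "ncx W"
    \<comment> \<open>Here \<open>v\<close> is no longer a vertex of the complex but still available
      as a common neighbour; this is why \<open>Q\<close> is a simplex of
      \<open>?K1\<close>.\<close>
    let ?K1 = "{\<sigma>\<in>?K. \<not> {v} \<subseteq> \<sigma>}"
    have K: "abstract_complex W ?K" using ncx_complex[OF fin] .
    have K1: "abstract_complex W ?K1" using K unfolding abstract_complex_def by auto
    have K1_eq: "?K1 = ncx W' \<union> Pow Q"
    proof (intro Set.set_eqI iffI)
      fix \<sigma> assume "\<sigma> \<in> ?K1"
      then obtain w where w: "\<sigma> \<subseteq> W'" "w \<in> W" "\<forall>x\<in>\<sigma>. E x w" unfolding ncx_def W'_def by auto
      show "\<sigma> \<in> ncx W' \<union> Pow Q"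
      proof (cases "w = v")
        case True
        then have "\<sigma> \<subseteq> Q" using w E_sym unfolding Q_def nbh_def W'_def by auto
        then show ?thesis by blast
      next
        case False
        then show ?thesis using w unfolding ncx_def W'_def by auto
      qed
    next
      fix \<sigma> assume "\<sigma> \<in> ncx W' \<union> Pow Q"
      then show "\<sigma> \<in> ?K1"
      proof
        assume "\<sigma> \<in> ncx W'" then show ?thesis unfolding ncx_def W'_def by auto
      next
        assume "\<sigma> \<in> Pow Q"
        then have "\<sigma> \<subseteq> W'" "\<forall>x\<in>\<sigma>. E x v" using Q E_sym unfolding Q_def nbh_def by auto
        then show ?thesis using vW unfolding ncx_def W'_def by auto
      qed
    qed
    have fills_K1: "fills d (realization ?K1)" if d: "d \<le> r" for d
    proof (cases ?common)
      case True
      then have "Pow Q \<subseteq> ncx W'" using Q(2) unfolding ncx_def by blast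
      then have "?K1 = ncx W'" unfolding K1_eq by blast
      then show ?thesis using IH[OF d] by simp
    next
      case False
      have Qn: "Q \<notin> ncx W'" using False unfolding ncx_def by blast
      have ncx_Q: "\<not> Q \<subseteq> \<sigma>" if "\<sigma> \<in> ncx W'" for \<sigma>
        using that Qn abstract_complexD(3)[OF ncx_complex[OF W'(1)]] by blast
      have "C \<subseteq> W'" "C \<noteq> {}" using less.prems(4) v assms(6) unfolding W'_def by auto
      then have "W' \<noteq> {}" by blast
      then have "Q \<noteq> {}" using False by blast
      show ?thesis
      proof (rule fills_star_deletion[OF K1 _ \<open>Q \<noteq> {}\<close>, of r])
        show "Q \<in> ?K1" unfolding K1_eq by blast
        \<comment> \<open>\<open>Q\<close> is a maximal simplex of \<open>?K1\<close> that is absent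
          from \<open>ncx W'\<close>: deleting it gives back \<open>ncx W'\<close>, and it is
          attached along its boundary.\<close>
        have "{\<sigma>\<in>?K1. \<not> Q \<subseteq> \<sigma>} = ncx W'" unfolding K1_eq using ncx_Q Q_proper by blast
        then show "fills d (realization {\<sigma>\<in>?K1. \<not> Q \<subseteq> \<sigma>})" if "d \<le> r" for d using IH[OF that] by simp
        have "{\<sigma>\<in>?K1. \<not> Q \<subseteq> \<sigma> \<and> \<sigma> \<union> Q \<in> ?K1} = {\<sigma>. \<sigma> \<subset> Q}"
          unfolding K1_eq using ncx_Q Q_proper by blast
        then show "fills d (realization {\<sigma>\<in>?K1. \<not> Q \<subseteq> \<sigma> \<and> \<sigma> \<union> Q \<in> ?K1})" if "d < r" for d
          using fills_simplex_boundary[OF Q(3), of d] big[OF False] that by simp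
      qed (rule d)
    qed
    show ?thesis
    proof (cases "{v} \<in> ?K")
      case False
      then have "?K = ?K1" using abstract_complexD(3)[OF K] by blast
      then show ?thesis using fills_K1 less.prems(5) by metis
    next
      case True
      have link: "{\<sigma>\<in>?K. \<not> {v} \<subseteq> \<sigma> \<and> \<sigma> \<union> {v} \<in> ?K} = link_complex Q W'"
      proof (intro Set.set_eqI iffI)
        fix \<sigma> assume "\<sigma> \<in> {\<sigma>\<in>?K. \<not> {v} \<subseteq> \<sigma> \<and> \<sigma> \<union> {v} \<in> ?K}"
        then obtain w where "\<sigma> \<subseteq> W" "v \<notin> \<sigma>" "w \<in> W" "E v w" "\<forall>x\<in>\<sigma>. E x w" unfolding ncx_def by auto
        then show "\<sigma> \<in> link_complex Q W'" unfolding link_complex_def Q_def nbh_def W'_def by auto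
      next
        fix \<sigma> assume "\<sigma> \<in> link_complex Q W'"
        then obtain w where "\<sigma> \<subseteq> W'" "w \<in> W" "E v w" "\<forall>x\<in>\<sigma>. E x w"
          unfolding link_complex_def Q_def nbh_def by auto
        then show "\<sigma> \<in> {\<sigma>\<in>?K. \<not> {v} \<subseteq> \<sigma> \<and> \<sigma> \<union> {v} \<in> ?K}" using vW unfolding ncx_def W'_def by auto
      qed
      have "Q \<noteq> {}" using True unfolding ncx_def Q_def nbh_def by auto
      show ?thesis
      proof (rule fills_star_deletion[OF K True, of r])
        show "fills d (realization {\<sigma>\<in>?K. \<not> {v} \<subseteq> \<sigma> \<and> \<sigma> \<union> {v} \<in> ?K})" if "d < r" for d
          unfolding link
        proof (cases ?common)
          case True
          then obtain w where w: "w \<in> W'" "\<forall>q\<in>Q. E q w" by blast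
          show "fills d (realization (link_complex Q W'))"
          proof (rule fills_cone[OF link_complex_complex[OF W'(1)], of _ w])
            show "link_complex Q W' \<noteq> {}" using \<open>Q \<noteq> {}\<close> unfolding link_complex_def by blast
            show "insert w \<sigma> \<in> link_complex Q W'" if "\<sigma> \<in> link_complex Q W'" for \<sigma>
              using that w E_sym unfolding link_complex_def by auto
          qed
        next
          case False
          \<comment> \<open>The vertices outside \<open>Q\<close> play the role of \<open>U\<close>;
            that each of them misses a neighbour in \<open>Q\<close> is the failure of
            \<open>?common\<close>.\<close>
          have "fills d (realization (link_complex Q (Q \<union> (W' - Q))))"
          proof (rule fills_link_complex)
            show "d + 2 \<le> card Q" using big[OF False] that by simp
          qed (use W' Q False in auto)
          moreover have "Q \<union> (W' - Q) = W'" using Q(2) by blast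
          ultimately show "fills d (realization (link_complex Q W'))" by simp
        qed
      qed (use fills_K1 less.prems(5) in auto)
    qed
  qed
qed

end

section \<open>Simplices and the upper bound\<close>

text \<open>
  Up to the centring translation and the choice of \<open>d\<close> of the \<open>d + 1\<close> barycentric coordinates, the
  unit ball of this asymmetric norm is the \<open>d\<close>-simplex.
\<close>

definition simplex_coord :: "nat \<Rightarrow> (nat \<Rightarrow> real) \<Rightarrow> nat \<Rightarrow> real" where
  "simplex_coord d y k = (if k < d then - y k else (\<Sum>i<d. y i))"

definition simplex_norm :: "nat \<Rightarrow> (nat \<Rightarrow> real) \<Rightarrow> real" where
  "simplex_norm d y = real (Suc d) * Max ((\<lambda>k. simplex_coord d y k) ` {..d})"

lemma continuous_on_simplex_coord: "continuous_on A (\<lambda>y. simplex_coord d y k)"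
  unfolding simplex_coord_def by (cases "k < d") (auto intro!: continuous_intros continuous_on_coordinate)

lemma sum_simplex_coord: "(\<Sum>k\<le>d. simplex_coord d y k) = 0"
proof -
  have "(\<Sum>k\<le>d. simplex_coord d y k) = (\<Sum>k<d. - y k) + (\<Sum>i<d. y i)"
    unfolding simplex_coord_def by (simp add: lessThan_Suc_atMost[symmetric])
  then show ?thesis by (simp add: sum_negf)
qed

text \<open>The differences \<open>1 / (d + 1) - simplex_coord d y k\<close> are the barycentric
  coordinates, so the right-hand side says that they are nonnegative; the factor
  \<open>Suc d\<close> in the norm is chosen for this.\<close>

lemma simplex_norm_le_iff:
  "simplex_norm d y \<le> 1 \<longleftrightarrow> (\<forall>k\<le>d. simplex_coord d y k \<le> 1 / real (Suc d))"
proof -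
  have "simplex_norm d y \<le> 1 \<longleftrightarrow> Max ((\<lambda>k. simplex_coord d y k) ` {..d}) \<le> 1 / real (Suc d)"
    unfolding simplex_norm_def by (simp add: field_simps)
  also have "\<dots> \<longleftrightarrow> (\<forall>k\<le>d. simplex_coord d y k \<le> 1 / real (Suc d))" by (subst Max_le_iff) auto
  finally show ?thesis .
qed

lemma simplex_norm_eq_iff:
  "simplex_norm d y = 1 \<longleftrightarrow> (\<forall>k\<le>d. simplex_coord d y k \<le> 1 / real (Suc d)) \<and>
    (\<exists>k\<le>d. simplex_coord d y k = 1 / real (Suc d))"
proof -
  have "simplex_norm d y = 1 \<longleftrightarrow> Max ((\<lambda>k. simplex_coord d y k) ` {..d}) = 1 / real (Suc d)"
    unfolding simplex_norm_def by (simp add: field_simps)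
  also have "\<dots> \<longleftrightarrow> (\<forall>k\<le>d. simplex_coord d y k \<le> 1 / real (Suc d)) \<and>
    (\<exists>k\<le>d. simplex_coord d y k = 1 / real (Suc d))"
  proof (subst Max_eq_iff)
    show "(1 / real (Suc d) \<in> simplex_coord d y ` {..d} \<and>
        (\<forall>a\<in>simplex_coord d y ` {..d}. a \<le> 1 / real (Suc d))) \<longleftrightarrow>
      (\<forall>k\<le>d. simplex_coord d y k \<le> 1 / real (Suc d)) \<and> (\<exists>k\<le>d. simplex_coord d y k = 1 / real (Suc d))"
      by (auto simp: image_iff simp del: of_nat_Suc) (metis atMost_iff)
  qed auto
  finally show ?thesis .
qed

lemma gauge_norm_simplex_norm: "gauge_norm d (simplex_norm d)"
  unfolding gauge_norm_def
proof (intro conjI ballI allI impI)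
  show "continuous_on UNIV (simplex_norm d)"
    unfolding simplex_norm_def
    by (intro continuous_intros continuous_on_Max_image continuous_on_simplex_coord) auto
  show "simplex_norm d (scl c x) = c * simplex_norm d x" if "0 \<le> c" for c x
  proof -
    have "mono (\<lambda>y. c * y)" using that by (simp add: mono_def mult_left_mono)
    then have "c * Max ((\<lambda>k. simplex_coord d x k) ` {..d}) = Max ((\<lambda>y. c * y) ` ((\<lambda>k. simplex_coord d x k) ` {..d}))"
      by (intro mono_Max_commute) auto
    also have "(\<lambda>y. c * y) ` ((\<lambda>k. simplex_coord d x k) ` {..d}) = (\<lambda>k. simplex_coord d (scl c x) k) ` {..d}"
      unfolding image_image by (intro image_cong refl) (simp add: simplex_coord_def scl_def sum_distrib_left)
    finally show ?thesis unfolding simplex_norm_def by simp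
  qed
  show "0 < simplex_norm d x" if x: "x \<in> espace d" "x \<noteq> (\<lambda>i. 0)" for x
  proof (rule ccontr)
    assume "\<not> ?thesis"
    then have "Max ((\<lambda>k. simplex_coord d x k) ` {..d}) \<le> 0"
      unfolding simplex_norm_def by (metis linorder_not_le mult_pos_pos of_nat_0_less_iff zero_less_Suc)
    \<comment> \<open>As the coordinates have sum 0, all of them vanish if none is positive.\<close>
    then have c: "simplex_coord d x k \<le> 0" if "k \<le> d" for k using that by (subst (asm) Max_le_iff) auto
    have nonneg: "0 \<le> x k" if "k < d" for k using c[of k] that unfolding simplex_coord_def by simp
    have "(\<Sum>i<d. x i) \<le> 0" using c[of d] unfolding simplex_coord_def by simp
    moreover have "0 \<le> (\<Sum>i<d. x i)" using nonneg by (intro sum_nonneg) simp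
    ultimately have "(\<Sum>i<d. x i) = 0" by simp
    moreover have "(\<Sum>i<d. x i) = 0 \<longleftrightarrow> (\<forall>i\<in>{..<d}. x i = 0)"
      using nonneg by (intro sum_nonneg_eq_0_iff) auto
    ultimately have "x k = 0" if "k < d" for k using that by simp
    then have "x k = 0" for k using x(1) unfolding espace_def by (cases "k < d") auto
    then show False using x(2) by auto
  qed
qed

lemma in_simplex_iff:
  assumes "finite T"
  shows "x \<in> realization (Pow T) \<longleftrightarrow> (\<forall>v. 0 \<le> x v) \<and> (\<forall>v. v \<notin> T \<longrightarrow> x v = 0) \<and> (\<Sum>v\<in>T. x v) = 1"
proof -
  have "abstract_complex T (Pow T)" using assms unfolding abstract_complex_def by auto
  from in_realization_iff[OF this] show ?thesis by auto
qed

lemma in_simplex_boundary_iff: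
  assumes "finite T"
  shows "x \<in> realization {\<sigma>. \<sigma> \<subset> T} \<longleftrightarrow> x \<in> realization (Pow T) \<and> (\<exists>t\<in>T. x t = 0)"
proof -
  have "abstract_complex T {\<sigma>. \<sigma> \<subset> T}" "abstract_complex T (Pow T)"
    using assms unfolding abstract_complex_def by auto
  from in_realization_iff[OF this(1)] in_realization_iff[OF this(2)] show ?thesis by auto
qed

lemma realization_mono: "K \<subseteq> L \<Longrightarrow> realization K \<subseteq> realization L"
  unfolding realization_def by auto

text \<open>The map \<open>p\<close> centres the simplex at the origin and drops one barycentric
  coordinate, which \<open>q\<close> recovers from the sum. On the boundary the two are mutually
  inverse: one identity serves to transfer extension problems, the other to identify the boundary
  with a sphere.\<close>

lemma simplex_gball_maps:
  fixes T :: "'a set"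
  assumes T: "finite T" "card T = Suc d"
  obtains p :: "('a \<Rightarrow> real) \<Rightarrow> nat \<Rightarrow> real" and q :: "(nat \<Rightarrow> real) \<Rightarrow> 'a \<Rightarrow> real" where
    "continuous_on (realization (Pow T)) p" "p ` realization (Pow T) \<subseteq> gball d (simplex_norm d)"
    "p ` realization {\<sigma>. \<sigma> \<subset> T} \<subseteq> gsphere d (simplex_norm d)"
    "continuous_on (gsphere d (simplex_norm d)) q" "q ` gsphere d (simplex_norm d) \<subseteq> realization {\<sigma>. \<sigma> \<subset> T}"
    "\<And>x. x \<in> realization {\<sigma>. \<sigma> \<subset> T} \<Longrightarrow> q (p x) = x"
    "\<And>y. y \<in> gsphere d (simplex_norm d) \<Longrightarrow> p (q y) = y"
proof -
  obtain e where e: "bij_betw e {..d} T"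
    using ex_bij_betw_nat_finite[OF T(1)] T(2) by (auto simp: atLeast0LessThan lessThan_Suc_atMost)
  define e' where "e' = the_inv_into {..d} e"
  have e'1: "e' v \<le> d" "e (e' v) = v" if "v \<in> T" for v
    using e that f_the_inv_into_f_bij_betw[OF e] the_inv_into_into[of e "{..d}" v "{..d}"]
    unfolding e'_def by (auto simp: bij_betw_def)
  have e'2: "e k \<in> T" "e' (e k) = k" if "k \<le> d" for k
    using e that unfolding e'_def by (auto simp: bij_betw_def the_inv_into_f_f)
  define c where "c = 1 / real (Suc d)"
  define p where "p x k = (if k < d then x (e k) - c else 0)" for x :: "'a \<Rightarrow> real" and k
  define q where "q y v = (if v \<in> T then c - simplex_coord d y (e' v) else 0)" for y v
  have sum_e: "(\<Sum>v\<in>T. f v) = (\<Sum>k\<le>d. f (e k))" for f :: "'a \<Rightarrow> real"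
    using sum.reindex_bij_betw[OF e, of f] by simp
  have dc: "real d * c = 1 - c" unfolding c_def by (simp add: field_simps)
  have p_coord: "simplex_coord d (p x) k = c - x (e k)" if x: "x \<in> realization (Pow T)" and k: "k \<le> d" for x k
  proof (cases "k < d")
    case False
    then have "k = d" using k by simp
    have "(\<Sum>i<d. x (e i)) + x (e d) = 1"
      using x sum_e[of x] unfolding in_simplex_iff[OF T(1)] by (simp add: lessThan_Suc_atMost[symmetric])
    moreover have "simplex_coord d (p x) d = (\<Sum>i<d. x (e i)) - real d * c"
      unfolding simplex_coord_def p_def by (simp add: sum_subtractf)
    ultimately show ?thesis using dc \<open>k = d\<close> by simp
  qed (simp add: simplex_coord_def p_def)
  have p_espace: "p x \<in> espace d" for x unfolding espace_def p_def by simp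
  have q_bd: "q y \<in> realization {\<sigma>. \<sigma> \<subset> T}" if "y \<in> gsphere d (simplex_norm d)" for y
  proof -
    have y: "\<And>k. k \<le> d \<Longrightarrow> simplex_coord d y k \<le> c" "\<exists>k\<le>d. simplex_coord d y k = c"
      using that unfolding gsphere_def c_def by (auto simp: simplex_norm_eq_iff)
    have "(\<Sum>v\<in>T. q y v) = (\<Sum>k\<le>d. c - simplex_coord d y k)"
      unfolding sum_e by (intro sum.cong refl) (simp add: q_def e'2)
    also have "\<dots> = 1" unfolding sum_subtractf sum_simplex_coord by (simp add: c_def)
    finally have "(\<Sum>v\<in>T. q y v) = 1" .
    moreover have "0 \<le> q y v" for v using y(1) e'1 unfolding q_def by auto
    moreover obtain k where "k \<le> d" "simplex_coord d y k = c" using y(2) by blast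
    then have "\<exists>t\<in>T. q y t = 0" using e'2 by (intro bexI[of _ "e k"]) (auto simp: q_def)
    ultimately show ?thesis unfolding in_simplex_boundary_iff[OF T(1)] in_simplex_iff[OF T(1)]
      by (auto simp: q_def)
  qed
  show thesis
  proof (rule that)
    show "continuous_on (realization (Pow T)) p"
    proof (rule continuous_on_coordinatewise_then_product)
      show "continuous_on (realization (Pow T)) (\<lambda>x. p x k)" for k
        unfolding p_def by (cases "k < d") (auto intro!: continuous_intros continuous_on_coordinate)
    qed
    show "p ` realization (Pow T) \<subseteq> gball d (simplex_norm d)"
    proof safe
      fix x assume x: "x \<in> realization (Pow T)"
      then have "simplex_coord d (p x) k \<le> c" if "k \<le> d" for k
        using p_coord[OF x that] unfolding in_simplex_iff[OF T(1)] by simp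
      then show "p x \<in> gball d (simplex_norm d)"
        using p_espace unfolding gball_def simplex_norm_le_iff c_def by auto
    qed
    show "p ` realization {\<sigma>. \<sigma> \<subset> T} \<subseteq> gsphere d (simplex_norm d)"
    proof safe
      fix x assume "x \<in> realization {\<sigma>. \<sigma> \<subset> T}"
      then obtain t where x: "x \<in> realization (Pow T)" "t \<in> T" "x t = 0"
        unfolding in_simplex_boundary_iff[OF T(1)] by blast
      then have "simplex_coord d (p x) k \<le> c" if "k \<le> d" for k
        using p_coord[OF x(1) that] unfolding in_simplex_iff[OF T(1)] by simp
      moreover have "simplex_coord d (p x) (e' t) = c" using p_coord[OF x(1)] x e'1 by simp
      ultimately show "p x \<in> gsphere d (simplex_norm d)"
        using p_espace e'1[OF x(2)] unfolding gsphere_def simplex_norm_eq_iff c_def by auto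
    qed
    show "continuous_on (gsphere d (simplex_norm d)) q"
    proof (rule continuous_on_coordinatewise_then_product)
      show "continuous_on (gsphere d (simplex_norm d)) (\<lambda>y. q y v)" for v
        unfolding q_def by (cases "v \<in> T") (auto intro!: continuous_intros continuous_on_simplex_coord)
    qed
    show "q ` gsphere d (simplex_norm d) \<subseteq> realization {\<sigma>. \<sigma> \<subset> T}" using q_bd by blast
    show "q (p x) = x" if "x \<in> realization {\<sigma>. \<sigma> \<subset> T}" for x
    proof
      fix v
      have x: "x \<in> realization (Pow T)" using that unfolding in_simplex_boundary_iff[OF T(1)] by blast
      show "q (p x) v = x v"
        using p_coord[OF x] e'1 x unfolding q_def in_simplex_iff[OF T(1)] by auto
    qed
    show "p (q y) = y" if "y \<in> gsphere d (simplex_norm d)" for y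
    proof
      fix k
      show "p (q y) k = y k"
        using that e'2[of k] unfolding p_def q_def gsphere_def espace_def by (auto simp: simplex_coord_def)
    qed
  qed
qed

lemma fills_simplex:
  assumes "finite T" "card T = Suc d" "fills d Y"
  shows "extendable (realization (Pow T)) (realization {\<sigma>. \<sigma> \<subset> T}) Y"
proof -
  obtain p q where pq: "continuous_on (realization (Pow T)) p" "p ` realization (Pow T) \<subseteq> gball d (simplex_norm d)"
    "p ` realization {\<sigma>. \<sigma> \<subset> T} \<subseteq> gsphere d (simplex_norm d)"
    "continuous_on (gsphere d (simplex_norm d)) q" "q ` gsphere d (simplex_norm d) \<subseteq> realization {\<sigma>. \<sigma> \<subset> T}"
    "\<And>x. x \<in> realization {\<sigma>. \<sigma> \<subset> T} \<Longrightarrow> q (p x) = x"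
    by (rule simplex_gball_maps[OF assms(1,2)]) (rule that)
  have "extendable (gball d (simplex_norm d)) (gsphere d (simplex_norm d)) Y"
    using assms(3) fills_iff_gauge gauge_norm_simplex_norm by blast
  then show ?thesis by (rule extendable_transfer) (use pq in auto)
qed

lemma enorm_le_1_iff: "enorm d x \<le> 1 \<longleftrightarrow> (\<Sum>i<d. (x i)\<^sup>2) \<le> 1"
  unfolding enorm_def by simp

lemma enorm_eq_1_iff: "enorm d x = 1 \<longleftrightarrow> (\<Sum>i<d. (x i)\<^sup>2) = 1"
  unfolding enorm_def by simp

lemma nsphere_eq: "nsphere n = top_of_set (gsphere (Suc n) (enorm (Suc n)))"
proof -
  have "{x. (\<Sum>i\<le>n. (x i)\<^sup>2) = 1 \<and> (\<forall>i>n. x i = 0)} = gsphere (Suc n) (enorm (Suc n))"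
    unfolding gsphere_def espace_def enorm_eq_1_iff lessThan_Suc_atMost by (auto simp: Suc_le_eq)
  then show ?thesis unfolding nsphere by (simp add: euclidean_product_topology)
qed

lemma disc_eq: "disc n = top_of_set (gball n (enorm n))"
proof -
  have "{x. \<forall>i\<ge>n. x i = 0} \<inter> {x. (\<Sum>i<n. (x i)\<^sup>2) \<le> 1} = gball n (enorm n)"
    unfolding gball_def espace_def enorm_le_1_iff by auto
  then show ?thesis
    unfolding disc_def Euclidean_space_def subtopology_subtopology by (simp add: euclidean_product_topology)
qed

text \<open>The one fact taken from homology theory; it produces the contradiction behind the upper
  bound.\<close>

lemma not_contractible_gsphere: "\<not> contractible (gsphere (Suc n) (enorm (Suc n)))"
  using non_contractible_space_nsphere[of n] unfolding nsphere_eq by simp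

text \<open>The map would be homotopic to the identity on the boundary, which is a sphere.\<close>

lemma no_face_preserving_map_to_boundary:
  fixes T :: "'a set"
  assumes T: "finite T" "card T = Suc (Suc r)"
    and \<theta>: "continuous_on (realization (Pow T)) \<theta>" "\<theta> ` realization (Pow T) \<subseteq> realization {\<sigma>. \<sigma> \<subset> T}"
    and face: "\<And>x t. x \<in> realization {\<sigma>. \<sigma> \<subset> T} \<Longrightarrow> t \<in> T \<Longrightarrow> x t = 0 \<Longrightarrow> \<theta> x t = 0"
  shows False
proof -
  let ?d = "Suc r"
  let ?S = "gsphere ?d (enorm ?d)" and ?S' = "gsphere ?d (simplex_norm ?d)"
  let ?sx = "realization (Pow T)" and ?bd = "realization {\<sigma>. \<sigma> \<subset> T}"
  obtain p q where pq: "continuous_on ?sx p" "p ` ?bd \<subseteq> ?S'"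
    "continuous_on ?S' q" "q ` ?S' \<subseteq> ?bd" "\<And>y. y \<in> ?S' \<Longrightarrow> p (q y) = y"
    by (rule simplex_gball_maps[OF T]) (rule that)
  define p1 where "p1 x = scl (1 / (simplex_norm ?d x + 1 - enorm ?d x)) x" for x
  define q1 where "q1 x = scl (1 / enorm ?d x) x" for x
  note g = gauge_transfer_maps[OF gauge_norm_simplex_norm[of ?d] gauge_norm_enorm[of ?d], folded p1_def q1_def]
  \<comment> \<open>\<open>P\<close> places the round sphere on the boundary of the simplex, by way
    of the sphere of the simplex gauge, and \<open>R\<close> is a left inverse.\<close>
  define P where "P s = q (p1 s)" for s
  define R where "R x = q1 (p x)" for x
  have SB: "?S \<subseteq> gball ?d (enorm ?d)" unfolding gsphere_def gball_def by auto
  have bd_sx: "?bd \<subseteq> ?sx" by (rule realization_mono) auto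
  have P: "continuous_on ?S P" "P ` ?S \<subseteq> ?bd"
    unfolding P_def using continuous_on_compose2[OF pq(3) continuous_on_subset[OF g(1) SB] g(3)] g(3) pq(4)
    by (auto simp: image_subset_iff)
  have R: "continuous_on ?bd R" "R ` ?bd \<subseteq> ?S"
    unfolding R_def using continuous_on_compose2[OF g(4) continuous_on_subset[OF pq(1) bd_sx] pq(2)] g(5) pq(2)
    by (auto simp: image_subset_iff)
  have RP: "R (P s) = s" if "s \<in> ?S" for s
    using g(3,6) that pq(5) unfolding R_def P_def by (auto simp: image_subset_iff)
  have convex: "(\<lambda>v. (1 - t) * x v + t * y v) \<in> ?sx" if "x \<in> ?sx" "y \<in> ?sx" "0 \<le> t" "t \<le> 1" for x y t
    using that unfolding in_simplex_iff[OF T(1)]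
    by (simp add: sum.distrib flip: sum_distrib_left)
  have P_sx: "P s \<in> ?sx" if "s \<in> ?S" for s using that P(2) bd_sx by blast
  have Pc: "continuous_on ({0..1::real} \<times> ?S) (\<lambda>z. P (snd z) v)" for v
    by (rule continuous_on_product_then_coordinatewise)
      (rule continuous_on_compose2[OF P(1) continuous_on_snd[OF continuous_on_id]], auto)
  \<comment> \<open>The segment from a boundary point to its image lies in a face containing both,
    since \<open>\<theta>\<close> preserves faces; so this homotopy stays in the boundary.\<close>
  define h1 where "h1 z = (\<lambda>v. (1 - fst z) * P (snd z) v + fst z * \<theta> (P (snd z)) v)" for z
  have h1_bd: "h1 (t, s) \<in> ?bd" if "t \<in> {0..1}" "s \<in> ?S" for t s
  proof -
    have Ps: "P s \<in> ?bd" using P that by blast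
    then obtain t0 where t0: "t0 \<in> T" "P s t0 = 0" unfolding in_simplex_boundary_iff[OF T(1)] by blast
    then have "h1 (t, s) t0 = 0" using face[OF Ps] unfolding h1_def by simp
    moreover have "h1 (t, s) \<in> ?sx"
      unfolding h1_def using convex[of "P s" "\<theta> (P s)" t] P_sx[OF that(2)] \<theta>(2) bd_sx that by auto
    ultimately show ?thesis using t0 unfolding in_simplex_boundary_iff[OF T(1)] by blast
  qed
  have c\<theta>: "continuous_on ({0..1::real} \<times> ?S) (\<lambda>z. \<theta> (P (snd z)))"
  proof (rule continuous_on_compose2[OF \<theta>(1)])
    show "continuous_on ({0..1::real} \<times> ?S) (\<lambda>z. P (snd z))"
      by (rule continuous_on_coordinatewise_then_product) (rule Pc)
  qed (use P_sx in auto)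
  have h1c: "continuous_on ({0..1} \<times> ?S) h1"
  proof (rule continuous_on_coordinatewise_then_product)
    show "continuous_on ({0..1} \<times> ?S) (\<lambda>z. h1 z v)" for v
      unfolding h1_def
      by (intro continuous_intros Pc continuous_on_product_then_coordinatewise[OF c\<theta>])
  qed
  obtain b where b: "b \<in> ?bd"
  proof -
    obtain t where t: "t \<in> T" using T by fastforce
    have "T \<noteq> {t}" using T by auto
    then have "(\<lambda>v. if v = t then 1 else 0) \<in> ?bd"
      using t T(1) unfolding in_simplex_boundary_iff[OF T(1)] in_simplex_iff[OF T(1)] by auto
    then show thesis using that by blast
  qed
  \<comment> \<open>Contracts the boundary inside the full simplex; composition with
    \<open>\<theta>\<close> brings the contraction back into the boundary.\<close>
  define h2 where "h2 z = (\<lambda>v. (1 - fst z) * P (snd z) v + fst z * b v)" for z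
  have h2_sx: "h2 (t, s) \<in> ?sx" if "t \<in> {0..1}" "s \<in> ?S" for t s
    unfolding h2_def using convex[of "P s" b t] P_sx[OF that(2)] b bd_sx that by auto
  have h2c: "continuous_on ({0..1} \<times> ?S) h2"
  proof (rule continuous_on_coordinatewise_then_product)
    show "continuous_on ({0..1} \<times> ?S) (\<lambda>z. h2 z v)" for v
      unfolding h2_def by (intro continuous_intros Pc)
  qed
  have "homotopic_with_canon (\<lambda>x. True) ?S ?S (\<lambda>s. R (P s)) (\<lambda>s. R (\<theta> (P s)))"
  proof -
    have "continuous_on ({0..1} \<times> ?S) (\<lambda>z. R (h1 z))"
      by (rule continuous_on_compose2[OF R(1) h1c]) (use h1_bd in auto)
    moreover have "(\<lambda>z. R (h1 z)) ` ({0..1} \<times> ?S) \<subseteq> ?S" using h1_bd R(2) by auto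
    moreover have "R (h1 (0, s)) = R (P s)" "R (h1 (1, s)) = R (\<theta> (P s))" for s
      unfolding h1_def by simp_all
    ultimately show ?thesis unfolding homotopic_with_def
      by (intro exI[of _ "\<lambda>z. R (h1 z)"]) (auto simp: image_subset_iff Pi_iff)
  qed
  moreover have "homotopic_with_canon (\<lambda>x. True) ?S ?S (\<lambda>s. R (\<theta> (P s))) (\<lambda>s. R (\<theta> b))"
  proof -
    have c2: "continuous_on ({0..1} \<times> ?S) (\<lambda>z. \<theta> (h2 z))"
      by (rule continuous_on_compose2[OF \<theta>(1) h2c]) (use h2_sx in auto)
    have "continuous_on ({0..1} \<times> ?S) (\<lambda>z. R (\<theta> (h2 z)))"
      by (rule continuous_on_compose2[OF R(1) c2]) (use h2_sx \<theta>(2) in auto)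
    moreover have "(\<lambda>z. R (\<theta> (h2 z))) ` ({0..1} \<times> ?S) \<subseteq> ?S" using h2_sx \<theta>(2) R(2)
      by (auto simp: image_subset_iff)
    moreover have "R (\<theta> (h2 (0, s))) = R (\<theta> (P s))" "R (\<theta> (h2 (1, s))) = R (\<theta> b)" for s
      unfolding h2_def by simp_all
    ultimately show ?thesis unfolding homotopic_with_def
      by (intro exI[of _ "\<lambda>z. R (\<theta> (h2 z))"]) (auto simp: image_subset_iff Pi_iff)
  qed
  moreover have "homotopic_with_canon (\<lambda>x. True) ?S ?S id (\<lambda>s. R (P s))"
    by (rule homotopic_with_equal) (use RP in auto)
  ultimately have "homotopic_with_canon (\<lambda>x. True) ?S ?S id (\<lambda>s. R (\<theta> b))"
    by (meson homotopic_with_trans)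
  then have "contractible ?S" unfolding contractible_def by blast
  then show False using not_contractible_gsphere by blast
qed

lemma closed_simplex:
  fixes T :: "'a set"
  assumes "finite T"
  shows "closed (realization (Pow T))"
proof -
  have "realization (Pow T) = (\<Inter>v. {x. 0 \<le> x v}) \<inter> (\<Inter>v\<in>-T. {x. x v = 0}) \<inter> {x. (\<Sum>v\<in>T. x v) = 1}"
    using in_simplex_iff[OF assms] by auto
  moreover have "closed {x::'a \<Rightarrow> real. 0 \<le> x v}" "closed {x::'a \<Rightarrow> real. x v = 0}"
    "closed {x::'a \<Rightarrow> real. (\<Sum>v\<in>T. x v) = 1}" for v
    by (intro closed_Collect_le closed_Collect_eq continuous_intros continuous_on_coordinate)+
  ultimately show ?thesis by (auto intro!: closed_Int closed_INT)
qed

section \<open>An essential sphere in the neighbourhood complex\<close>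

context sgraph
begin

lemma simplex_boundary_subset_ncx:
  assumes "clique (insert a S)" "insert a S \<subseteq> W"
  shows "realization {\<sigma>. \<sigma> \<subset> insert a S} \<subseteq> realization (ncx W)"
proof (rule realization_mono)
  have "{\<sigma>. \<sigma> \<subset> insert a S} = ncx (insert a S)" using ncx_clique[OF assms(1)] by simp
  also have "\<dots> \<subseteq> ncx W" using assms(2) unfolding ncx_def by blast
  finally show "{\<sigma>. \<sigma> \<subset> insert a S} \<subseteq> ncx W" .
qed

text \<open>\<open>insert a S\<close> is a clique, so its proper subsets are simplices of
  \<open>ncx (A \<union> S)\<close>, but it need not be one itself. Its boundary is a sphere of
  dimension \<open>card S - 1\<close>, which bounds in this complex by
  \<open>fills_ncx\<close>.\<close>

lemma side_extension:
  assumes "finite W" "chordal_on W" "sep_order_ge (card S) W" "stiff_on W" "separation W A S B"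
  obtains a g where "a \<in> A" "clique (insert a S)"
    "continuous_on (realization (Pow (insert a S))) g"
    "g ` realization (Pow (insert a S)) \<subseteq> realization (ncx (A \<union> S))"
    "\<And>x. x \<in> realization {\<sigma>. \<sigma> \<subset> insert a S} \<Longrightarrow> g x = x"
proof -
  have AS: "A \<union> S \<subseteq> W" "A \<inter> S = {}" using assms(5) unfolding separation_def by auto
  have fin: "finite (A \<union> S)" using AS(1) assms(1) finite_subset by blast
  obtain a where a: "a \<in> A" "S \<subseteq> nbh W a" using separation_side(1)[OF assms] by blast
  obtain C where C: "C \<subseteq> A \<union> S" "clique C" "card C = card S + 2" using separation_side(2)[OF assms] by blast
  have cl: "clique (insert a S)"
    using minimum_separation_clique[OF assms(2,5,3,1)] a clique_insert by blast
  have "fills (card S) (realization (ncx (A \<union> S)))"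
    using fills_ncx[OF fin chordal_on_subset[OF assms(2) AS(1)] separation_side(3)[OF assms] C(2,1,3)] by simp
  moreover have "a \<notin> S" using a(1) AS by blast
  then have "card (insert a S) = Suc (card S)" "finite (insert a S)" using fin by auto
  ultimately have "extendable (realization (Pow (insert a S))) (realization {\<sigma>. \<sigma> \<subset> insert a S})
    (realization (ncx (A \<union> S)))" by (intro fills_simplex)
  moreover have "(\<lambda>x. x) ` realization {\<sigma>. \<sigma> \<subset> insert a S} \<subseteq> realization (ncx (A \<union> S))"
    using simplex_boundary_subset_ncx[OF cl, of "A \<union> S"] a by auto
  ultimately obtain g where "continuous_on (realization (Pow (insert a S))) g"
    "g ` realization (Pow (insert a S)) \<subseteq> realization (ncx (A \<union> S))"
    "\<And>x. x \<in> realization {\<sigma>. \<sigma> \<subset> insert a S} \<Longrightarrow> g x = x"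
    using extendableE[OF _ continuous_on_id] by metis
  then show thesis using that a cl by blast
qed

theorem not_fills_ncx:
  assumes fin: "finite W" and ch: "chordal_on W" and min: "sep_order_ge (card S) W" and st: "stiff_on W"
    and sep: "separation W A S B"
  shows "\<not> fills (Suc (card S)) (realization (ncx W))"
proof
  assume fills: "fills (Suc (card S)) (realization (ncx W))"
  have W: "W = A \<union> S \<union> B" "A \<inter> S = {}" "A \<inter> B = {}" "S \<inter> B = {}" "\<And>x y. x \<in> A \<Longrightarrow> y \<in> B \<Longrightarrow> \<not> E x y"
    using sep unfolding separation_def by auto
  obtain a gA where a: "a \<in> A" "clique (insert a S)"
    and gA: "continuous_on (realization (Pow (insert a S))) gA"
    "gA ` realization (Pow (insert a S)) \<subseteq> realization (ncx (A \<union> S))"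
    "\<And>x. x \<in> realization {\<sigma>. \<sigma> \<subset> insert a S} \<Longrightarrow> gA x = x"
    by (rule side_extension[OF fin ch min st sep]) (rule that)
  obtain b gB where b: "b \<in> B" "clique (insert b S)"
    and gB: "continuous_on (realization (Pow (insert b S))) gB"
    "gB ` realization (Pow (insert b S)) \<subseteq> realization (ncx (B \<union> S))"
    "\<And>x. x \<in> realization {\<sigma>. \<sigma> \<subset> insert b S} \<Longrightarrow> gB x = x"
    by (rule side_extension[OF fin ch min st separation_sym[OF sep]]) (rule that)
  define T where "T = insert a (insert b S)"
  have finA: "finite A" and finS: "finite S" and finB: "finite B" using W(1) fin by auto
  have ab: "a \<noteq> b" "a \<notin> S" "b \<notin> S" "a \<notin> B" "b \<notin> A" using a(1) b(1) W by auto
  have T: "finite T" "card T = Suc (Suc (card S))" using finS ab unfolding T_def by auto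
  have TW: "T \<subseteq> W" using a(1) b(1) W(1) unfolding T_def by blast
  let ?sx = "realization (Pow T)" and ?bd = "realization {\<sigma>. \<sigma> \<subset> T}"
  let ?N = "realization (ncx W)"
  \<comment> \<open>The face opposite \<open>b\<close> is spanned by \<open>insert a S\<close>, the
    one opposite \<open>a\<close> by \<open>insert b S\<close>. On the boundaries of these two
    faces, and so on their intersection, \<open>gA\<close> and \<open>gB\<close> are the identity;
    hence the pieces fit together.\<close>
  define \<psi> where "\<psi> x = (if x b = 0 then gA x else if x a = 0 then gB x else x)" for x
  have face: "x \<in> realization (Pow (T - {t})) \<longleftrightarrow> x \<in> ?sx \<and> x t = 0" if "t \<in> T" for x t
  proof -
    have "(\<Sum>v\<in>T. x v) = (\<Sum>v\<in>T - {t}. x v)" if "x t = 0"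
      using sum.remove[OF T(1) \<open>t \<in> T\<close>, of x] that by simp
    then show ?thesis using T(1) \<open>t \<in> T\<close> by (auto simp: in_simplex_iff)
  qed
  have Tb: "T - {b} = insert a S" and Ta: "T - {a} = insert b S" using ab unfolding T_def by auto
  have abT: "a \<in> T" "b \<in> T" unfolding T_def by auto
  have bdA: "x \<in> realization {\<sigma>. \<sigma> \<subset> insert a S}"
    if "x \<in> ?sx" "x b = 0" "x t = 0" "t \<in> insert a S" for x t
    using face[OF abT(2), of x] that finS unfolding Tb by (auto simp: in_simplex_boundary_iff)
  have bdB: "x \<in> realization {\<sigma>. \<sigma> \<subset> insert b S}"
    if "x \<in> ?sx" "x a = 0" "x t = 0" "t \<in> insert b S" for x t
    using face[OF abT(1), of x] that finS unfolding Ta by (auto simp: in_simplex_boundary_iff)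
  have \<psi>_b: "\<psi> x = gA x" if "x b = 0" for x using that unfolding \<psi>_def by simp
  have \<psi>_a: "\<psi> x = gB x" if "x \<in> ?sx" "x a = 0" for x
  proof (cases "x b = 0")
    case True
    then have "gA x = x" "gB x = x"
      using gA(3)[OF bdA[of x a]] gB(3)[OF bdB[of x b]] that by auto
    then show ?thesis using True unfolding \<psi>_def by simp
  qed (use that in \<open>simp add: \<psi>_def\<close>)
  have \<psi>_s: "\<psi> x = x" if "x \<in> ?sx" "s \<in> S" "x s = 0" for x s
    using gA(3)[OF bdA[of x s]] gB(3)[OF bdB[of x s]] that unfolding \<psi>_def by auto
  have bd: "?bd = (\<Union>t\<in>T. realization (Pow (T - {t})))"
    using in_simplex_boundary_iff[OF T(1)] face by blast
  have "continuous_on (realization (Pow (T - {t}))) \<psi>" if t: "t \<in> T" for t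
  proof -
    consider "t = b" | "t = a" | "t \<in> S" using t unfolding T_def by blast
    then show ?thesis
    proof cases
      case 1
      then show ?thesis using \<psi>_b face[OF t] gA(1) unfolding 1 Tb
        by (intro continuous_on_eq[OF gA(1)]) auto
    next
      case 2
      then show ?thesis using \<psi>_a face[OF t] unfolding 2 Ta
        by (intro continuous_on_eq[OF gB(1)]) auto
    next
      case 3
      then show ?thesis using \<psi>_s face[OF t]
        by (intro continuous_on_eq[OF continuous_on_id]) auto
    qed
  qed
  then have \<psi>_cont: "continuous_on ?bd \<psi>"
    unfolding bd using T(1) by (intro continuous_on_closed_Union closed_simplex) auto
  have \<psi>_N: "\<psi> x \<in> ?N" if x: "x \<in> ?bd" for x
  proof -
    obtain t where t: "t \<in> T" "x \<in> ?sx" "x t = 0" using x in_simplex_boundary_iff[OF T(1)] by blast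
    have ncxAB: "ncx (A \<union> S) \<subseteq> ncx W" "ncx (B \<union> S) \<subseteq> ncx W" unfolding ncx_def W(1) by blast+
    consider "t = b" | "t = a" | "t \<in> S" using t unfolding T_def by blast
    then show ?thesis
    proof cases
      case 1
      then have "x \<in> realization (Pow (insert a S))" using face[OF abT(2), of x] t unfolding Tb by auto
      then show ?thesis using \<psi>_b t 1 gA(2) realization_mono[OF ncxAB(1)] by (auto simp: image_subset_iff)
    next
      case 2
      then have "x \<in> realization (Pow (insert b S))" using face[OF abT(1), of x] t unfolding Ta by auto
      then show ?thesis using \<psi>_a t 2 gB(2) realization_mono[OF ncxAB(2)] by (auto simp: image_subset_iff)
    next
      case 3
      \<comment> \<open>\<open>t \<in> S\<close> is adjacent to \<open>a\<close>, \<open>b\<close>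
        and the rest of \<open>S\<close>, hence a common neighbour of the whole face.\<close>
      have "Pow (T - {t}) \<subseteq> ncx W"
      proof
        fix \<sigma> assume "\<sigma> \<in> Pow (T - {t})"
        moreover have "E v t" if "v \<in> T - {t}" for v
          using that 3 a(2) b(2) unfolding T_def clique_def by auto
        ultimately show "\<sigma> \<in> ncx W" using TW t(1) unfolding ncx_def by auto
      qed
      then have "realization (Pow (T - {t})) \<subseteq> ?N" by (rule realization_mono)
      then have "x \<in> ?N" using face[OF t(1), of x] t(2,3) by auto
      then show ?thesis using \<psi>_s[OF t(2) 3 t(3)] by simp
    qed
  qed
  \<comment> \<open>\<open>T\<close> has \<open>card S + 2\<close> vertices, so the simplex has
    dimension \<open>card S + 1\<close>, the dimension in which fillings are assumed.\<close>
  have "extendable ?sx ?bd ?N" by (rule fills_simplex[OF T fills])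
  then obtain \<Psi> where \<Psi>: "continuous_on ?sx \<Psi>" "\<Psi> ` ?sx \<subseteq> ?N" "\<And>x. x \<in> ?bd \<Longrightarrow> \<Psi> x = \<psi> x"
    using extendableE[OF _ \<psi>_cont] \<psi>_N by (metis image_subsetI)
  \<comment> \<open>In barycentric coordinates the collapse adds up the masses on \<open>A\<close>
    and on \<open>B\<close>.\<close>
  define \<phi> where "\<phi> x v = (if v \<in> S then x v else if v = a then (\<Sum>u\<in>A. x u)
    else if v = b then (\<Sum>u\<in>B. x u) else 0)" for x :: "'a \<Rightarrow> real" and v
  note N_iff = in_realization_iff[OF ncx_complex[OF fin]]
  have \<phi>_bd: "\<phi> x \<in> ?bd" if "x \<in> ?N" for x
  proof -
    have x: "\<And>v. 0 \<le> x v" "{v. x v \<noteq> 0} \<in> ncx W" "(\<Sum>v\<in>W. x v) = 1" using that N_iff by auto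
    have "(\<Sum>v\<in>T. \<phi> x v) = \<phi> x a + (\<phi> x b + (\<Sum>v\<in>S. \<phi> x v))" unfolding T_def using ab finS by simp
    also have "\<dots> = (\<Sum>u\<in>A. x u) + ((\<Sum>u\<in>B. x u) + (\<Sum>v\<in>S. x v))" using ab unfolding \<phi>_def by simp
    also have "\<dots> = (\<Sum>v\<in>W. x v)"
      unfolding W(1) using W(2-4) finA finS finB by (simp add: sum.union_disjoint Int_Un_distrib2)
    finally have sum1: "(\<Sum>v\<in>T. \<phi> x v) = 1" using x(3) by simp
    have nonneg: "0 \<le> \<phi> x v" for v unfolding \<phi>_def using x(1) by (auto intro: sum_nonneg)
    obtain w where w: "w \<in> W" "\<And>v. x v \<noteq> 0 \<Longrightarrow> E v w" using x(2) unfolding ncx_def by auto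
    \<comment> \<open>A common neighbour \<open>w\<close> of the support decides which coordinate
      vanishes: the one at \<open>w\<close> if \<open>w \<in> S\<close>, otherwise the one at the
      vertex of the opposite side, as no edge joins \<open>A\<close> and \<open>B\<close>.\<close>
    have "\<exists>t\<in>T. \<phi> x t = 0"
    proof -
      consider "w \<in> S" | "w \<in> A" | "w \<in> B" using w(1) W(1) by blast
      then show ?thesis
      proof cases
        case 1
        then have "x w = 0" using w(2)[of w] E_irrefl by blast
        then show ?thesis using 1 unfolding \<phi>_def T_def by auto
      next
        case 2
        then have "x v = 0" if "v \<in> B" for v using w(2)[of v] W(5)[of w v] E_sym that by blast
        then have "\<phi> x b = 0" using ab unfolding \<phi>_def by simp
        then show ?thesis unfolding T_def by blast
      next
        case 3
        then have "x v = 0" if "v \<in> A" for v using w(2)[of v] W(5)[of v w] that by blast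
        then have "\<phi> x a = 0" using ab unfolding \<phi>_def by simp
        then show ?thesis unfolding T_def by blast
      qed
    qed
    moreover have "\<phi> x v = 0" if "v \<notin> T" for v using that unfolding \<phi>_def T_def by auto
    ultimately show ?thesis using sum1 nonneg
      unfolding in_simplex_boundary_iff[OF T(1)] in_simplex_iff[OF T(1)] by blast
  qed
  have \<phi>_cont: "continuous_on ?N \<phi>"
  proof (rule continuous_on_coordinatewise_then_product)
    fix v
    have c: "continuous_on ?N (\<lambda>x. x v)" "continuous_on ?N (\<lambda>x. \<Sum>u\<in>A. x u)"
      "continuous_on ?N (\<lambda>x. \<Sum>u\<in>B. x u)"
      by (intro continuous_intros continuous_on_coordinate)+
    show "continuous_on ?N (\<lambda>x. \<phi> x v)"
      unfolding \<phi>_def using c by (cases "v \<in> S"; cases "v = a"; cases "v = b") auto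
  qed
  show False
  proof (rule no_face_preserving_map_to_boundary[OF T, of "\<lambda>x. \<phi> (\<Psi> x)"])
    show "continuous_on ?sx (\<lambda>x. \<phi> (\<Psi> x))" by (rule continuous_on_compose2[OF \<phi>_cont \<Psi>(1,2)])
    show "(\<lambda>x. \<phi> (\<Psi> x)) ` ?sx \<subseteq> ?bd" using \<Psi>(2) \<phi>_bd by (auto simp: image_subset_iff)
    fix x t assume x: "x \<in> ?bd" and t: "t \<in> T" "x t = 0"
    have xs: "x \<in> ?sx" using x in_simplex_boundary_iff[OF T(1)] by blast
    have eq: "\<phi> (\<Psi> x) t = \<phi> (\<psi> x) t" using \<Psi>(3)[OF x] by simp
    consider "t = b" | "t = a" | "t \<in> S" using t unfolding T_def by blast
    then show "\<phi> (\<Psi> x) t = 0"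
    proof cases
      case 1
      \<comment> \<open>\<open>gA\<close> has its values over \<open>A \<union> S\<close>, so no
        mass is put on \<open>B\<close> and the coordinate at \<open>b\<close> stays zero.\<close>
      then have "x \<in> realization (Pow (insert a S))" using face[OF abT(2), of x] t xs unfolding Tb by auto
      then have "gA x \<in> realization (ncx (A \<union> S))" using gA(2) by blast
      then have "{v. gA x v \<noteq> 0} \<subseteq> A \<union> S" unfolding realization_def ncx_def by auto
      then have "gA x v = 0" if "v \<in> B" for v using that W by blast
      then have "\<phi> (gA x) b = 0" using ab unfolding \<phi>_def by simp
      then show ?thesis using eq 1 \<psi>_b t by simp
    next
      case 2
      then have "x \<in> realization (Pow (insert b S))" using face[OF abT(1), of x] t xs unfolding Ta by auto
      then have "gB x \<in> realization (ncx (B \<union> S))" using gB(2) by blast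
      then have "{v. gB x v \<noteq> 0} \<subseteq> B \<union> S" unfolding realization_def ncx_def by auto
      then have "gB x v = 0" if "v \<in> A" for v using that W by blast
      then have "\<phi> (gB x) a = 0" using ab unfolding \<phi>_def by simp
      then show ?thesis using eq 2 \<psi>_a xs t by simp
    next
      case 3
      then show ?thesis using eq \<psi>_s[OF xs 3 t(2)] t(2) unfolding \<phi>_def by simp
    qed
  qed
qed

end

section \<open>Connectivity of graphs and spaces\<close>

lemma set_vwalk_arcs_subset_iff:
  "set (vwalk_arcs p) \<subseteq> R \<longleftrightarrow> successively (\<lambda>u v. (u, v) \<in> R) p"
  by (induction p rule: vwalk_arcs.induct) auto

lemma space_k_connected_iff_fills:
  "space_k_connected k (top_of_set Y) \<longleftrightarrow> fills 0 Y \<and> (\<forall>m. int m \<le> k \<longrightarrow> fills (Suc m) Y)"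
  unfolding space_k_connected_def nsphere_eq disc_eq fills_0 fills_def[of "Suc _"] extendable_def
  by (simp add: image_subset_iff_funcset)

lemma geometric_realization_eq: "geometric_realization K = top_of_set (realization K)"
  unfolding geometric_realization_def realization_def by (simp add: euclidean_product_topology)

text \<open>The shift by one arises because \<open>fills (Suc m)\<close> is the condition for maps
  from the \<open>m\<close>-sphere: filling up to dimension \<open>r\<close> and no further means
  being \<open>k\<close>-connected exactly for \<open>k < r\<close>.\<close>

lemma Conn_eq_iff:
  assumes below: "\<And>d. d \<le> r \<Longrightarrow> fills d Y" and above: "\<not> fills (Suc r) Y"
  shows "Conn (top_of_set Y) = ereal (real n) \<longleftrightarrow> r = n + 1"
proof -
  have conn: "space_k_connected k (top_of_set Y) \<longleftrightarrow> k < int r" for k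
  proof
    assume k: "space_k_connected k (top_of_set Y)"
    show "k < int r"
    proof (rule ccontr)
      assume "\<not> k < int r"
      then have "fills (Suc r) Y" using k unfolding space_k_connected_iff_fills by simp
      then show False using above by blast
    qed
  next
    assume "k < int r"
    then show "space_k_connected k (top_of_set Y)"
      unfolding space_k_connected_iff_fills using below by auto
  qed
  have "Conn (top_of_set Y) = ereal (real_of_int (int r - 1))"
    unfolding Conn_def conn
  proof (rule antisym)
    show "(SUP k\<in>{k. k < int r}. ereal (real_of_int k)) \<le> ereal (real_of_int (int r - 1))"
      by (rule SUP_least) auto
    show "ereal (real_of_int (int r - 1)) \<le> (SUP k\<in>{k. k < int r}. ereal (real_of_int k))"
      by (rule SUP_upper) auto
  qed
  then show ?thesis by auto
qed

section \<open>Translation of the graph notions\<close>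

context
  fixes G :: "'a pair_pre_digraph"
  assumes G: "pair_graph G"
begin

abbreviation (input) adj :: "'a \<Rightarrow> 'a \<Rightarrow> bool" where
  "adj u v \<equiv> (u, v) \<in> parcs G"

interpretation pair_graph G by (rule G)

interpretation sgraph adj
  by unfold_locales (auto intro: arcs_symmetric dest: no_loops')

lemma neighbours_eq_nbh: "neighbours G v = nbh (pverts G) v"
  unfolding neighbours_def nbh_def using in_arcsD2 by auto

lemma neighbourhood_complex_eq_ncx: "neighbourhood_complex G = ncx (pverts G)"
  unfolding neighbourhood_complex_def ncx_def neighbours_def by auto

lemma stiff_imp_stiff_on: "stiff G \<Longrightarrow> stiff_on (pverts G)"
  unfolding stiff_def stiff_on_def neighbours_eq_nbh by blast

lemma clique_imp_complete_graph:
  assumes "clique (pverts G)"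
  shows "complete_graph G"
proof -
  have "parcs G = {(u, v). (u, v) \<in> pverts G \<times> pverts G \<and> u \<noteq> v}"
  proof (rule equalityI; rule subsetI)
    fix e assume e: "e \<in> parcs G"
    obtain u v where "e = (u, v)" by fastforce
    then show "e \<in> {(u, v). (u, v) \<in> pverts G \<times> pverts G \<and> u \<noteq> v}"
      using e in_arcsD1 in_arcsD2 no_loops' by auto
  next
    fix e assume "e \<in> {(u, v). (u, v) \<in> pverts G \<times> pverts G \<and> u \<noteq> v}"
    then show "e \<in> parcs G" using assms unfolding clique_def by auto
  qed
  then show ?thesis
    unfolding complete_graph_def complete_digraph_def using pair_graphD_graph by simp
qed

text \<open>The required isomorphism leads from the induced subgraph to the cycle graph, so it is
  the inverse \<open>d\<close> of the labelling \<open>c\<close>, acting on arcs as on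
  pairs.\<close>

lemma chordal_imp_chordal_on:
  assumes "chordal G"
  shows "chordal_on (pverts G)"
  unfolding chordal_on_def
proof
  assume "\<exists>k\<ge>4. \<exists>c::nat \<Rightarrow> 'a. inj_on c {..<k} \<and> c ` {..<k} \<subseteq> pverts G \<and>
     (\<forall>i<k. \<forall>j<k. adj (c i) (c j) \<longleftrightarrow> j = (i + 1) mod k \<or> i = (j + 1) mod k)"
  then obtain k and c :: "nat \<Rightarrow> 'a" where k: "4 \<le> k" and c: "inj_on c {..<k}" "c ` {..<k} \<subseteq> pverts G"
    and adj: "\<And>i j. i < k \<Longrightarrow> j < k \<Longrightarrow> adj (c i) (c j) \<longleftrightarrow> j = (i + 1) mod k \<or> i = (j + 1) mod k"
    by blast
  define C where "C = c ` {..<k}"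
  define H where "H = with_proj \<lparr>pverts = C, parcs = {(u, v) \<in> parcs G. u \<in> C \<and> v \<in> C}\<rparr>"
  define d where "d = the_inv_into {..<k} c"
  have dc: "d (c i) = i" if "i < k" for i using c(1) that unfolding d_def by (simp add: the_inv_into_f_f)
  have wf: "wf_digraph H" unfolding H_def wf_digraph_def by auto
  have "induced_subgraph H (with_proj G)"
    unfolding induced_subgraph_def subgraph_def compatible_def
    using wf wf_digraph_axioms c(2) unfolding H_def C_def by auto
  moreover have "digraph_iso H (with_proj (cycle_graph k))"
  proof -
    define f where "f = \<lparr>iso_verts = d, iso_arcs = map_prod d d, iso_head = snd, iso_tail = fst\<rparr>"
    have inj_d: "inj_on d C" using dc unfolding C_def by (auto intro!: inj_onI)
    have "inj_on (map_prod d d) (arcs H)"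
      by (rule inj_on_subset[OF map_prod_inj_on[OF inj_d inj_d]]) (auto simp: H_def)
    then have "pre_digraph.digraph_isomorphism H f"
      unfolding pre_digraph.digraph_isomorphism_def using wf inj_d by (auto simp: f_def H_def)
    moreover have "with_proj (cycle_graph k) = app_iso f H"
    proof -
      have v: "d ` C = {..<k}" unfolding C_def image_image using dc by auto
      have a: "map_prod d d ` {(u, v) \<in> parcs G. u \<in> C \<and> v \<in> C} = parcs (cycle_graph k)"
      proof (rule equalityI; rule subsetI)
        fix e assume "e \<in> map_prod d d ` {(u, v) \<in> parcs G. u \<in> C \<and> v \<in> C}"
        then obtain i j where "e = (i, j)" "i < k" "j < k" "adj (c i) (c j)"
          using dc unfolding C_def by auto
        then show "e \<in> parcs (cycle_graph k)" using adj unfolding cycle_graph_def by auto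
      next
        fix e assume "e \<in> parcs (cycle_graph k)"
        then obtain i j where e: "e = (i, j)" "i < k" "j < k" "adj (c i) (c j)"
          using adj unfolding cycle_graph_def by auto
        then have "e = map_prod d d (c i, c j)" using dc by simp
        then show "e \<in> map_prod d d ` {(u, v) \<in> parcs G. u \<in> C \<and> v \<in> C}"
          using e unfolding C_def by blast
      qed
      show ?thesis unfolding app_iso_def f_def H_def using v a by (simp add: with_proj_def cycle_graph_def)
    qed
    ultimately show ?thesis unfolding digraph_iso_def by blast
  qed
  ultimately show False using assms k unfolding chordal_def by blast
qed

lemma internally_disjoint_paths_iff:
  "internally_disjoint_paths G x y P \<and> finite P \<longleftrightarrow> disjoint_paths (pverts G) x y P"
  unfolding internally_disjoint_paths_def disjoint_paths_def path_in_def walk_in_def vpath_def vwalk_def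
    with_proj_simps set_vwalk_arcs_subset_iff by auto

text \<open>The paths from \<open>ex_disjoint_paths\<close> show that \<open>card S\<close> is
  attained; a vertex of \<open>A\<close> and one of \<open>B\<close> show that it is not exceeded.
  These two vertices also provide the bound \<open>Suc (card S) \<le> card ?V\<close>.\<close>

lemma vertex_connectivity_eq:
  assumes ch: "chordal_on (pverts G)" and sep: "separation (pverts G) A S B"
    and min: "sep_order_ge (card S) (pverts G)"
  shows "vertex_connectivity G = card S"
proof -
  let ?V = "pverts G"
  have S: "?V = A \<union> S \<union> B" "A \<inter> S = {}" "A \<inter> B = {}" "S \<inter> B = {}" "A \<noteq> {}" "B \<noteq> {}"
    using sep unfolding separation_def by auto
  obtain x y where xy: "x \<in> A" "y \<in> B" using S(5,6) by blast
  have finS: "finite S" using pair_finite_verts S(1) by auto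
  have xyS: "x \<notin> S" "y \<notin> S" "x \<noteq> y" using xy S(2-4) by auto
  have "card (insert x (insert y S)) \<le> card ?V"
    using xy S(1) by (intro card_mono pair_finite_verts) auto
  then have big: "Suc (card S) \<le> card ?V" using finS xyS by simp
  have "graph_k_connected (card S) G"
    unfolding graph_k_connected_def
    using ex_disjoint_paths[OF pair_finite_verts ch min big] internally_disjoint_paths_iff by metis
  moreover have "k \<le> card S" if "graph_k_connected k G" for k
  proof -
    obtain P where "internally_disjoint_paths G x y P" "finite P" "k \<le> card P"
      using \<open>graph_k_connected k G\<close> xy xyS S(1) unfolding graph_k_connected_def by blast
    moreover from this have "card P \<le> card S"
      using disjoint_paths_card_le[OF sep finS xy] internally_disjoint_paths_iff by blast
    ultimately show ?thesis by simp
  qed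
  ultimately show ?thesis unfolding vertex_connectivity_def by (intro Greatest_equality) auto
qed

text \<open>Both sides are equivalent to \<open>card S = n + 1\<close> for a minimum separator
  \<open>S\<close>, which exists because a graph that is not complete has two non-adjacent
  vertices.\<close>

theorem vertex_connectivity_iff_Conn:
  assumes "\<not> complete_graph G" "stiff G" "chordal G"
  shows "vertex_connectivity G = n + 1 \<longleftrightarrow>
    Conn (geometric_realization (neighbourhood_complex G)) = ereal (real n)"
proof -
  let ?V = "pverts G"
  have ch: "chordal_on ?V" and st: "stiff_on ?V"
    using chordal_imp_chordal_on stiff_imp_stiff_on assms by auto
  have ncl: "\<not> clique ?V" using clique_imp_complete_graph assms by blast
  obtain A S B where sep: "separation ?V A S B" and min: "sep_order_ge (card S) ?V"
    using ex_minimum_separation[OF pair_finite_verts ncl] by blast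
  obtain C where "C \<subseteq> A \<union> S" "clique C" "card C = card S + 2"
    using separation_side(2)[OF pair_finite_verts ch min st sep] by blast
  moreover have "A \<union> S \<subseteq> ?V" using sep unfolding separation_def by blast
  ultimately have "fills d (realization (ncx ?V))" if "d \<le> card S" for d
    using fills_ncx[OF pair_finite_verts ch min, of C] that by blast
  moreover have "\<not> fills (Suc (card S)) (realization (ncx ?V))"
    by (rule not_fills_ncx[OF pair_finite_verts ch min st sep])
  ultimately have "Conn (top_of_set (realization (ncx ?V))) = ereal (real n) \<longleftrightarrow> card S = n + 1"
    by (rule Conn_eq_iff)
  then show ?thesis
    unfolding vertex_connectivity_eq[OF ch sep min] geometric_realization_eq neighbourhood_complex_eq_ncx
    by simp
qed

end

theorem theorem5p10:
  fixes G :: "'a pair_pre_digraph" and n :: nat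
  assumes "pair_graph G"
    and "\<not> complete_graph G"
    and "stiff G"
    and "chordal G"
  shows "vertex_connectivity G = n + 1 \<longleftrightarrow>
    Conn (geometric_realization (neighbourhood_complex G)) = ereal (real n)"
  by (rule vertex_connectivity_iff_Conn[OF assms])

end
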